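(* (1) For each $p$ with $2\le p<\infty$ there exists a closed subspace $N_p$ of $\ell_\infty$ with $c_0\subseteq N_p$ such that the quotient $\ell_\infty/N_p$ is isomorphic to $L_p(0,1)$; moreover, any such $N_p$ is an $\ell_\infty$-Grothendieck subspace. (2) If $2\le p<\infty$, $2\le r<\infty$ and $p\neq r$, and $N_p$, $N_r$ are closed subspaces of $\ell_\infty$ containing $c_0$ with $\ell_\infty/N_p$ isomorphic to $L_p(0,1)$ and $\ell_\infty/N_r$ isomorphic to $L_r(0,1)$, then $N_p$ and $N_r$ are not isomorphic.
   Context: Let $S$ be a closed subspace of $\ell_\infty$ containing $c_0$ and let $j:c_0\to S$ be the inclusion map. Then $j^{**}:c_0^{**}\equiv\ell_\infty\to S^{**}$ identifies $\ell_\infty$ with a subspace of $S^{**}$ containing $S$. A sequence $(x_n^* )$ in $S^*$ is said to be $\sigma(S^*,\ell_\infty)$-convergent to $x^*\in S^*$ if $\langle j^{**}z,x_n^*\rangle\to\langle j^{**}z,x^*\rangle$ for every $z\in\ell_\infty$ (equivalently, the restrictions $j^*x_n^*\in\ell_1$ converge to $j^*x^*$ in the topology $\sigma(\ell_1,\ell_\infty)$). The closed subspace $S$ of $\ell_\infty$ is called an $\ell_\infty$-Grothendieck subspace if $c_0\subseteq S$ and every $\sigma(S^*,S)$-convergent (weak$^*$-convergent) sequence in $S^*$ is $\sigma(S^*,\ell_\infty)$-convergent (to the same limit). *)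

theory Defs
  imports "HOL-Analysis.Analysis"
begin

text \<open>ell_infinity is modelled by the Banach space nat =>C real of bounded
 (automatically continuous) real sequences with the sup norm.\<close>

type_synonym linf = "nat \<Rightarrow>\<^sub>C real"

definition c0 :: "linf set" where
  "c0 = {x. (\<lambda>n. apply_bcontfun x n) \<longlonglongrightarrow> 0}"

definition closed_subspace :: "linf set \<Rightarrow> bool" where
  "closed_subspace S \<longleftrightarrow> subspace S \<and> closed S"

definition unitv :: "nat \<Rightarrow> linf" where
  "unitv k = Bcontfun (\<lambda>n. if n = k then 1 else 0)"

text \<open>Elements of the dual S^*: functionals linear and bounded on S (values
 outside S are irrelevant).\<close>
definition dual_elem :: "linf set \<Rightarrow> (linf \<Rightarrow> real) \<Rightarrow> bool" where
  "dual_elem S f \<longleftrightarrow>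
     (\<forall>x\<in>S. \<forall>y\<in>S. f (x + y) = f x + f y) \<and>
     (\<forall>c. \<forall>x\<in>S. f (c *\<^sub>R x) = c * f x) \<and>
     (\<exists>K. \<forall>x\<in>S. \<bar>f x\<bar> \<le> K * norm x)"

definition weakstar_conv :: "linf set \<Rightarrow> (nat \<Rightarrow> linf \<Rightarrow> real) \<Rightarrow> (linf \<Rightarrow> real) \<Rightarrow> bool" where
  "weakstar_conv S fs f \<longleftrightarrow> (\<forall>x\<in>S. (\<lambda>n. fs n x) \<longlonglongrightarrow> f x)"

text \<open>sigma(S^*,ell_infinity)-convergence: pairing of j** z with x^* equals
 the pairing of z in ell_infinity with j^* x^* in ell_1, i.e. sum_k z_k x^*(e_k).\<close>
definition linf_conv :: "(nat \<Rightarrow> linf \<Rightarrow> real) \<Rightarrow> (linf \<Rightarrow> real) \<Rightarrow> bool" where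
  "linf_conv fs f \<longleftrightarrow>
     (\<forall>z::linf. (\<lambda>n. \<Sum>k. apply_bcontfun z k * fs n (unitv k))
                 \<longlonglongrightarrow> (\<Sum>k. apply_bcontfun z k * f (unitv k)))"

definition linf_grothendieck :: "linf set \<Rightarrow> bool" where
  "linf_grothendieck S \<longleftrightarrow> closed_subspace S \<and> c0 \<subseteq> S \<and>
     (\<forall>fs f. (\<forall>n. dual_elem S (fs n)) \<and> dual_elem S f \<and> weakstar_conv S fs f
              \<longrightarrow> linf_conv fs f)"

text \<open>L_p(0,1): measurable functions on [0,1] (Lebesgue measure) with integrable
 p-th power of the absolute value, considered modulo a.e. equality.\<close>
abbreviation I01 :: "real measure" where
  "I01 \<equiv> lebesgue_on {0..1}"

definition Lp_fun :: "real \<Rightarrow> (real \<Rightarrow> real) set" where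
  "Lp_fun p = {f. f \<in> borel_measurable I01 \<and> integrable I01 (\<lambda>t. \<bar>f t\<bar> powr p)}"

definition Lp_norm :: "real \<Rightarrow> (real \<Rightarrow> real) \<Rightarrow> real" where
  "Lp_norm p f = (\<integral>t. \<bar>f t\<bar> powr p \<partial>I01) powr (1 / p)"

text \<open>ell_infinity / N is isomorphic (as a Banach space) to L_p(0,1):
 there is a map T on ell_infinity, linear modulo a.e. equality, with values in
 L_p, vanishing (a.e.) exactly on N, onto L_p modulo a.e. equality, and bounded
 above and below with respect to the quotient norm dist(x, N).  This is exactly a
 linear isomorphism from the quotient space ell_infinity/N onto L_p(0,1).\<close>
definition quot_iso_Lp :: "linf set \<Rightarrow> real \<Rightarrow> bool" where
  "quot_iso_Lp N p \<longleftrightarrow> (\<exists>T :: linf \<Rightarrow> real \<Rightarrow> real.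
     (\<forall>x. T x \<in> Lp_fun p) \<and>
     (\<forall>x y. AE t in I01. T (x + y) t = T x t + T y t) \<and>
     (\<forall>c x. AE t in I01. T (c *\<^sub>R x) t = c * T x t) \<and>
     (\<forall>x. (AE t in I01. T x t = 0) \<longleftrightarrow> x \<in> N) \<and>
     (\<forall>f\<in>Lp_fun p. \<exists>x. AE t in I01. T x t = f t) \<and>
     (\<exists>C>0. \<forall>x. Lp_norm p (T x) \<le> C * infdist x N) \<and>
     (\<exists>c>0. \<forall>x. c * infdist x N \<le> Lp_norm p (T x)))"

definition subspace_iso :: "linf set \<Rightarrow> linf set \<Rightarrow> bool" where
  "subspace_iso A B \<longleftrightarrow> (\<exists>U :: linf \<Rightarrow> linf.
     bij_betw U A B \<and>
     (\<forall>x\<in>A. \<forall>y\<in>A. U (x + y) = U x + U y) \<and>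
     (\<forall>c. \<forall>x\<in>A. U (c *\<^sub>R x) = c *\<^sub>R U x) \<and>
     (\<exists>C. \<forall>x\<in>A. norm (U x) \<le> C * norm x) \<and>
     (\<exists>C. \<forall>x\<in>A. norm x \<le> C * norm (U x)))"

end

theory Submission
  imports Defs
begin

text \<open>\<^emph>\<open>Existence.\<close> For \<open>p > 2\<close> the dual of \<open>L\<^sub>p\<close> embeds into \<open>L\<^sub>1\<close> by means of independent symmetric
  variables with tail exponent \<open>p/(p - 1)\<close> (Rademacher variables for \<open>p = 2\<close>). Dually, every dyadic level
  of \<open>L\<^sub>p\<close> is a quotient of a finite-dimensional space with the maximum norm, with a uniform constant.
  A Banach limit over the levels gives a bounded map from bounded sequences onto \<open>L\<^sub>p\<close> that
  kills \<^const>\<open>c0\<close>; its values are obtained as limits of \<open>L\<^sub>2\<close>-bounded dyadic martingales.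

  \<^emph>\<open>Grothendieck property.\<close> A gliding hump yields disjoint finite blocks \<open>A\<^sub>i\<close> that carry the mass of the
  functionals. Let \<open>M\<close> run through an uncountable almost disjoint family of infinite sets of indices, and let
  \<open>y\<^sub>M\<close> be \<open>z\<close> restricted to the blocks with index in \<open>M\<close>. Modulo \<^const>\<open>c0\<close>, signed sums of the \<open>y\<^sub>M\<close> are
  bounded, so by the cotype of \<open>L\<^sub>p\<close> all but countably many of them lie in \<open>N\<close>, and, again up to countably
  many, the functionals act on them through their coordinates only. One such \<open>y\<^sub>M\<close> contradicts weak-star
  convergence.

  \<^emph>\<open>Non-isomorphism.\<close> Let \<open>p < r\<close>. An isomorphism \<open>N\<^sub>p \<rightarrow> N\<^sub>r\<close> and its inverse extend to operators \<open>V\<close>, \<open>W\<close> on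
  bounded sequences, inducing operators \<open>L\<^sub>p \<rightarrow> L\<^sub>r\<close> and \<open>L\<^sub>r \<rightarrow> L\<^sub>p\<close>, and \<open>VW - 1\<close> factors through \<open>L\<^sub>r\<close>. On \<open>n\<close>
  disjoint indicators in \<open>L\<^sub>r\<close>, the cotype \<open>p\<close> of \<open>L\<^sub>p\<close> makes the part through \<open>L\<^sub>p\<close> small, while Riesz products
  bound the trace of the part through bounded sequences; so the trace of the identity cannot be
  attained for large \<open>n\<close>.\<close>

section \<open>Extension of bounded operators\<close>

text \<open>The quotient norm enters mainly through \<open>Q\<close>, equivalent to its p-th power.
  The reason is that Clarkson's inequality for numbers integrates to
  \<open>2 * Q a + 2 * Q b \<le> Q (a + b) + Q (a - b)\<close>, and this inequality alone gives
  signs for which a sum has large \<open>Q\<close>. Squares of functionals satisfy it too, so a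
  single countability lemma treats both the quotient and the functionals vanishing on
  \<open>c0\<close>. In the existence part a heavy-tailed variable is cut at a level adapted to a
  dual weight: its large part is controlled in mean, the rest in mean square. The second estimate
  diverges logarithmically at p = 2, so signs take over there. In the trace argument the total is
  normalised to 1. The part through L_p is of order n^(1/r - 1/p), which decays because p < r. The
  part through bounded sequences is of order n^(-1/r): on normalised indicators each coordinate of
  VW - 1 gives a vector bounded in l_2 (this uses r >= 2), and Riesz products realise such vectors
  by uniformly bounded sequences.\<close>

definition sublinear :: "('a::real_vector \<Rightarrow> real) \<Rightarrow> bool" where
  "sublinear p \<longleftrightarrow> (\<forall>x y. p (x + y) \<le> p x + p y) \<and> (\<forall>c>0. \<forall>x. p (c *\<^sub>R x) \<le> c * p x)"

text \<open>The definition asks for one inequality only, and only for c > 0, because infima inherit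
  that form directly. Scaling back by 1/c gives the other one; at 0, subadditivity yields
  \<open>p 0 \<ge> 0\<close> and halving yields \<open>p 0 \<le> 0\<close>.\<close>

lemma sublinear_scaleR:
  assumes "sublinear p" "c \<ge> 0"
  shows "p (c *\<^sub>R x) = c * p x"
proof (cases "c = 0")
  case True
  have "p 0 + p 0 \<ge> p (0 + 0)" "p ((1/2) *\<^sub>R 0) \<le> (1/2) * p 0"
    using assms(1) unfolding sublinear_def by (metis, meson half_gt_zero zero_less_one)
  then show ?thesis using True by simp
next
  case False
  then have c: "c > 0" using assms by simp
  have "p ((1/c) *\<^sub>R c *\<^sub>R x) \<le> (1/c) * p (c *\<^sub>R x)" "p (c *\<^sub>R x) \<le> c * p x"
    using assms(1) c unfolding sublinear_def by (metis zero_less_divide_1_iff, metis)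
  then show ?thesis using c by (simp add: field_simps)
qed

lemma sublinear_zero: "sublinear p \<Longrightarrow> p 0 = 0"
  using sublinear_scaleR[of p 0 0] by simp

lemma sublinear_lower:
  assumes "sublinear p" shows "- p (- x) \<le> p x"
proof -
  have "p (x + (-x)) \<le> p x + p (-x)" using assms unfolding sublinear_def by blast
  then show ?thesis using sublinear_zero[OF assms] by simp
qed

text \<open>Serves three infima: along a ray, along a chain and over a subspace. The bound
  \<open>l\<close> keeps the infimum real-valued; the index \<open>k\<close> may vary with the
  vectors, as in a chain.\<close>

lemma sublinear_INF:
  fixes \<phi> :: "'i \<Rightarrow> 'a::real_vector \<Rightarrow> real"
  assumes ne: "I \<noteq> {}" and low: "\<And>i x. i \<in> I \<Longrightarrow> l x \<le> \<phi> i x"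
    and add: "\<And>i j x y. i \<in> I \<Longrightarrow> j \<in> I \<Longrightarrow> \<exists>k\<in>I. \<phi> k (x + y) \<le> \<phi> i x + \<phi> j y"
    and scale: "\<And>i c x. i \<in> I \<Longrightarrow> c > 0 \<Longrightarrow> \<exists>k\<in>I. \<phi> k (c *\<^sub>R x) \<le> c * \<phi> i x"
  shows "sublinear (\<lambda>x. INF i\<in>I. \<phi> i x) \<and> (\<forall>i\<in>I. \<forall>x. (INF i\<in>I. \<phi> i x) \<le> \<phi> i x)"
proof -
  define u where "u x = (INF i\<in>I. \<phi> i x)" for x
  have le: "u x \<le> \<phi> i x" if "i \<in> I" for i x
    unfolding u_def by (rule cINF_lower[OF bdd_belowI2[of _ "l x"] that]) (rule low)
  have ge: "z \<le> u x" if "\<And>i. i \<in> I \<Longrightarrow> z \<le> \<phi> i x" for x z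
    unfolding u_def by (rule cINF_greatest[OF ne]) (use that in auto)
  have "sublinear u" unfolding sublinear_def
  proof (intro conjI allI impI)
    fix x y
    have "u (x + y) - \<phi> i x \<le> \<phi> j y" if "i \<in> I" "j \<in> I" for i j
      using add[OF that, of x y] le[of _ "x + y"] by force
    then have "u (x + y) - \<phi> i x \<le> u y" if "i \<in> I" for i using that by (intro ge) auto
    then have "u (x + y) - u y \<le> u x" by (intro ge) (simp add: algebra_simps)
    then show "u (x + y) \<le> u x + u y" by simp
  next
    fix c :: real and x assume c: "c > 0"
    have "u (c *\<^sub>R x) / c \<le> u x"
    proof (rule ge)
      fix i assume "i \<in> I"
      then have "u (c *\<^sub>R x) \<le> c * \<phi> i x" using scale[of i c x] c le[of _ "c *\<^sub>R x"] by force
      then show "u (c *\<^sub>R x) / c \<le> \<phi> i x" using c by (simp add: field_simps)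
    qed
    then show "u (c *\<^sub>R x) \<le> c * u x" using c by (simp add: field_simps)
  qed
  then show ?thesis using le unfolding u_def[abs_def] by blast
qed

text \<open>The infimum of \<open>q (x + t *\<^sub>R y) - t * q y\<close> over
  \<open>t \<ge> 0\<close> is sublinear and lies below \<open>q\<close> (take t = 0). Minimality
  makes it equal to \<open>q\<close>, and t = 1 then turns subadditivity into additivity.\<close>

lemma minimal_sublinear_linear:
  assumes q: "sublinear q"
    and min: "\<And>q'. sublinear q' \<Longrightarrow> (\<And>x. q' x \<le> q x) \<Longrightarrow> q' = q"
  shows "linear q"
proof -
  have add: "q (x + y) = q x + q y" for x y
  proof -
    define \<phi> where "\<phi> t x = q (x + t *\<^sub>R y) - t * q y" for t x
    define r where "r x = (INF t\<in>{0..}. \<phi> t x)" for x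
    have low: "- q (- x) \<le> \<phi> t x" if "t \<in> {0..}" for x t
    proof -
      have "q (t *\<^sub>R y) \<le> q (x + t *\<^sub>R y) + q (- x)"
        using q unfolding sublinear_def by (metis add.commute add_minus_cancel)
      then show ?thesis using sublinear_scaleR[OF q, of t y] that by (simp add: \<phi>_def)
    qed
    have sub_add: "\<phi> (t1 + t2) (x1 + x2) \<le> \<phi> t1 x1 + \<phi> t2 x2" for t1 t2 x1 x2
    proof -
      have "(x1 + x2) + (t1 + t2) *\<^sub>R y = (x1 + t1 *\<^sub>R y) + (x2 + t2 *\<^sub>R y)"
        by (simp add: algebra_simps)
      then have "q ((x1 + x2) + (t1 + t2) *\<^sub>R y) \<le> q (x1 + t1 *\<^sub>R y) + q (x2 + t2 *\<^sub>R y)"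
        using q unfolding sublinear_def by metis
      then show ?thesis by (simp add: \<phi>_def algebra_simps)
    qed
    have sub_scale: "\<phi> (c * t) (c *\<^sub>R x) = c * \<phi> t x" if "c > 0" for c t x
      using sublinear_scaleR[OF q, of c "x + t *\<^sub>R y"] that
      by (simp add: \<phi>_def scaleR_right_distrib right_diff_distrib)
    have ex_add: "\<exists>k\<in>{0..}. \<phi> k (x1 + x2) \<le> \<phi> t1 x1 + \<phi> t2 x2" if "t1 \<in> {0..}" "t2 \<in> {0..}" for t1 t2 x1 x2
      using sub_add[of t1 t2] that by (intro bexI[of _ "t1 + t2"]) auto
    have ex_scale: "\<exists>k\<in>{0..}. \<phi> k (c *\<^sub>R x) \<le> c * \<phi> t x" if "t \<in> {0..}" "c > 0" for c t x
      using sub_scale[OF that(2), of t x] that by (intro bexI[of _ "c * t"]) auto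
    have inf: "sublinear r \<and> (\<forall>t\<in>{0..}. \<forall>x. r x \<le> \<phi> t x)" unfolding r_def[abs_def]
      by (rule sublinear_INF[where l = "\<lambda>x. - q (- x)"], simp, erule low, erule (1) ex_add, erule (1) ex_scale)
    then have le: "r x \<le> q (x + t *\<^sub>R y) - t * q y" if "t \<ge> 0" for x t
      using that by (simp add: \<phi>_def)
    have "r = q"
    proof (rule min)
      show "r x \<le> q x" for x using le[of 0 x] by simp
      show "sublinear r" using inf ..
    qed
    then have "q x + q y \<le> q (x + y)" using le[of 1 x] by simp
    moreover have "q (x + y) \<le> q x + q y" using q unfolding sublinear_def by blast
    ultimately show ?thesis by simp
  qed
  have neg: "q (- x) = - q x" for x
    using add[of x "- x"] sublinear_zero[OF q] by simp
  show ?thesis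
  proof (rule linearI)
    show "q (x + y) = q x + q y" for x y by (rule add)
    show "q (c *\<^sub>R x) = c *\<^sub>R q x" for c x
    proof (cases "c \<ge> 0")
      case True then show ?thesis using sublinear_scaleR[OF q] by simp
    next
      case False
      then show ?thesis using sublinear_scaleR[OF q, of "-c" x] neg[of "c *\<^sub>R x"] by simp
    qed
  qed
qed

lemma sublinear_dominates_linear:
  assumes p: "sublinear p"
  obtains f where "linear f" "\<And>x. f x \<le> p x"
proof -
  define A where "A = {q. sublinear q \<and> (\<forall>x. q x \<le> p x)}"
  \<comment> \<open>The order is reversed, so that a maximal element in Zorn's lemma is a minimal
    sublinear functional below \<open>p\<close>.\<close>
  define P where "P q r \<longleftrightarrow> (\<forall>x. r x \<le> q x)" for q r :: "'a \<Rightarrow> real"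
  have "\<exists>m\<in>A. \<forall>a\<in>A. P m a \<longrightarrow> a = m"
  proof (rule predicate_Zorn)
    show "partial_order_on A (relation_of P A)"
      by (rule partial_order_on_relation_ofI) (auto simp: P_def intro: order_trans, meson antisym ext)
    fix C assume C: "C \<in> Chains (relation_of P A)"
    have CA: "C \<subseteq> A" using C unfolding Chains_def relation_of_def by blast
    have tot: "P a b \<or> P b a" if "a \<in> C" "b \<in> C" for a b
      using C that unfolding Chains_def relation_of_def by blast
    show "\<exists>u\<in>A. \<forall>a\<in>C. P a u"
    proof (cases "C = {}")
      case True
      then show ?thesis using p by (intro bexI[of _ p]) (auto simp: A_def)
    next
      case False
      define u where "u x = (INF q\<in>C. q x)" for x
      have low: "- p (- x) \<le> q x" if "q \<in> C" for q x
      proof -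
        have "sublinear q" "q (-x) \<le> p (-x)" using that CA by (auto simp: A_def)
        then show ?thesis using sublinear_lower[of q x] by simp
      qed
      have ex_add: "\<exists>q\<in>C. q (x + y) \<le> q1 x + q2 y" if q: "q1 \<in> C" "q2 \<in> C" for q1 q2 x y
      proof -
        obtain q where q: "q \<in> C" "q x \<le> q1 x" "q y \<le> q2 y" using tot[OF q] q unfolding P_def by blast
        moreover have "q (x + y) \<le> q x + q y" using q(1) CA by (auto simp: A_def sublinear_def)
        ultimately show ?thesis by (intro bexI[of _ q]) auto
      qed
      have ex_scale: "\<exists>k\<in>C. k (c *\<^sub>R x) \<le> c * q x" if "q \<in> C" "c > 0" for q c x
        using that CA by (intro bexI[of _ q]) (auto simp: A_def sublinear_def)
      have inf: "sublinear u \<and> (\<forall>q\<in>C. \<forall>x. u x \<le> q x)" unfolding u_def[abs_def]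
        by (rule sublinear_INF[where l = "\<lambda>x. - p (- x)" and \<phi> = "\<lambda>q. q"], rule False, erule low, erule (1) ex_add, erule (1) ex_scale)
      then have le: "u x \<le> q x" if "q \<in> C" for x q using that by blast
      have "sublinear u" using inf ..
      moreover obtain q where "q \<in> C" using False by blast
      then have "u x \<le> p x" for x using le[of q x] CA unfolding A_def by (smt (verit) mem_Collect_eq subset_iff)
      ultimately show ?thesis using le by (intro bexI[of _ u]) (auto simp: A_def P_def)
    qed
  qed
  then obtain m where m: "sublinear m" "\<And>x. m x \<le> p x"
    and min: "\<And>a. sublinear a \<Longrightarrow> (\<And>x. a x \<le> p x) \<Longrightarrow> (\<And>x. a x \<le> m x) \<Longrightarrow> a = m"
    unfolding A_def P_def by blast
  have "linear m"
    by (rule minimal_sublinear_linear[OF m(1)]) (use min m(2) order_trans in blast)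
  then show ?thesis using m(2) that by blast
qed

theorem Hahn_Banach_bounded:
  fixes S :: "'a::real_normed_vector set" and f :: "'a \<Rightarrow> real"
  assumes S: "subspace S"
    and add: "\<And>x y. x \<in> S \<Longrightarrow> y \<in> S \<Longrightarrow> f (x + y) = f x + f y"
    and hom: "\<And>c x. x \<in> S \<Longrightarrow> f (c *\<^sub>R x) = c * f x"
    and bnd: "\<And>x. x \<in> S \<Longrightarrow> \<bar>f x\<bar> \<le> K * norm x" and K: "K \<ge> 0"
  obtains g where "linear g" "\<And>x. x \<in> S \<Longrightarrow> g x = f x" "\<And>x. \<bar>g x\<bar> \<le> K * norm x"
proof -
  \<comment> \<open>Infimal convolution of \<open>f\<close> on \<open>S\<close> with
    \<open>K * norm\<close>. For a dominated \<open>g\<close>, the choice u = x gives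
    \<open>g \<le> f\<close> on \<open>S\<close> and u = 0 gives \<open>g \<le> K * norm\<close>;
    replacing x by -x reverses both.\<close>
  define p where "p x = (INF u\<in>S. f u + K * norm (x - u))" for x
  have neS: "S \<noteq> {}" using subspace_0[OF S] by blast
  have low: "- (K * norm x) \<le> f u + K * norm (x - u)" if "u \<in> S" for u x
  proof -
    have "K * norm u \<le> K * norm (x - u) + K * norm x"
      using norm_triangle_sub[of u x] K mult_left_mono[of "norm u" "norm (x - u) + norm x" K]
      by (simp add: norm_minus_commute algebra_simps)
    then show ?thesis using bnd[OF that] by linarith
  qed
  have ex_add: "\<exists>k\<in>S. f k + K * norm ((x + y) - k) \<le> (f u + K * norm (x - u)) + (f v + K * norm (y - v))"
    if uv: "u \<in> S" "v \<in> S" for u v x y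
  proof (rule bexI)
    have "norm ((x + y) - (u + v)) \<le> norm (x - u) + norm (y - v)"
      by (metis add_diff_add norm_triangle_ineq)
    then have "K * norm ((x + y) - (u + v)) \<le> K * norm (x - u) + K * norm (y - v)"
      using K by (metis distrib_left mult_left_mono)
    then show "f (u + v) + K * norm ((x + y) - (u + v)) \<le> (f u + K * norm (x - u)) + (f v + K * norm (y - v))"
      using add[OF uv] by linarith
  qed (use uv S subspace_add in blast)
  have ex_scale: "\<exists>k\<in>S. f k + K * norm (c *\<^sub>R x - k) \<le> c * (f u + K * norm (x - u))"
    if u: "u \<in> S" "c > 0" for u c x
  proof (rule bexI)
    show "f (c *\<^sub>R u) + K * norm (c *\<^sub>R x - c *\<^sub>R u) \<le> c * (f u + K * norm (x - u))"
      using hom[OF u(1)] u(2) by (simp add: algebra_simps flip: scaleR_diff_right)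
  qed (use u S subspace_scale in blast)
  have inf: "sublinear p \<and> (\<forall>u\<in>S. \<forall>x. p x \<le> f u + K * norm (x - u))" unfolding p_def[abs_def]
    by (rule sublinear_INF[where l = "\<lambda>x. - (K * norm x)"], rule neS, erule low, erule (1) ex_add, erule (1) ex_scale)
  then have le: "p x \<le> f u + K * norm (x - u)" if "u \<in> S" for x u using that by blast
  have "sublinear p" using inf ..
  then obtain g where g: "linear g" "\<And>x. g x \<le> p x" using sublinear_dominates_linear by blast
  have gneg: "g (- x) = - g x" for x using linear_neg[OF g(1)] by simp
  have f0: "f 0 = 0" using hom[of 0 0] subspace_0[OF S] by simp
  have up: "g x \<le> K * norm x" for x
    using g(2)[of x] le[OF subspace_0[OF S], of x] f0 by simp
  have onS: "g x \<le> f x" if "x \<in> S" for x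
    using g(2)[of x] le[OF that, of x] by simp
  show ?thesis
  proof (rule that[OF g(1)])
    show "\<bar>g x\<bar> \<le> K * norm x" for x using up[of x] up[of "-x"] gneg[of x] by simp
    show "g x = f x" if "x \<in> S" for x
      using onS[OF that] onS[of "-x"] gneg[of x] hom[OF that, of "-1"] that subspace_neg[OF S] by force
  qed
qed

section \<open>Operators into bounded sequences, and Banach limits\<close>

lemma linf_apply_Bcontfun:
  assumes "\<And>n::nat. \<bar>f n\<bar> \<le> b"
  shows "apply_bcontfun (Bcontfun f) = (f :: nat \<Rightarrow> real)"
  by (rule Bcontfun_inverse, rule bcontfun_normI[where b=b]) (use assms in auto)

lemma linf_norm_le: "(\<And>n. \<bar>apply_bcontfun x n\<bar> \<le> b) \<Longrightarrow> norm (x::linf) \<le> b"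
  by (rule norm_bound) auto

lemma linf_abs_le_norm: "\<bar>apply_bcontfun x n\<bar> \<le> norm (x::linf)"
  using norm_bounded[of x n] by simp

text \<open>Bounded sequences form an injective space: every coordinate of \<open>U\<close> is a
  functional with the same bound and is extended separately. \<open>K\<close> may be negative if
  \<open>S\<close> is trivial, whence \<open>K' = max K 0\<close>.\<close>

lemma extend_operator_linf:
  fixes S :: "linf set" and U :: "linf \<Rightarrow> linf"
  assumes S: "subspace S"
    and add: "\<And>x y. x \<in> S \<Longrightarrow> y \<in> S \<Longrightarrow> U (x + y) = U x + U y"
    and hom: "\<And>c x. x \<in> S \<Longrightarrow> U (c *\<^sub>R x) = c *\<^sub>R U x"
    and bnd: "\<And>x. x \<in> S \<Longrightarrow> norm (U x) \<le> K * norm x"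
  obtains V K' where "linear V" "\<And>x. x \<in> S \<Longrightarrow> V x = U x" "\<And>x. norm (V x) \<le> K' * norm x" "K' \<ge> 0"
proof -
  define K' where "K' = max K 0"
  have bnd': "norm (U x) \<le> K' * norm x" if "x \<in> S" for x
    using bnd[OF that] mult_right_mono[of K K' "norm x"] unfolding K'_def by simp
  have "\<exists>g. linear g \<and> (\<forall>x\<in>S. g x = apply_bcontfun (U x) n) \<and> (\<forall>x. \<bar>g x\<bar> \<le> K' * norm x)" for n
  proof -
    have "\<bar>apply_bcontfun (U x) n\<bar> \<le> K' * norm x" if "x \<in> S" for x
      using bnd'[OF that] linf_abs_le_norm[of "U x" n] by linarith
    then obtain g where "linear g" "\<And>x. x \<in> S \<Longrightarrow> g x = apply_bcontfun (U x) n" "\<And>x. \<bar>g x\<bar> \<le> K' * norm x"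
      using Hahn_Banach_bounded[OF S, of "\<lambda>x. apply_bcontfun (U x) n" K'] add hom
      by (auto simp: K'_def)
    then show ?thesis by blast
  qed
  then obtain g where g: "\<And>n. linear (g n)" "\<And>n x. x \<in> S \<Longrightarrow> g n x = apply_bcontfun (U x) n"
    "\<And>n x. \<bar>g n x\<bar> \<le> K' * norm x" by metis
  define V where "V x = (Bcontfun (\<lambda>n. g n x) :: linf)" for x
  have V: "apply_bcontfun (V x) n = g n x" for x n
    unfolding V_def using linf_apply_Bcontfun[of "\<lambda>n. g n x", OF g(3)] by simp
  show ?thesis
  proof (rule that)
    show "linear V"
      by (rule linearI; rule bcontfun_eqI) (simp_all add: V linear_add[OF g(1)] linear_scale[OF g(1)])
    show "V x = U x" if "x \<in> S" for x by (rule bcontfun_eqI) (simp add: V g(2)[OF that])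
    show "norm (V x) \<le> K' * norm x" for x by (rule linf_norm_le) (simp add: V g(3))
    show "K' \<ge> 0" by (simp add: K'_def)
  qed
qed

text \<open>A norm-one extension of \<open>lim\<close> from the convergent sequences; monotonicity
  results from the norm bound and the values on constants.\<close>

lemma Banach_limit:
  obtains L :: "linf \<Rightarrow> real" where "linear L" "\<And>x. \<bar>L x\<bar> \<le> norm x"
    "\<And>x l. apply_bcontfun x \<longlonglongrightarrow> l \<Longrightarrow> L x = l"
    "\<And>x y. (\<And>n. apply_bcontfun x n \<le> apply_bcontfun y n) \<Longrightarrow> L x \<le> L y"
proof -
  define S where "S = {x::linf. convergent (apply_bcontfun x)}"
  have S: "subspace S"
    unfolding S_def subspace_def
    by (auto intro!: convergent_add convergent_const convergent_mult simp: convergent_add convergent_mult)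
  have lim: "apply_bcontfun x \<longlonglongrightarrow> lim (apply_bcontfun x)" if "x \<in> S" for x
    using that by (simp add: S_def convergent_LIMSEQ_iff)
  obtain L where L: "linear L" "\<And>x. x \<in> S \<Longrightarrow> L x = lim (apply_bcontfun x)" "\<And>x. \<bar>L x\<bar> \<le> 1 * norm x"
  proof (rule Hahn_Banach_bounded[OF S, of "\<lambda>x. lim (apply_bcontfun x)" 1])
    show "lim (apply_bcontfun (x + y)) = lim (apply_bcontfun x) + lim (apply_bcontfun y)"
      if "x \<in> S" "y \<in> S" for x y
      using tendsto_add[OF lim[OF that(1)] lim[OF that(2)]] by (intro limI) simp
    show "lim (apply_bcontfun (c *\<^sub>R x)) = c * lim (apply_bcontfun x)" if "x \<in> S" for c x
      using tendsto_mult_left[OF lim[OF that], of c] by (intro limI) simp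
    show "\<bar>lim (apply_bcontfun x)\<bar> \<le> 1 * norm x" if "x \<in> S" for x
      using tendsto_rabs[OF lim[OF that]] linf_abs_le_norm[of x]
      by (auto intro: LIMSEQ_le_const2)
  qed auto
  have conv: "L x = l" if "apply_bcontfun x \<longlonglongrightarrow> l" for x l
    using L(2)[of x] that by (auto simp: S_def convergent_def limI)
  have pos: "0 \<le> L z" if z: "\<And>n. 0 \<le> apply_bcontfun z n" for z
  proof -
    \<comment> \<open>Since z takes values between 0 and 2 h, the constant h is within h of z, and
      so \<open>h - L z \<le> h\<close>.\<close>
    define h where "h = norm z / 2"
    have "norm (const_bcontfun h - z) \<le> h"
    proof (rule linf_norm_le)
      fix n show "\<bar>apply_bcontfun (const_bcontfun h - z) n\<bar> \<le> h"
        using z[of n] linf_abs_le_norm[of z n] by (auto simp: h_def abs_if)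
    qed
    moreover have "L (const_bcontfun h) = h" by (rule conv) simp
    ultimately show ?thesis
      using L(3)[of "const_bcontfun h - z"] linear_diff[OF L(1)] by simp
  qed
  show ?thesis
  proof (rule that[OF L(1) _ conv])
    show "\<bar>L x\<bar> \<le> norm x" for x using L(3)[of x] by simp
    show "L x \<le> L y" if "\<And>n. apply_bcontfun x n \<le> apply_bcontfun y n" for x y
      using pos[of "y - x"] that linear_diff[OF L(1)] by simp
  qed
qed

section \<open>Power inequalities and choices of signs\<close>

text \<open>Above the threshold c the ratio x / c is at least 1, so x is at most x times (x / c)^(s
  - 1).\<close>

lemma le_add_powr:
  fixes x c s :: real
  assumes "x \<ge> 0" "c > 0" "s \<ge> 1"
  shows "x \<le> c + c powr (1 - s) * x powr s"
proof (cases "x \<le> c")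
  case True
  then show ?thesis by (simp add: add_increasing2)
next
  case False
  then have x: "x > 0" "x \<ge> c" using assms by auto
  have "x = x powr (1 - s) * x powr s" using x by (simp flip: powr_add)
  also have "\<dots> \<le> c powr (1 - s) * x powr s"
    using x assms by (intro mult_right_mono powr_mono2') auto
  finally show ?thesis using assms by linarith
qed

text \<open>Together with the previous lemma this replaces Jensen's and Hoelder's inequality, at the
  cost of a factor 2.\<close>

lemma powr_le_of_le_add_powr:
  fixes a g s :: real
  assumes "a \<ge> 0" "g \<ge> 0" "s \<ge> 1" and le: "\<And>c. c > 0 \<Longrightarrow> a \<le> c + c powr (1 - s) * g"
  shows "a powr s \<le> 2 powr s * g"
proof (cases "g = 0")
  case True
  have "a \<le> 0" by (rule field_le_epsilon) (use le True in simp)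
  then show ?thesis using assms True by simp
next
  case False
  then have g: "g > 0" using assms by simp
  \<comment> \<open>This choice of c makes both terms equal to \<open>g powr (1/s)\<close>.\<close>
  have "a \<le> g powr (1/s) + (g powr (1/s)) powr (1 - s) * g" using le[of "g powr (1/s)"] g by simp
  also have "(g powr (1/s)) powr (1 - s) * g = g powr ((1/s) * (1 - s) + 1)"
    using g by (simp add: powr_powr powr_add)
  also have "(1/s) * (1 - s) + 1 = 1/s" using assms by (simp add: field_simps)
  finally have "a \<le> 2 * g powr (1/s)" by simp
  then have "a powr s \<le> (2 * g powr (1/s)) powr s" using assms by (intro powr_mono2) auto
  also have "\<dots> = 2 powr s * g" using assms g by (simp add: powr_mult powr_powr)
  finally show ?thesis .
qed

text \<open>A Clarkson inequality. With s = p/2, the squares of a + b and a - b have mean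
  \<open>a\<^sup>2 + b\<^sup>2\<close>; convexity of the s-th power handles the mean,
  superadditivity the sum.\<close>

lemma abs_powr_two_point:
  fixes a b p :: real
  assumes p: "p \<ge> 2"
  shows "2 * \<bar>a\<bar> powr p + 2 * \<bar>b\<bar> powr p \<le> \<bar>a + b\<bar> powr p + \<bar>a - b\<bar> powr p"
proof -
  define s where "s = p / 2"
  have s: "s \<ge> 1" using p by (simp add: s_def)
  have sq: "\<bar>x\<bar> powr p = (x\<^sup>2) powr s" for x :: real
  proof (cases "x = 0")
    case False
    have "x\<^sup>2 = \<bar>x\<bar> powr 2" using False by (simp add: powr_numeral)
    then show ?thesis by (simp only: powr_powr s_def) simp
  qed simp
  have super: "u powr s + v powr s \<le> (u + v) powr s" if uv: "u \<ge> 0" "v \<ge> 0" for u v :: real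
  proof (cases "u + v = 0")
    case False
    then have uv0: "u + v > 0" using uv by simp
    have split: "t powr s = t * t powr (s - 1)" if "t \<ge> 0" for t :: real
      using that by (cases "t = 0") (auto simp: powr_mult_base)
    have "u powr s + v powr s = u * u powr (s - 1) + v * v powr (s - 1)" using split uv by simp
    also have "\<dots> \<le> u * (u + v) powr (s - 1) + v * (u + v) powr (s - 1)"
      using uv s by (intro add_mono mult_left_mono powr_mono2) auto
    also have "\<dots> = (u + v) powr s" using split[of "u + v"] uv by (simp add: algebra_simps)
    finally show ?thesis .
  qed (use uv in \<open>auto simp: add_nonneg_eq_0_iff\<close>)
  have "2 * (a\<^sup>2 + b\<^sup>2) powr s \<le> ((a + b)\<^sup>2) powr s + ((a - b)\<^sup>2) powr s"
  \<comment> \<open>Convexity is applied to two positive squares. If one of them vanishes, the claim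
    comes down to 2 * 2^s <= 4^s.\<close>
  proof (cases "a + b = 0 \<or> a - b = 0")
    case True
    then have b: "b\<^sup>2 = a\<^sup>2" by (auto simp: power2_eq_iff)
    have eq: "((a + b)\<^sup>2) powr s + ((a - b)\<^sup>2) powr s = (4 * a\<^sup>2) powr s"
      using True by (elim disjE) (simp_all add: eq_neg_iff_add_eq_0[symmetric] power2_eq_square)
    have "2 * (a\<^sup>2 + b\<^sup>2) powr s = 2 powr 1 * (2 powr s * (a\<^sup>2) powr s)"
      using b by (simp add: powr_mult flip: mult_2)
    also have "\<dots> \<le> 2 powr s * (2 powr s * (a\<^sup>2) powr s)"
      using s by (intro mult_right_mono powr_mono) auto
    also have "\<dots> = (4 * a\<^sup>2) powr s"
      by (simp add: powr_mult flip: mult.assoc powr_mult)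
    finally show ?thesis using eq by simp
  next
    case False
    then have pos: "(a + b)\<^sup>2 > 0" "(a - b)\<^sup>2 > 0" by auto
    have "((1 - 1/2) *\<^sub>R (a + b)\<^sup>2 + (1/2) *\<^sub>R (a - b)\<^sup>2) powr s
        \<le> (1 - 1/2) * ((a + b)\<^sup>2) powr s + (1/2) * ((a - b)\<^sup>2) powr s"
      by (rule convex_onD[OF powr_convex[OF s]]) (use pos in auto)
    also have "(1 - 1/2) *\<^sub>R (a + b)\<^sup>2 + (1/2) *\<^sub>R (a - b)\<^sup>2 = a\<^sup>2 + b\<^sup>2"
      by (simp add: power2_eq_square algebra_simps)
    finally show ?thesis by simp
  qed
  moreover have "(a\<^sup>2) powr s + (b\<^sup>2) powr s \<le> (a\<^sup>2 + b\<^sup>2) powr s" by (rule super) auto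
  ultimately show ?thesis unfolding sq by linarith
qed

text \<open>Signs are chosen greedily: one of the two continuations of the partial sum
  \<open>v\<close> has at least the average value, and by the two-point inequality the average is at
  least \<open>Q v + Q (y j)\<close>.\<close>

lemma signs_superadditive:
  fixes Q :: "'v::real_vector \<Rightarrow> real"
  assumes "finite F" and S: "subspace S" and nonneg: "\<And>x. x \<in> S \<Longrightarrow> Q x \<ge> 0"
    and two: "\<And>a b. a \<in> S \<Longrightarrow> b \<in> S \<Longrightarrow> 2 * Q a + 2 * Q b \<le> Q (a + b) + Q (a - b)"
    and y: "\<And>i. i \<in> F \<Longrightarrow> y i \<in> S"
  shows "\<exists>s. (\<forall>i. s i \<in> {-1, 1::real}) \<and> (\<Sum>i\<in>F. Q (y i)) \<le> Q (\<Sum>i\<in>F. s i *\<^sub>R y i)"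
  using assms(1) y
proof (induction F)
  case empty
  then show ?case using nonneg[OF subspace_0[OF S]] by (intro exI[of _ "\<lambda>_. 1"]) auto
next
  case (insert j F)
  then obtain s where s: "\<And>i. s i \<in> {-1, 1::real}" "(\<Sum>i\<in>F. Q (y i)) \<le> Q (\<Sum>i\<in>F. s i *\<^sub>R y i)"
    by auto
  define v where "v = (\<Sum>i\<in>F. s i *\<^sub>R y i)"
  have v: "v \<in> S" unfolding v_def using insert.prems S by (intro subspace_sum subspace_scale) auto
  have "2 * Q v + 2 * Q (y j) \<le> Q (v + y j) + Q (v - y j)" using two v insert.prems by simp
  then obtain e :: real where e: "e \<in> {-1, 1}" "Q v + Q (y j) \<le> Q (v + e *\<^sub>R y j)"
    by (cases "Q v + Q (y j) \<le> Q (v + y j)") (auto intro: that[of 1] that[of "-1"])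
  have "(\<Sum>i\<in>insert j F. (s(j := e)) i *\<^sub>R y i) = v + e *\<^sub>R y j"
    using insert.hyps by (auto simp: v_def intro!: sum.cong)
  moreover have "(\<Sum>i\<in>insert j F. Q (y i)) \<le> Q (v + e *\<^sub>R y j)"
    using s(2) e(2) insert.hyps by (simp add: v_def)
  ultimately show ?case using s(1) e(1) by (intro exI[of _ "s(j := e)"]) auto
qed

section \<open>Almost disjoint families\<close>

text \<open>Branches of the binary tree: r is represented by the codes of its finite initial
  segments, and two branches share none that extends beyond a place where they differ.\<close>

lemma almost_disjoint_family:
  obtains M :: "(nat \<Rightarrow> bool) \<Rightarrow> nat set" where "\<And>r. infinite (M r)"
    "\<And>r r'. r \<noteq> r' \<Longrightarrow> finite (M r \<inter> M r')"
proof -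
  define f where "f r n = to_nat (map r [0..<n])" for r :: "nat \<Rightarrow> bool" and n
  have f: "f r n = f r' m \<longleftrightarrow> n = m \<and> (\<forall>i<n. r i = r' i)" for r r' n m
  proof
    assume "f r n = f r' m"
    then have eq: "map r [0..<n] = map r' [0..<m]" by (simp add: f_def)
    then have "n = m" by (metis length_map length_upt minus_nat.diff_0)
    with eq show "n = m \<and> (\<forall>i<n. r i = r' i)" by simp
  qed (auto simp: f_def)
  show ?thesis
  proof (rule that[of "\<lambda>r. range (f r)"])
    show "infinite (range (f r))" for r
      by (rule range_inj_infinite) (simp add: inj_def f)
    fix r r' :: "nat \<Rightarrow> bool" assume "r \<noteq> r'"
    then obtain i where i: "r i \<noteq> r' i" by blast
    have "range (f r) \<inter> range (f r') \<subseteq> f r ` {..i}"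
    proof
      fix x assume "x \<in> range (f r) \<inter> range (f r')"
      then obtain n m where nm: "x = f r n" "x = f r' m" by blast
      then have "\<forall>i<n. r i = r' i" using f by metis
      then have "n \<le> i" using i by (meson not_le)
      then show "x \<in> f r ` {..i}" using nm by auto
    qed
    then show "finite (range (f r) \<inter> range (f r'))" using finite_subset by blast
  qed
qed

lemma uncountable_nat_bool: "uncountable (UNIV :: (nat \<Rightarrow> bool) set)"
proof -
  have "range f \<noteq> UNIV" for f :: "nat \<Rightarrow> nat \<Rightarrow> bool"
  proof
    assume "range f = UNIV"
    then obtain n where "f n = (\<lambda>n. \<not> f n n)" by (metis UNIV_I imageE)
    then show False by metis
  qed
  then show ?thesis unfolding uncountable_def by auto
qed

definition restrict_seq :: "nat set \<Rightarrow> linf \<Rightarrow> linf" where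
  "restrict_seq A z = Bcontfun (\<lambda>k. if k \<in> A then apply_bcontfun z k else 0)"

lemma apply_restrict_seq:
  "apply_bcontfun (restrict_seq A z) k = (if k \<in> A then apply_bcontfun z k else 0)"
  unfolding restrict_seq_def
  by (subst linf_apply_Bcontfun[where b = "norm z"]) (use linf_abs_le_norm in auto)

lemma apply_sum: "apply_bcontfun (\<Sum>i\<in>A. f i :: linf) k = (\<Sum>i\<in>A. apply_bcontfun (f i) k)"
  by (induction A rule: infinite_finite_induct) auto

lemma restrict_seq_c0: "finite A \<Longrightarrow> restrict_seq A z \<in> c0"
proof -
  assume "finite A"
  then obtain m where "\<And>k. k \<in> A \<Longrightarrow> k \<le> m" using finite_nat_set_iff_bounded_le by auto
  then have "apply_bcontfun (restrict_seq A z) k = 0" if "k > m" for k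
    using that by (fastforce simp: apply_restrict_seq)
  then have "\<forall>\<^sub>F k in sequentially. apply_bcontfun (restrict_seq A z) k = 0"
    unfolding eventually_sequentially by (metis Suc_le_eq)
  then show ?thesis unfolding c0_def by (simp add: tendsto_eventually)
qed

text \<open>Signed sums of finitely many of the \<^term>\<open>restrict_seq (B r) z\<close> are bounded by \<^term>\<open>norm z\<close>
  after removing finitely many coordinates, which \<open>Q\<close> does not see.\<close>

lemma countable_nonzero_almost_disjoint:
  fixes B :: "'r \<Rightarrow> nat set" and z :: linf and Q :: "linf \<Rightarrow> real"
  assumes S: "subspace S" "c0 \<subseteq> S" and nonneg: "\<And>x. x \<in> S \<Longrightarrow> Q x \<ge> 0"
    and two: "\<And>a b. a \<in> S \<Longrightarrow> b \<in> S \<Longrightarrow> 2 * Q a + 2 * Q b \<le> Q (a + b) + Q (a - b)"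
    and inv: "\<And>x u. x \<in> S \<Longrightarrow> u \<in> c0 \<Longrightarrow> Q (x - u) = Q x"
    and bnd: "\<And>x. x \<in> S \<Longrightarrow> norm x \<le> norm z \<Longrightarrow> Q x \<le> K"
    and B: "\<And>r r'. r \<noteq> r' \<Longrightarrow> finite (B r \<inter> B r')"
    and inS: "\<And>r. r \<in> G \<Longrightarrow> restrict_seq (B r) z \<in> S"
  shows "countable {r \<in> G. Q (restrict_seq (B r) z) \<noteq> 0}"
\<comment> \<open>A bound on all finite partial sums makes the family summable, and a summable
  family of reals has only countably many nonzero terms.\<close>
proof (rule summable_countable_real, rule nonneg_bdd_above_summable_on)
  show "0 \<le> Q (restrict_seq (B r) z)" if "r \<in> G" for r using nonneg inS that by blast
  show "bdd_above (sum (\<lambda>r. Q (restrict_seq (B r) z)) ` {F. F \<subseteq> G \<and> finite F})"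
  proof (rule bdd_aboveI2[of _ _ K], clarify)
    fix F assume F: "F \<subseteq> G" "finite F"
    obtain s where s: "\<And>i. s i \<in> {-1, 1::real}"
      "(\<Sum>r\<in>F. Q (restrict_seq (B r) z)) \<le> Q (\<Sum>r\<in>F. s r *\<^sub>R restrict_seq (B r) z)"
      using signs_superadditive[OF F(2) S(1) nonneg two, of "\<lambda>r. restrict_seq (B r) z"] inS F by blast
    define v where "v = (\<Sum>r\<in>F. s r *\<^sub>R restrict_seq (B r) z)"
    have vS: "v \<in> S" unfolding v_def using inS F S by (intro subspace_sum subspace_scale) auto
    define E where "E = (\<Union>r\<in>F. \<Union>r'\<in>F - {r}. B r \<inter> B r')"
    have "finite E" unfolding E_def using F B by (intro finite_UN_I) auto
    then have u: "restrict_seq E v \<in> c0" by (rule restrict_seq_c0)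
    have "norm (v - restrict_seq E v) \<le> norm z"
    proof (rule linf_norm_le)
      fix k
      show "\<bar>apply_bcontfun (v - restrict_seq E v) k\<bar> \<le> norm z"
      proof (cases "k \<in> E \<or> (\<forall>r\<in>F. k \<notin> B r)")
        case True
        then show ?thesis by (auto simp: apply_restrict_seq v_def apply_sum)
      next
        case False
        then obtain r where r: "r \<in> F" "k \<in> B r" by blast
        have other: "k \<notin> B r'" if r': "r' \<in> F - {r}" for r'
        proof
          assume "k \<in> B r'"
          then have "k \<in> E" unfolding E_def using r r' by (intro UN_I[of r] UN_I[of r'] IntI) auto
          then show False using False by simp
        qed
        have "apply_bcontfun v k = (\<Sum>i\<in>F. if i = r then s r * apply_bcontfun z k else 0)"
          unfolding v_def apply_sum using r other
          by (intro sum.cong) (auto simp: apply_restrict_seq)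
        also have "\<dots> = s r * apply_bcontfun z k" using F r by simp
        finally have "\<bar>apply_bcontfun v k\<bar> = \<bar>apply_bcontfun z k\<bar>"
          using s(1)[of r] by (auto simp: abs_mult)
        then show ?thesis using False linf_abs_le_norm[of z k] by (simp add: apply_restrict_seq)
      qed
    qed
    then have "Q (v - restrict_seq E v) \<le> K" using bnd vS u S subspace_diff[OF S(1)] by blast
    then show "(\<Sum>r\<in>F. Q (restrict_seq (B r) z)) \<le> K" using s(2) inv[OF vS u] unfolding v_def by simp
  qed
qed

section \<open>The Grothendieck property\<close>

lemma dual_elem_sum:
  assumes F: "dual_elem S F" and S: "subspace S" and x: "\<And>i. i \<in> A \<Longrightarrow> x i \<in> S" and "finite A"
  shows "F (\<Sum>i\<in>A. c i *\<^sub>R x i) = (\<Sum>i\<in>A. c i * F (x i))"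
  using \<open>finite A\<close> x
proof (induction A)
  case empty
  have "F (0 *\<^sub>R 0) = 0 * F 0" using F subspace_0[OF S] unfolding dual_elem_def by blast
  then show ?case by simp
next
  case (insert j A)
  have "(\<Sum>i\<in>A. c i *\<^sub>R x i) \<in> S" "c j *\<^sub>R x j \<in> S"
    using insert.prems S by (auto intro!: subspace_sum subspace_scale)
  then have "F (c j *\<^sub>R x j + (\<Sum>i\<in>A. c i *\<^sub>R x i)) = F (c j *\<^sub>R x j) + F (\<Sum>i\<in>A. c i *\<^sub>R x i)"
    using F unfolding dual_elem_def by blast
  moreover have "F (c j *\<^sub>R x j) = c j * F (x j)" using F insert.prems unfolding dual_elem_def by blast
  ultimately show ?case using insert by simp
qed

lemma apply_unitv: "apply_bcontfun (unitv k) n = (if n = k then 1 else 0)"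
  unfolding unitv_def by (subst linf_apply_Bcontfun[where b = 1]) auto

lemma unitv_c0: "unitv k \<in> c0"
proof -
  have "\<forall>n\<ge>Suc k. apply_bcontfun (unitv k) n = 0" by (auto simp: apply_unitv)
  then have "\<forall>\<^sub>F n in sequentially. apply_bcontfun (unitv k) n = 0"
    unfolding eventually_sequentially by blast
  then show ?thesis unfolding c0_def by (simp add: tendsto_eventually)
qed

lemma apply_unitv_sum:
  "apply_bcontfun (\<Sum>k<n. c k *\<^sub>R unitv k) m = (if m < n then c m else 0)"
  by (simp add: apply_sum apply_unitv if_distrib if_distribR sum.delta cong: if_cong)

lemma dual_elem_bound:
  assumes "dual_elem S F" obtains K where "K \<ge> 0" "\<And>x. x \<in> S \<Longrightarrow> \<bar>F x\<bar> \<le> K * norm x"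
proof -
  obtain K where K: "\<And>x. x \<in> S \<Longrightarrow> \<bar>F x\<bar> \<le> K * norm x" using assms unfolding dual_elem_def by blast
  have "\<bar>F x\<bar> \<le> max K 0 * norm x" if "x \<in> S" for x
    using K[OF that] mult_right_mono[of K "max K 0" "norm x"] by simp
  then show ?thesis using that[of "max K 0"] by simp
qed

text \<open>On \<open>c0\<close> the functional is given by an element of l_1: testing on vectors of
  signs bounds every partial sum by its norm.\<close>

lemma dual_elem_unitv_summable:
  assumes F: "dual_elem S F" and S: "subspace S" "c0 \<subseteq> S"
  shows "summable (\<lambda>k. \<bar>F (unitv k)\<bar>)"
proof -
  obtain K where K: "K \<ge> 0" "\<And>x. x \<in> S \<Longrightarrow> \<bar>F x\<bar> \<le> K * norm x" using dual_elem_bound[OF F] by blast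
  have uS: "unitv k \<in> S" for k using unitv_c0 S by blast
  have "(\<Sum>k<n. \<bar>F (unitv k)\<bar>) \<le> K" for n
  proof -
    define x where "x = (\<Sum>k<n. sgn (F (unitv k)) *\<^sub>R unitv k)"
    have xS: "x \<in> S" unfolding x_def using uS S by (intro subspace_sum subspace_scale) auto
    have "norm x \<le> 1" by (rule linf_norm_le) (auto simp: x_def apply_unitv_sum abs_sgn_eq)
    then have "F x \<le> K" using K(2)[OF xS] K(1) mult_left_mono[of "norm x" 1 K] by simp
    moreover have "F x = (\<Sum>k<n. \<bar>F (unitv k)\<bar>)"
      unfolding x_def by (subst dual_elem_sum[OF F S(1) uS]) (auto simp: abs_sgn mult.commute)
    ultimately show ?thesis by simp
  qed
  then show ?thesis by (intro summableI_nonneg_bounded[of _ K]) auto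
qed

lemma dual_elem_seq_summable:
  assumes F: "dual_elem S F" and S: "subspace S" "c0 \<subseteq> S"
  shows "summable (\<lambda>k. \<bar>apply_bcontfun z k * F (unitv k)\<bar>)"
proof (rule summable_comparison_test')
  show "summable (\<lambda>k. norm z * \<bar>F (unitv k)\<bar>)"
    using dual_elem_unitv_summable[OF assms] by (rule summable_mult)
  show "norm \<bar>apply_bcontfun z k * F (unitv k)\<bar> \<le> norm z * \<bar>F (unitv k)\<bar>" for k
    using linf_abs_le_norm[of z k] by (simp add: abs_mult mult_right_mono)
qed

text \<open>Truncations of u converge to u in norm, so on \<open>c0\<close> a functional acts
  through its coordinates. The remainder of a functional on larger subspaces is isolated later as
  \<open>\<sigma>\<close>.\<close>

lemma dual_elem_c0_sums:
  assumes F: "dual_elem S F" and S: "subspace S" "c0 \<subseteq> S" and u: "u \<in> c0"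
  shows "(\<lambda>k. apply_bcontfun u k * F (unitv k)) sums F u"
proof -
  obtain K where K: "K \<ge> 0" "\<And>x. x \<in> S \<Longrightarrow> \<bar>F x\<bar> \<le> K * norm x" using dual_elem_bound[OF F] by blast
  have uS: "unitv k \<in> S" for k using unitv_c0 S by blast
  show ?thesis unfolding sums_def
  proof (rule LIMSEQ_I)
    fix e :: real assume e: "e > 0"
    define d where "d = e / (2 * (K + 1))"
    have d: "d > 0" "K * d < e" using e K by (auto simp: d_def field_simps intro: add_nonneg_pos)
    obtain n0 where n0: "\<And>n. n \<ge> n0 \<Longrightarrow> \<bar>apply_bcontfun u n\<bar> < d"
      using u d unfolding c0_def by (force dest: LIMSEQ_D)
    have "norm ((\<Sum>k<n. apply_bcontfun u k * F (unitv k)) - F u) < e" if n: "n \<ge> n0" for n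
    proof -
      define x where "x = (\<Sum>k<n. apply_bcontfun u k *\<^sub>R unitv k)"
      have xS: "x \<in> S" unfolding x_def using uS S by (intro subspace_sum subspace_scale) auto
      have uuS: "u \<in> S" using u S by blast
      have "norm (u - x) \<le> d"
      proof (rule linf_norm_le)
        fix k show "\<bar>apply_bcontfun (u - x) k\<bar> \<le> d"
          using n0[of k] n d by (auto simp: x_def apply_unitv_sum not_less)
      qed
      then have "\<bar>F (u - x)\<bar> \<le> K * d"
        using K(2)[of "u - x"] subspace_diff[OF S(1) uuS xS] mult_left_mono[of "norm (u - x)" d K] K(1)
        by linarith
      moreover have "F ((u - x) + x) = F (u - x) + F x"
        using F subspace_diff[OF S(1) uuS xS] xS unfolding dual_elem_def by blast
      moreover have "F x = (\<Sum>k<n. apply_bcontfun u k * F (unitv k))"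
        unfolding x_def by (rule dual_elem_sum[OF F S(1)]) (use uS in auto)
      ultimately show ?thesis using d by simp
    qed
    then show "\<exists>n0. \<forall>n\<ge>n0. norm ((\<Sum>k<n. apply_bcontfun u k * F (unitv k)) - F u) < e" by blast
  qed
qed

text \<open>Convergence of each coordinate makes the mass before the current right end small for a
  late index; summability makes the tail beyond a new right end small. Each part gets e/2.\<close>

lemma gliding_hump:
  fixes w :: "nat \<Rightarrow> nat \<Rightarrow> real"
  assumes nonneg: "\<And>n k. w n k \<ge> 0" and summ: "\<And>n. summable (w n)"
    and lim: "\<And>k. (\<lambda>n. w n k) \<longlonglongrightarrow> 0" and I: "infinite I" and e: "e > 0"
  obtains n K :: "nat \<Rightarrow> nat" where "strict_mono n" "strict_mono K" "\<And>i. n i \<in> I"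
    "\<And>i. (\<Sum>k. if k \<in> {K i..<K (Suc i)} then 0 else w (n i) k) \<le> e"
proof -
  have step: "\<exists>n b'. n \<in> I \<and> m < n \<and> b < b' \<and> (\<Sum>k. if k \<in> {b..<b'} then 0 else w n k) \<le> e" for m b
  proof -
    have "(\<lambda>n. \<Sum>k<b. w n k) \<longlonglongrightarrow> (\<Sum>k<b. 0)" by (intro tendsto_sum lim)
    then have "\<forall>\<^sub>F n in sequentially. (\<Sum>k<b. w n k) < e / 2"
      using e by (intro order_tendstoD(2)[of _ 0]) auto
    then obtain n0 where n0: "\<And>n. n \<ge> n0 \<Longrightarrow> (\<Sum>k<b. w n k) < e / 2"
      unfolding eventually_sequentially by blast
    obtain n where n: "n \<in> I" "n > max m n0" using I infinite_nat_iff_unbounded by blast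
    obtain b0 where b0: "\<And>b'. b' \<ge> b0 \<Longrightarrow> norm (\<Sum>i. w n (i + b')) < e / 2"
      using suminf_exist_split[OF _ summ[of n], of "e/2"] e by auto
    define b' where "b' = max b0 (Suc b)"
    define v where "v k = (if k \<in> {b..<b'} then 0 else w n k)" for k
    have v: "summable v"
      by (rule summable_comparison_test'[OF summ[of n]]) (auto simp: v_def nonneg)
    have "suminf v = (\<Sum>k. v (k + b')) + (\<Sum>k<b'. v k)" by (rule suminf_split_initial_segment[OF v])
    also have "(\<Sum>k. v (k + b')) = (\<Sum>k. w n (k + b'))" by (simp add: v_def)
    also have "(\<Sum>k<b'. v k) = (\<Sum>k<b. w n k)"
      by (rule sum.mono_neutral_cong_right) (auto simp: v_def b'_def)
    finally have "suminf v \<le> e" using b0[of b'] n0[of n] n by (simp add: b'_def)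
    then show ?thesis using n unfolding v_def by (intro exI[of _ n] exI[of _ b']) (auto simp: b'_def)
  qed
  \<comment> \<open>A state is (index, left end, right end). Each left end is the previous right
    end, so the blocks are consecutive and \<open>K\<close> lists the left ends.\<close>
  let ?P = "\<lambda>x. case x of (n, a, b) \<Rightarrow> n \<in> I \<and> a < b \<and> (\<Sum>k. if k \<in> {a..<b} then 0 else w n k) \<le> e"
  have "\<exists>f. \<forall>i. ?P (f i) \<and> fst (f i) < fst (f (Suc i)) \<and> fst (snd (f (Suc i))) = snd (snd (f i))"
  proof (rule dependent_nat_choice)
    obtain n b' where "n \<in> I" "0 < b'" "(\<Sum>k. if k \<in> {0..<b'} then 0 else w n k) \<le> e"
      using step[of 0 0] by blast
    then show "\<exists>x. ?P x" by (intro exI[of _ "(n, 0, b')"]) simp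
    fix x and i :: nat
    obtain n b' where "n \<in> I" "fst x < n" "snd (snd x) < b'"
      "(\<Sum>k. if k \<in> {snd (snd x)..<b'} then 0 else w n k) \<le> e"
      using step[of "fst x" "snd (snd x)"] by blast
    then show "\<exists>y. ?P y \<and> fst x < fst y \<and> fst (snd y) = snd (snd x)"
      by (intro exI[of _ "(n, snd (snd x), b')"]) simp
  qed
  then obtain f where f0: "\<forall>i. ?P (f i) \<and> fst (f i) < fst (f (Suc i)) \<and> fst (snd (f (Suc i))) = snd (snd (f i))" ..
  then have f: "fst (f i) \<in> I" "fst (snd (f i)) < fst (snd (f (Suc i)))" "fst (f i) < fst (f (Suc i))"
    "(\<Sum>k. if k \<in> {fst (snd (f i))..<fst (snd (f (Suc i)))} then 0 else w (fst (f i)) k) \<le> e" for i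
    using f0[rule_format, of i] by (auto simp: case_prod_unfold)
  show ?thesis
  proof (rule that[of "\<lambda>i. fst (f i)" "\<lambda>i. fst (snd (f i))"])
  qed (use f in \<open>simp_all add: strict_mono_Suc_iff\<close>)
qed

lemma blocks_almost_disjoint:
  fixes K :: "nat \<Rightarrow> nat"
  assumes K: "strict_mono K" and "finite (M \<inter> M')"
  shows "finite ((\<Union>i\<in>M. {K i..<K (Suc i)}) \<inter> (\<Union>i\<in>M'. {K i..<K (Suc i)}))"
proof -
  have "i = j" if "k \<in> {K i..<K (Suc i)}" "k \<in> {K j..<K (Suc j)}" for i j k
  proof (rule ccontr)
    assume "i \<noteq> j"
    then have "Suc i \<le> j \<or> Suc j \<le> i" by auto
    then have "K (Suc i) \<le> K j \<or> K (Suc j) \<le> K i" using K strict_mono_less_eq by blast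
    then show False using that by auto
  qed
  then have "(\<Union>i\<in>M. {K i..<K (Suc i)}) \<inter> (\<Union>i\<in>M'. {K i..<K (Suc i)})
      \<subseteq> (\<Union>i\<in>M \<inter> M'. {K i..<K (Suc i)})" by blast
  then show ?thesis using assms(2) finite_subset by (metis finite_UN_I finite_atLeastLessThan)
qed

text \<open>\<open>Q\<close> abstracts the p-th moment of the image in the quotient: what counts is
  the two-point inequality, invariance under \<open>N\<close>, a bound on the ball of radius
  \<open>norm z\<close>, and that \<open>Q x = 0\<close> puts x into \<open>N\<close>.\<close>

lemma weakstar_null_linf_null:
  fixes Q :: "linf \<Rightarrow> real" and g :: "nat \<Rightarrow> linf \<Rightarrow> real" and z :: linf
  assumes N: "subspace N" "c0 \<subseteq> N" and nonneg: "\<And>x. Q x \<ge> 0"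
    and two: "\<And>a b. 2 * Q a + 2 * Q b \<le> Q (a + b) + Q (a - b)"
    and inv: "\<And>x u. u \<in> N \<Longrightarrow> Q (x - u) = Q x"
    and bnd: "\<And>x. norm x \<le> norm z \<Longrightarrow> Q x \<le> C"
    and ker: "\<And>x. Q x = 0 \<Longrightarrow> x \<in> N"
    and g: "\<And>n. dual_elem N (g n)" and conv: "\<And>x. x \<in> N \<Longrightarrow> (\<lambda>n. g n x) \<longlonglongrightarrow> 0"
  shows "(\<lambda>n. \<Sum>k. apply_bcontfun z k * g n (unitv k)) \<longlonglongrightarrow> 0"
proof (rule ccontr)
  define d where "d n = (\<Sum>k. apply_bcontfun z k * g n (unitv k))" for n
  define w where "w n k = \<bar>apply_bcontfun z k * g n (unitv k)\<bar>" for n k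
  assume "\<not> (\<lambda>n. \<Sum>k. apply_bcontfun z k * g n (unitv k)) \<longlonglongrightarrow> 0"
  then have "\<not> d \<longlonglongrightarrow> 0" unfolding d_def .
  then obtain \<delta> where \<delta>: "\<delta> > 0" "\<And>m. \<exists>n\<ge>m. \<not> \<bar>d n\<bar> < \<delta>" unfolding LIMSEQ_iff by auto
  define I where "I = {n. \<bar>d n\<bar> \<ge> \<delta>}"
  have I: "infinite I" unfolding infinite_nat_iff_unbounded_le I_def using \<delta>(2) by (auto simp: not_less)
  have wsum: "summable (w n)" for n
    unfolding w_def by (rule dual_elem_seq_summable[OF g N])
  have wlim: "(\<lambda>n. w n k) \<longlonglongrightarrow> 0" for k
  proof -
    have "(\<lambda>n. g n (unitv k)) \<longlonglongrightarrow> 0" using conv unitv_c0 N by blast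
    then show ?thesis unfolding w_def by (intro tendsto_rabs_zero tendsto_mult_right_zero)
  qed
  obtain n K where nK: "strict_mono n" "strict_mono K" "\<And>i. n i \<in> I"
    "\<And>i. (\<Sum>k. if k \<in> {K i..<K (Suc i)} then 0 else w (n i) k) \<le> \<delta> / 2"
    using gliding_hump[OF _ wsum wlim I, of "\<delta>/2"] \<delta>(1) by (auto simp: w_def)
  obtain M :: "(nat \<Rightarrow> bool) \<Rightarrow> nat set" where M: "\<And>r. infinite (M r)"
    "\<And>r r'. r \<noteq> r' \<Longrightarrow> finite (M r \<inter> M r')" using almost_disjoint_family by blast
  define B where "B r = (\<Union>i\<in>M r. {K i..<K (Suc i)})" for r
  have B: "finite (B r \<inter> B r')" if "r \<noteq> r'" for r r'
    unfolding B_def by (rule blocks_almost_disjoint[OF nK(2) M(2)[OF that]])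
  define y where "y r = restrict_seq (B r) z" for r
  \<comment> \<open>The whole space serves as \<open>S\<close> here: that \<open>y r\<close> lies in
    \<open>N\<close> is yet to be derived, from \<open>Q (y r) = 0\<close>.\<close>
  have cQ: "countable {r. Q (y r) \<noteq> 0}"
    using countable_nonzero_almost_disjoint[of UNIV Q z C B UNIV, OF _ _ nonneg two _ bnd B]
      inv subsetD[OF N(2)] unfolding y_def by auto
  define G where "G = {r. y r \<in> N}"
  \<comment> \<open>\<open>\<sigma> n\<close> is the part of \<open>g n\<close> that vanishes on \<^const>\<open>c0\<close>.\<close>
  define \<sigma> where "\<sigma> n x = g n x - (\<Sum>k. apply_bcontfun x k * g n (unitv k))" for n x
  have sm: "summable (\<lambda>k. apply_bcontfun x k * g m (unitv k))" for x m
    by (rule summable_rabs_cancel[OF dual_elem_seq_summable[OF g N]])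
  have \<sigma>_diff: "\<sigma> m (a - b) = \<sigma> m a - \<sigma> m b" if ab: "a \<in> N" "b \<in> N" for m a b
  proof -
    have "g m ((a - b) + b) = g m (a - b) + g m b"
      using g[of m] ab subspace_diff[OF N(1)] unfolding dual_elem_def by blast
    then show ?thesis unfolding \<sigma>_def using suminf_diff[OF sm sm, of a m b m] by (simp add: algebra_simps)
  qed
  have \<sigma>_add: "\<sigma> m (a + b) = \<sigma> m a + \<sigma> m b" if ab: "a \<in> N" "b \<in> N" for m a b
    using \<sigma>_diff[of "a + b" b m] ab subspace_add[OF N(1)] by simp
  have \<sigma>_c0: "\<sigma> m u = 0" if "u \<in> c0" for m u
    using dual_elem_c0_sums[OF g N that, of m] by (simp add: \<sigma>_def sums_iff)
  \<comment> \<open>The square of a functional satisfies the two-point inequality with equality, and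
    \<open>\<sigma> m\<close> vanishes on \<open>c0\<close>. The same countability lemma therefore
    applies, now on \<open>N\<close>, where \<open>g m\<close> is linear.\<close>
  have c\<sigma>: "countable {r \<in> G. (\<sigma> m (y r))\<^sup>2 \<noteq> 0}" for m
  proof -
    obtain L where L: "L \<ge> 0" "\<And>x. x \<in> N \<Longrightarrow> \<bar>g m x\<bar> \<le> L * norm x"
      using dual_elem_bound[OF g[of m]] by blast
    define C2 where "C2 = norm z * (\<Sum>k. \<bar>g m (unitv k)\<bar>)"
    have sg: "summable (\<lambda>k. \<bar>g m (unitv k)\<bar>)" by (rule dual_elem_unitv_summable[OF g N])
    have "(\<sigma> m x)\<^sup>2 \<le> (L * norm z + C2)\<^sup>2" if x: "x \<in> N" "norm x \<le> norm z" for x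
    proof -
      have "\<bar>\<Sum>k. apply_bcontfun x k * g m (unitv k)\<bar> \<le> (\<Sum>k. \<bar>apply_bcontfun x k * g m (unitv k)\<bar>)"
        by (rule summable_rabs[OF dual_elem_seq_summable[OF g N]])
      also have "\<dots> \<le> (\<Sum>k. norm z * \<bar>g m (unitv k)\<bar>)"
      proof (rule suminf_le)
        fix k
        have "\<bar>apply_bcontfun x k\<bar> \<le> norm z" using linf_abs_le_norm[of x k] x by simp
        then show "\<bar>apply_bcontfun x k * g m (unitv k)\<bar> \<le> norm z * \<bar>g m (unitv k)\<bar>"
          by (simp add: abs_mult mult_right_mono)
      qed (auto intro: dual_elem_seq_summable[OF g N] summable_mult sg)
      also have "\<dots> = C2" unfolding C2_def by (rule suminf_mult[OF sg])
      finally have "\<bar>\<sigma> m x\<bar> \<le> L * norm z + C2"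
        using L(2)[OF x(1)] mult_left_mono[OF x(2) L(1)] unfolding \<sigma>_def by linarith
      then show ?thesis by (metis abs_ge_zero power2_abs power_mono)
    qed
    note bound = this
    show ?thesis unfolding y_def
    proof (rule countable_nonzero_almost_disjoint[where S = N and K = "(L * norm z + C2)\<^sup>2"])
      show "2 * (\<sigma> m a)\<^sup>2 + 2 * (\<sigma> m b)\<^sup>2 \<le> (\<sigma> m (a + b))\<^sup>2 + (\<sigma> m (a - b))\<^sup>2"
        if "a \<in> N" "b \<in> N" for a b
        unfolding \<sigma>_add[OF that] \<sigma>_diff[OF that] by (simp add: power2_eq_square algebra_simps)
      show "(\<sigma> m (x - u))\<^sup>2 = (\<sigma> m x)\<^sup>2" if "x \<in> N" "u \<in> c0" for x u
        using \<sigma>_diff[OF that(1), of u m] \<sigma>_c0[OF that(2)] that(2) N by auto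
      show "restrict_seq (B r) z \<in> N" if "r \<in> G" for r using that by (simp add: G_def y_def)
    qed (fact N B bound | simp)+
  qed
  define E where "E = {r. Q (y r) \<noteq> 0} \<union> (\<Union>m. {r \<in> G. (\<sigma> m (y r))\<^sup>2 \<noteq> 0})"
  have "countable E" unfolding E_def
    using cQ c\<sigma> by (intro countable_Un countable_UN) auto
  then have "E \<noteq> UNIV" using uncountable_nat_bool by auto
  then obtain r where "r \<notin> E" by blast
  then have r: "Q (y r) = 0" "\<And>m. r \<in> G \<Longrightarrow> \<sigma> m (y r) = 0" by (auto simp: E_def)
  have yN: "y r \<in> N" using ker r by blast
  \<comment> \<open>For i in \<open>M r\<close> the block of i lies in \<open>B r\<close>, so
    passing from z to \<open>y r\<close> alters the pairing with \<open>g (n i)\<close> only outside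
    this block, by at most half of \<delta>.\<close>
  have big: "\<bar>g (n i) (y r)\<bar> \<ge> \<delta> / 2" if i: "i \<in> M r" for i
  proof -
    have val: "g (n i) (y r) = (\<Sum>k. apply_bcontfun (y r) k * g (n i) (unitv k))"
      using r(2)[of "n i"] yN by (simp add: \<sigma>_def G_def)
    have le: "\<bar>apply_bcontfun z k * g (n i) (unitv k) - apply_bcontfun (y r) k * g (n i) (unitv k)\<bar>
        \<le> (if k \<in> {K i..<K (Suc i)} then 0 else w (n i) k)" for k
      using i by (auto simp: y_def apply_restrict_seq w_def B_def)
    have s0: "summable (\<lambda>k. if k \<in> {K i..<K (Suc i)} then 0 else w (n i) k)"
      by (rule summable_comparison_test'[OF wsum[of "n i"]]) (auto simp: w_def)
    have s1: "summable (\<lambda>k. \<bar>apply_bcontfun z k * g (n i) (unitv k) - apply_bcontfun (y r) k * g (n i) (unitv k)\<bar>)"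
      by (rule summable_comparison_test'[OF s0]) (use le in auto)
    have "\<bar>d (n i) - g (n i) (y r)\<bar>
        = \<bar>\<Sum>k. apply_bcontfun z k * g (n i) (unitv k) - apply_bcontfun (y r) k * g (n i) (unitv k)\<bar>"
      unfolding val d_def by (simp add: suminf_diff[OF sm sm])
    also have "\<dots> \<le> (\<Sum>k. \<bar>apply_bcontfun z k * g (n i) (unitv k) - apply_bcontfun (y r) k * g (n i) (unitv k)\<bar>)"
      by (rule summable_rabs[OF s1])
    also have "\<dots> \<le> (\<Sum>k. if k \<in> {K i..<K (Suc i)} then 0 else w (n i) k)"
      by (rule suminf_le[OF le s1 s0])
    also have "\<dots> \<le> \<delta> / 2" by (rule nK(4))
    finally show ?thesis using nK(3)[of i] unfolding I_def by (auto simp: abs_if split: if_splits)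
  qed
  have "(\<lambda>i. g (n i) (y r)) \<longlonglongrightarrow> 0"
    using LIMSEQ_subseq_LIMSEQ[OF conv[OF yN] nK(1)] by (simp add: o_def)
  then obtain i0 where i0: "\<And>i. i \<ge> i0 \<Longrightarrow> \<bar>g (n i) (y r)\<bar> < \<delta> / 2"
    using \<delta>(1) by (fastforce simp: LIMSEQ_iff dest: spec[of _ "\<delta>/2"])
  obtain i where "i \<in> M r" "i \<ge> i0" using M(1)[of r] infinite_nat_iff_unbounded_le by blast
  then show False using big i0 by fastforce
qed

section \<open>Functions on the unit interval\<close>

lemma space_I01: "space I01 = {0..1}" by (simp add: space_restrict_space)

lemma finite_measure_I01: "finite_measure I01"
  by (rule finite_measure_lebesgue_on) (simp add: lmeasurable_interval)

lemma measure_I01: "A \<in> sets lborel \<Longrightarrow> A \<subseteq> {0..1} \<Longrightarrow> measure I01 A = measure lborel A"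
  by (subst measure_restrict_space) (auto simp: measure_completion)

lemma sets_I01: "A \<in> sets borel \<Longrightarrow> A \<inter> {0..1} \<in> sets I01"
  by (subst sets_restrict_space_iff) auto

abbreviation moment :: "real \<Rightarrow> (real \<Rightarrow> real) \<Rightarrow> real" where
  "moment p f \<equiv> (\<integral>t. \<bar>f t\<bar> powr p \<partial>I01)"

lemma Lp_fun_integrable:
  assumes "f \<in> Lp_fun p" shows "integrable I01 (\<lambda>t. \<bar>f t\<bar> powr p)" "f \<in> borel_measurable I01"
  using assms by (auto simp: Lp_fun_def)

lemma Lp_fun_imp_integrable:
  assumes f: "f \<in> Lp_fun p" and p: "p \<ge> 1"
  shows "integrable I01 f"
proof (rule Bochner_Integration.integrable_bound)
  interpret finite_measure I01 by (rule finite_measure_I01)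
  show "integrable I01 (\<lambda>t. 1 + \<bar>f t\<bar> powr p)"
    using Lp_fun_integrable[OF f] by simp
  show "f \<in> borel_measurable I01" by (rule Lp_fun_integrable[OF f])
  show "AE t in I01. norm (f t) \<le> norm (1 + \<bar>f t\<bar> powr p)"
    using le_add_powr[of "\<bar>f t\<bar>" 1 p for t] p by (intro AE_I2) simp
qed

lemma integrable_indicator_mult:
  fixes f :: "real \<Rightarrow> real"
  assumes "integrable I01 f" "A \<in> sets borel"
  shows "integrable I01 (\<lambda>t. indicator A t * f t)"
proof -
  have "integrable I01 (\<lambda>t. indicator (A \<inter> {0..1}) t *\<^sub>R f t)"
    by (rule integrable_mult_indicator[OF sets_I01[OF assms(2)] assms(1)])
  then show ?thesis
    by (rule Bochner_Integration.integrable_cong[THEN iffD1, rotated -1])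
       (auto simp: indicator_def space_I01)
qed

lemma integral_indicator_I01:
  assumes "A \<in> sets borel" "A \<subseteq> {0..1}"
  shows "(\<integral>t. indicat_real A t \<partial>I01) = measure lborel A"
  using assms sets_I01[OF assms(1)]
  by (simp add: measure_I01 space_I01 Int_absorb2 Bochner_Integration.integral_indicator)

text \<open>Hoelder's inequality on A; the factor \<open>2 powr p\<close> comes from optimising over
  thresholds instead of using conjugate exponents.\<close>

lemma Lp_integral_indicator_le:
  assumes f: "f \<in> Lp_fun p" and p: "p \<ge> 1" and A: "A \<in> sets borel" "A \<subseteq> {0..1}" "measure lborel A > 0"
  shows "(\<integral>t. indicator A t * \<bar>f t\<bar> \<partial>I01) powr p
    \<le> 2 powr p * (measure lborel A powr (p - 1) * (\<integral>t. indicator A t * \<bar>f t\<bar> powr p \<partial>I01))"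
proof (rule powr_le_of_le_add_powr[OF _ _ p])
  define \<mu> where "\<mu> = measure lborel A"
  interpret finite_measure I01 by (rule finite_measure_I01)
  have fi: "integrable I01 (\<lambda>t. indicator A t * \<bar>f t\<bar>)"
    using Lp_fun_imp_integrable[OF f p] A by (intro integrable_indicator_mult) auto
  have fp: "integrable I01 (\<lambda>t. indicator A t * \<bar>f t\<bar> powr p)"
    using Lp_fun_integrable[OF f] A by (intro integrable_indicator_mult) auto
  have Ai: "integrable I01 (indicat_real A)"
    using integrable_indicator_mult[of "\<lambda>_. 1" A] A by simp
  show "0 \<le> (\<integral>t. indicator A t * \<bar>f t\<bar> \<partial>I01)" by (rule integral_nonneg_AE) simp
  show "0 \<le> measure lborel A powr (p - 1) * (\<integral>t. indicator A t * \<bar>f t\<bar> powr p \<partial>I01)"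
    by (intro mult_nonneg_nonneg integral_nonneg_AE) auto
  fix c :: real assume c: "c > 0"
  have \<mu>: "\<mu> > 0" using A by (simp add: \<mu>_def)
  \<comment> \<open>The threshold is c divided by the measure of A, so that its integral over A is
    c.\<close>
  have "(\<integral>t. indicator A t * \<bar>f t\<bar> \<partial>I01)
      \<le> (\<integral>t. (c / \<mu>) * indicat_real A t + (c / \<mu>) powr (1 - p) * (indicator A t * \<bar>f t\<bar> powr p) \<partial>I01)"
  proof (rule integral_mono)
    fix t
    show "indicator A t * \<bar>f t\<bar> \<le> (c / \<mu>) * indicat_real A t + (c / \<mu>) powr (1 - p) * (indicator A t * \<bar>f t\<bar> powr p)"
      using le_add_powr[of "\<bar>f t\<bar>" "c / \<mu>" p] c \<mu> p by (auto simp: indicator_def)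
  qed (intro fi Bochner_Integration.integrable_add integrable_mult_right fp Ai)+
  also have "\<dots> = (c / \<mu>) * \<mu> + (c / \<mu>) powr (1 - p) * (\<integral>t. indicator A t * \<bar>f t\<bar> powr p \<partial>I01)"
    using fp Ai integral_indicator_I01[OF A(1,2)] by (simp add: \<mu>_def)
  also have "(c / \<mu>) powr (1 - p) = c powr (1 - p) * \<mu> powr (p - 1)"
    using c \<mu> by (simp add: powr_divide divide_powr_uminus)
  finally show "(\<integral>t. indicator A t * \<bar>f t\<bar> \<partial>I01)
      \<le> c + c powr (1 - p) * (measure lborel A powr (p - 1) * (\<integral>t. indicator A t * \<bar>f t\<bar> powr p \<partial>I01))"
    using \<mu> by (simp add: \<mu>_def algebra_simps)
qed

section \<open>Dyadic intervals and step functions\<close>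

definition dyadic :: "nat \<Rightarrow> nat \<Rightarrow> real set" where
  "dyadic m i = {real i / 2^m ..< (real i + 1) / 2^m}"

abbreviation dyadic_int :: "nat \<Rightarrow> nat \<Rightarrow> (real \<Rightarrow> real) \<Rightarrow> real" where
  "dyadic_int m i f \<equiv> (\<integral>t. indicator (dyadic m i) t * f t \<partial>I01)"

lemma dyadic_borel [measurable]: "dyadic m i \<in> sets borel" by (simp add: dyadic_def)

lemma measure_dyadic: "measure lborel (dyadic m i) = 1 / 2^m"
  by (simp add: dyadic_def divide_right_mono flip: diff_divide_distrib)

lemma dyadic_subset: "i < 2^m \<Longrightarrow> dyadic m i \<subseteq> {0..1}"
proof -
  assume "i < 2^m"
  then have "real i + 1 \<le> 2^m" by (metis Suc_leI of_nat_Suc of_nat_le_iff of_nat_numeral of_nat_power add.commute)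
  then have "(real i + 1) / 2^m \<le> 1" by simp
  moreover have "0 \<le> real i / 2^m" by simp
  ultimately show ?thesis unfolding dyadic_def by (intro subsetI) (unfold atLeastAtMost_iff atLeastLessThan_iff, linarith)
qed

lemma in_dyadic_iff: "t \<ge> 0 \<Longrightarrow> t \<in> dyadic m i \<longleftrightarrow> nat \<lfloor>t * 2^m\<rfloor> = i"
proof -
  assume "t \<ge> 0"
  then have "nat \<lfloor>t * 2^m\<rfloor> = i \<longleftrightarrow> \<lfloor>t * 2^m\<rfloor> = int i" by auto
  also have "\<dots> \<longleftrightarrow> real i \<le> t * 2^m \<and> t * 2^m < real i + 1" by (simp add: floor_eq_iff)
  also have "\<dots> \<longleftrightarrow> t \<in> dyadic m i" by (simp add: dyadic_def field_simps)
  finally show ?thesis by simp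
qed

lemma sum_dyadic:
  assumes t: "0 \<le> t" "t < 1"
  shows "(\<Sum>i<2^m. c i * indicat_real (dyadic m i) t) = c (nat \<lfloor>t * 2^m\<rfloor>)"
proof -
  have "\<lfloor>t * 2^m\<rfloor> < 2^m" using t by (simp add: floor_less_iff)
  then have lt: "nat \<lfloor>t * 2^m\<rfloor> < 2^m" by (simp add: nat_less_iff)
  have "(\<Sum>i<2^m. c i * indicat_real (dyadic m i) t) = (\<Sum>i<2^m. if i = nat \<lfloor>t * 2^m\<rfloor> then c i else 0)"
    using in_dyadic_iff[OF t(1)] by (intro sum.cong) (auto simp: indicator_def)
  also have "\<dots> = c (nat \<lfloor>t * 2^m\<rfloor>)" using lt by simp
  finally show ?thesis .
qed

text \<open>The half-open cells cover [0,1) and miss the point 1, so identities summed over cells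
  hold only almost everywhere.\<close>

lemma AE_I01_less_1: "AE t in I01. 0 \<le> t \<and> t < 1"
proof -
  have "AE t in lebesgue. t \<noteq> (1::real)" by (rule AE_completion) (rule AE_lborel_singleton)
  then have "AE t in I01. t \<noteq> 1" by (auto simp: AE_restrict_space_iff elim: eventually_mono)
  moreover have "AE t in I01. t \<in> {0..1}" by (rule AE_I2) (simp add: space_I01)
  ultimately show ?thesis by eventually_elim auto
qed

definition step :: "nat \<Rightarrow> (nat \<Rightarrow> real) \<Rightarrow> real \<Rightarrow> real" where
  "step m c t = (\<Sum>i<2^m. c i * indicat_real (dyadic m i) t)"

lemma step_borel [measurable]: "step m c \<in> borel_measurable borel"
  unfolding step_def[abs_def] by measurable

lemma borel_measurable_I01I [measurable (raw)]: "f \<in> borel_measurable borel \<Longrightarrow> f \<in> borel_measurable I01"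
  by (intro measurable_restrict_space1) (auto intro: measurable_completion)

lemma integrable_dyadic: "integrable I01 (indicat_real (dyadic m i))"
proof -
  interpret finite_measure I01 by (rule finite_measure_I01)
  show ?thesis using integrable_indicator_mult[of "\<lambda>_. 1" "dyadic m i"] by simp
qed

lemma integrable_step [simp]: "integrable I01 (step m c)"
  unfolding step_def[abs_def]
  by (intro Bochner_Integration.integrable_sum integrable_mult_right integrable_dyadic)

text \<open>On [0,1) exactly one cell contributes, so \<phi> passes inside. At t = 1 both step
  functions are 0, while \<phi> 0 need not be.\<close>

lemma AE_step_apply: "AE t in I01. \<phi> (step m c t) = step m (\<lambda>i. \<phi> (c i)) t"
  using AE_I01_less_1 by eventually_elim (unfold step_def, simp only: sum_dyadic)

lemma integral_step: "(\<integral>t. step m c t \<partial>I01) = (\<Sum>i<2^m. c i) / 2^m"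
proof -
  have "(\<integral>t. step m c t \<partial>I01) = (\<Sum>i<2^m. c i * (\<integral>t. indicat_real (dyadic m i) t \<partial>I01))"
    unfolding step_def using integrable_dyadic by (subst Bochner_Integration.integral_sum) auto
  also have "\<dots> = (\<Sum>i<2^m. c i * (1 / 2^m))"
    using integral_indicator_I01[OF dyadic_borel dyadic_subset] by (intro sum.cong) (auto simp: measure_dyadic)
  finally show ?thesis by (simp add: sum_divide_distrib)
qed

lemma integral_AE_eq_step:
  assumes "AE t in I01. f t = step m c t" "f \<in> borel_measurable I01"
  shows "integrable I01 f" "(\<integral>t. f t \<partial>I01) = (\<Sum>i<2^m. c i) / 2^m"
proof -
  show "integrable I01 f"
    using integrable_cong_AE[OF assms(2) _ assms(1)] by simp
  show "(\<integral>t. f t \<partial>I01) = (\<Sum>i<2^m. c i) / 2^m"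
    using integral_cong_AE[OF assms(2) _ assms(1)] by (simp add: integral_step)
qed

lemma step_Lp_fun: "step m c \<in> Lp_fun p"
  and integral_step_powr: "moment p (step m c) = (\<Sum>i<2^m. \<bar>c i\<bar> powr p) / 2^m"
proof -
  have "AE t in I01. \<bar>step m c t\<bar> powr p = step m (\<lambda>i. \<bar>c i\<bar> powr p) t"
    by (rule AE_step_apply)
  from integral_AE_eq_step[OF this]
  show "step m c \<in> Lp_fun p" "moment p (step m c) = (\<Sum>i<2^m. \<bar>c i\<bar> powr p) / 2^m"
    by (auto simp: Lp_fun_def)
qed

section \<open>Quotient maps onto \<open>L\<^sub>p\<close>\<close>

text \<open>Fixes the witnesses hidden in \<open>quot_iso_Lp\<close>, so that estimates can refer to
  \<open>T\<close> and to its two constants.\<close>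

locale Lp_quotient =
  fixes N :: "linf set" and p :: real and T :: "linf \<Rightarrow> real \<Rightarrow> real" and C c :: real
  assumes N: "subspace N" and p: "p \<ge> 2"
    and T_Lp: "T x \<in> Lp_fun p"
    and T_add: "AE t in I01. T (x + y) t = T x t + T y t"
    and T_scale: "AE t in I01. T (a *\<^sub>R x) t = a * T x t"
    and T_ker: "(AE t in I01. T x t = 0) \<longleftrightarrow> x \<in> N"
    and T_onto: "f \<in> Lp_fun p \<Longrightarrow> \<exists>x. AE t in I01. T x t = f t"
    and C: "C > 0" and T_upper: "Lp_norm p (T x) \<le> C * infdist x N"
    and c: "c > 0" and T_lower: "c * infdist x N \<le> Lp_norm p (T x)"
begin

text \<open>The p-th moment rather than the norm, because the two-point inequality for numbers can
  be integrated.\<close>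

definition Q :: "linf \<Rightarrow> real" where "Q x = moment p (T x)"

lemma Q_nonneg: "Q x \<ge> 0" unfolding Q_def by (rule integral_nonneg_AE) simp

lemma Lp_norm_T: "Lp_norm p (T x) = Q x powr (1 / p)" by (simp add: Lp_norm_def Q_def)

lemma Q_le: "Q x \<le> (C * infdist x N) powr p"
proof -
  have "(Q x powr (1 / p)) powr p \<le> (C * infdist x N) powr p"
    using T_upper[of x] p by (intro powr_mono2) (auto simp: Lp_norm_T)
  then show ?thesis using p Q_nonneg[of x] by (simp add: powr_powr)
qed

lemma infdist_N_le: "infdist x N \<le> norm x"
  using infdist_le[of 0 N x] subspace_0[OF N] by simp

lemma T_diff: "AE t in I01. T (x - y) t = T x t - T y t"
  using T_add[of x "(-1) *\<^sub>R y"] T_scale[of "-1" y] by eventually_elim simp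

lemma integrable_T: "integrable I01 (T x)"
  using Lp_fun_imp_integrable[OF T_Lp] p by simp

lemma Q_cong: "AE t in I01. T x t = f t \<Longrightarrow> f \<in> borel_measurable I01 \<Longrightarrow> Q x = moment p f"
  unfolding Q_def using Lp_fun_integrable(2)[OF T_Lp]
  by (intro integral_cong_AE) auto

lemma Q_two: "2 * Q a + 2 * Q b \<le> Q (a + b) + Q (a - b)"
proof -
  note i = Lp_fun_integrable(1)[OF T_Lp]
  have "2 * Q a + 2 * Q b = (\<integral>t. 2 * \<bar>T a t\<bar> powr p + 2 * \<bar>T b t\<bar> powr p \<partial>I01)"
    using i by (simp add: Q_def)
  also have "\<dots> \<le> (\<integral>t. \<bar>T (a + b) t\<bar> powr p + \<bar>T (a - b) t\<bar> powr p \<partial>I01)"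
  proof (rule integral_mono_AE)
    show "AE t in I01. 2 * \<bar>T a t\<bar> powr p + 2 * \<bar>T b t\<bar> powr p \<le> \<bar>T (a + b) t\<bar> powr p + \<bar>T (a - b) t\<bar> powr p"
      using T_add[of a b] T_diff[of a b] by eventually_elim (use abs_powr_two_point[OF p] in simp)
  qed (use i in auto)
  also have "\<dots> = Q (a + b) + Q (a - b)" using i by (simp add: Q_def)
  finally show ?thesis .
qed

lemma Q_diff_N: assumes "u \<in> N" shows "Q (x - u) = Q x"
proof (unfold Q_def[of x], rule Q_cong)
  have "AE t in I01. T u t = 0" using T_ker assms by simp
  with T_diff[of x u] show "AE t in I01. T (x - u) t = T x t" by eventually_elim simp
qed (rule Lp_fun_integrable[OF T_Lp])

lemma Q_eq_0: assumes "Q x = 0" shows "x \<in> N"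
proof -
  have "AE t in I01. \<bar>T x t\<bar> powr p = 0"
    using assms integral_nonneg_eq_0_iff_AE[OF Lp_fun_integrable(1)[OF T_Lp]] by (simp add: Q_def)
  then have "AE t in I01. T x t = 0" by eventually_elim simp
  then show ?thesis using T_ker by simp
qed

end

lemma quot_iso_Lp_obtain:
  assumes "quot_iso_Lp N p" "subspace N" "p \<ge> 2"
  obtains T C c where "Lp_quotient N p T C c"
proof -
  from assms(1) obtain T C c where h: "\<forall>x. T x \<in> Lp_fun p"
     "\<forall>x y. AE t in I01. T (x + y) t = T x t + T y t"
     "\<forall>a x. AE t in I01. T (a *\<^sub>R x) t = a * T x t"
     "\<forall>x. (AE t in I01. T x t = 0) \<longleftrightarrow> x \<in> N"
     "\<forall>f\<in>Lp_fun p. \<exists>x. AE t in I01. T x t = f t"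
     "C > 0" "\<forall>x. Lp_norm p (T x) \<le> C * infdist x N"
     "c > 0" "\<forall>x. c * infdist x N \<le> Lp_norm p (T x)"
    unfolding quot_iso_Lp_def by (elim exE conjE) (rule that)
  show ?thesis
  proof (rule that[of T C c], rule Lp_quotient.intro)
    show "AE t in I01. T (x + y) t = T x t + T y t" for x y using h(2) by (elim allE)
    show "AE t in I01. T (a *\<^sub>R x) t = a * T x t" for a x using h(3) by (elim allE)
    show "(AE t in I01. T x t = 0) \<longleftrightarrow> x \<in> N" for x using h(4) by (elim allE)
    show "\<exists>x. AE t in I01. T x t = f t" if "f \<in> Lp_fun p" for f using h(5) that by (rule bspec)
  qed (use h assms in auto)
qed

text \<open>Subtracting the limit reduces the claim to weak-star null sequences, with the p-th
  moment in the role of \<open>Q\<close>.\<close>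

theorem quot_iso_Lp_imp_grothendieck:
  assumes cN: "closed_subspace N" "c0 \<subseteq> N" and q: "quot_iso_Lp N p" and p: "p \<ge> 2"
  shows "linf_grothendieck N"
  unfolding linf_grothendieck_def
proof (intro conjI allI impI cN, elim conjE)
  have S: "subspace N" using cN by (simp add: closed_subspace_def)
  obtain T C c where "Lp_quotient N p T C c" using quot_iso_Lp_obtain[OF q S p] .
  then interpret Lp_quotient N p T C c .
  fix fs f assume fs: "\<forall>n. dual_elem N (fs n)" and f: "dual_elem N f" and w: "weakstar_conv N fs f"
  show "linf_conv fs f" unfolding linf_conv_def
  proof
    fix z :: linf
    have dual: "dual_elem N (\<lambda>x. fs n x - f x)" for n
    proof -
      obtain K1 K2 where K: "\<And>x. x \<in> N \<Longrightarrow> \<bar>fs n x\<bar> \<le> K1 * norm x" "\<And>x. x \<in> N \<Longrightarrow> \<bar>f x\<bar> \<le> K2 * norm x"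
        using dual_elem_bound[OF f] dual_elem_bound[OF fs[rule_format, of n]] by metis
      have "\<bar>fs n x - f x\<bar> \<le> (K1 + K2) * norm x" if "x \<in> N" for x
        using K[OF that] by (simp add: algebra_simps)
      then show ?thesis using fs[rule_format, of n] f unfolding dual_elem_def
        by (auto simp: algebra_simps intro!: exI[of _ "K1 + K2"])
    qed
    have sm: "summable (\<lambda>k. apply_bcontfun z k * F (unitv k))" if "dual_elem N F" for F
      by (rule summable_rabs_cancel[OF dual_elem_seq_summable[OF that S cN(2)]])
    have "(\<lambda>n. \<Sum>k. apply_bcontfun z k * (fs n (unitv k) - f (unitv k))) \<longlonglongrightarrow> 0"
    proof (rule weakstar_null_linf_null[where Q = Q and C = "(C * norm z) powr p", OF S cN(2)])
      show "Q x \<le> (C * norm z) powr p" if "norm x \<le> norm z" for x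
        using infdist_N_le[of x] that C p infdist_nonneg[of x N]
        by (intro order_trans[OF Q_le] powr_mono2 mult_left_mono) auto
      show "(\<lambda>n. fs n x - f x) \<longlonglongrightarrow> 0" if "x \<in> N" for x
        using w that unfolding weakstar_conv_def by (simp add: LIM_zero)
    qed (use Q_nonneg Q_two Q_diff_N Q_eq_0 dual in auto)
    also have "(\<lambda>n. \<Sum>k. apply_bcontfun z k * (fs n (unitv k) - f (unitv k)))
        = (\<lambda>n. (\<Sum>k. apply_bcontfun z k * fs n (unitv k)) - (\<Sum>k. apply_bcontfun z k * f (unitv k)))"
      using suminf_diff[OF sm sm] fs f by (simp add: right_diff_distrib)
    finally show "(\<lambda>n. \<Sum>k. apply_bcontfun z k * fs n (unitv k)) \<longlonglongrightarrow> (\<Sum>k. apply_bcontfun z k * f (unitv k))"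
      by (simp add: LIM_zero_iff)
  qed
qed

section \<open>Riesz products\<close>

definition signs :: "nat \<Rightarrow> (nat \<Rightarrow> real) set" where
  "signs n = PiE {..<n} (\<lambda>_. {-1, 1})"

text \<open>A Riesz product with imaginary coefficients: the imaginary part of the product of 1 + i
  \<omega>_k y_k. The coefficient of a single sign \<omega>_k in its Walsh expansion is y_k.\<close>

definition riesz :: "nat \<Rightarrow> (nat \<Rightarrow> real) \<Rightarrow> (nat \<Rightarrow> real) \<Rightarrow> real" where
  "riesz n y \<omega> = Im (\<Prod>k<n. Complex 1 (\<omega> k * y k))"

lemma card_signs: "card (signs n) = 2 ^ n"
  unfolding signs_def by (subst card_PiE) (auto simp flip: numeral_2_eq_2)

lemma finite_signs: "finite (signs n)"
  unfolding signs_def by (intro finite_PiE) auto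

lemma signsD: "\<omega> \<in> signs n \<Longrightarrow> i < n \<Longrightarrow> \<omega> i \<in> {-1, 1}"
  by (auto simp: signs_def PiE_iff)

text \<open>Each factor has modulus sqrt (1 + t^2), which is at most exp (t^2 / 2). So the l_2 norm
  of y controls the product; real factors would bring in the l_1 norm.\<close>

lemma abs_riesz_le:
  assumes "\<omega> \<in> signs n" "(\<Sum>i<n. (y i)\<^sup>2) \<le> D"
  shows "\<bar>riesz n y \<omega>\<bar> \<le> exp (D / 2)"
proof -
  have "\<bar>riesz n y \<omega>\<bar> \<le> cmod (\<Prod>k<n. Complex 1 (\<omega> k * y k))"
    unfolding riesz_def by (rule abs_Im_le_cmod)
  also have "\<dots> = (\<Prod>k<n. cmod (Complex 1 (\<omega> k * y k)))" by (rule prod_norm[symmetric])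
  also have "\<dots> \<le> (\<Prod>k<n. exp ((y k)\<^sup>2 / 2))"
  proof (rule prod_mono, intro conjI)
    fix k assume "k \<in> {..<n}"
    then have "(\<omega> k)\<^sup>2 = 1" using signsD[OF assms(1), of k] by auto
    then have "cmod (Complex 1 (\<omega> k * y k)) = sqrt (1 + (y k)\<^sup>2)"
      by (simp add: cmod_def power_mult_distrib)
    also have "\<dots> \<le> sqrt (exp ((y k)\<^sup>2))" by (simp add: exp_ge_add_one_self)
    also have "exp ((y k)\<^sup>2) = (exp ((y k)\<^sup>2 / 2))\<^sup>2" by (simp add: power2_eq_square flip: exp_add)
    finally show "cmod (Complex 1 (\<omega> k * y k)) \<le> exp ((y k)\<^sup>2 / 2)" by simp
  qed auto
  also have "\<dots> = exp ((\<Sum>k<n. (y k)\<^sup>2) / 2)" by (simp add: exp_sum sum_divide_distrib)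
  also have "\<dots> \<le> exp (D / 2)" using assms(2) by simp
  finally show ?thesis .
qed

text \<open>The sum over all sign vectors factorises: a factor at k different from i contributes 2,
  the one at i contributes \<open>2 * Complex 0 (y i)\<close>.\<close>

lemma riesz_coeff:
  assumes i: "i < n"
  shows "(\<Sum>\<omega>\<in>signs n. \<omega> i * riesz n y \<omega>) = 2 ^ n * y i"
proof -
  define F where "F k a = (if k = i then complex_of_real a else 1) * Complex 1 (a * y k)" for k and a :: real
  have "(\<Sum>\<omega>\<in>signs n. \<omega> i * riesz n y \<omega>) = Im (\<Sum>\<omega>\<in>signs n. \<Prod>k<n. F k (\<omega> k))"
    unfolding Im_sum
  proof (rule sum.cong[OF refl])
    fix \<omega>
    have "(\<Prod>k<n. F k (\<omega> k)) = complex_of_real (\<omega> i) * (\<Prod>k<n. Complex 1 (\<omega> k * y k))"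
      unfolding F_def prod.distrib using i by (simp add: prod.delta)
    then show "\<omega> i * riesz n y \<omega> = Im (\<Prod>k<n. F k (\<omega> k))"
      by (simp add: riesz_def)
  qed
  also have "(\<Sum>\<omega>\<in>signs n. \<Prod>k<n. F k (\<omega> k)) = (\<Prod>k<n. \<Sum>a\<in>{-1,1}. F k a)"
    unfolding signs_def by (rule prod_sum_PiE[symmetric]) auto
  also have "\<dots> = (\<Prod>k<n. 2 * (if k = i then Complex 0 (y i) else 1))"
    by (rule prod.cong) (auto simp: F_def complex_eq_iff)
  also have "\<dots> = 2 ^ n * Complex 0 (y i)"
    unfolding prod.distrib using i by (simp add: prod.delta)
  also have "Im \<dots> = 2 ^ n * y i" 
  proof -
    have "(2::complex) ^ n = of_real (2 ^ n)" by simp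
    then show ?thesis by (simp only: Im_complex_of_real times_complex.sel Re_complex_of_real) simp
  qed
  finally show ?thesis .
qed

section \<open>Non-isomorphic subspaces\<close>

lemma le_mult_infdist:
  assumes "N \<noteq> {}" "K \<ge> 0" "\<And>u. u \<in> N \<Longrightarrow> a \<le> K * dist x u"
  shows "a \<le> K * infdist x N"
proof (cases "K = 0")
  case True
  then show ?thesis using assms by auto
next
  case False
  then have "K > 0" using assms by simp
  then have "a / K \<le> infdist x N"
    unfolding infdist_notempty[OF assms(1)]
    by (intro cINF_greatest[OF assms(1)]) (use assms(3) in \<open>simp add: field_simps\<close>)
  then show ?thesis using \<open>K > 0\<close> by (simp add: field_simps)
qed

text \<open>Boundedness of the operator that \<open>W\<close> induces between the quotients.\<close>

lemma infdist_image_le: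
  fixes W :: "linf \<Rightarrow> linf"
  assumes W: "linear W" "\<And>x. norm (W x) \<le> K * norm x" "K \<ge> 0"
    and map: "\<And>u. u \<in> N \<Longrightarrow> W u \<in> N'" and "N \<noteq> {}"
  shows "infdist (W x) N' \<le> K * infdist x N"
proof (rule le_mult_infdist[OF \<open>N \<noteq> {}\<close> \<open>K \<ge> 0\<close>])
  fix u assume "u \<in> N"
  then have "infdist (W x) N' \<le> dist (W x) (W u)" using map by (intro infdist_le) auto
  also have "\<dots> \<le> K * dist x u"
    using W(2)[of "x - u"] by (simp add: dist_norm linear_diff[OF W(1)])
  finally show "infdist (W x) N' \<le> K * dist x u" .
qed

text \<open>An operator that kills \<open>N\<close> factors through the quotient with the same
  bound.\<close>

lemma norm_le_infdist:
  fixes W :: "linf \<Rightarrow> linf"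
  assumes W: "linear W" "\<And>x. norm (W x) \<le> K * norm x" "K \<ge> 0"
    and ker: "\<And>u. u \<in> N \<Longrightarrow> W u = 0" and "N \<noteq> {}"
  shows "norm (W x) \<le> K * infdist x N"
proof (rule le_mult_infdist[OF \<open>N \<noteq> {}\<close> \<open>K \<ge> 0\<close>])
  fix u assume "u \<in> N"
  then have "norm (W x) = norm (W (x - u))" using ker linear_diff[OF W(1)] by simp
  also have "\<dots> \<le> K * dist x u" using W(2)[of "x - u"] by (simp add: dist_norm)
  finally show "norm (W x) \<le> K * dist x u" .
qed

text \<open>Split off a square from \<open>\<bar>a i\<bar> powr r\<close>; the remaining (r - 2)-th
  power is at most S^(r/2 - 1), where S is the sum of the squares.\<close>

lemma sum_powr_le_sum_squares:
  fixes a :: "'i \<Rightarrow> real"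
  assumes "r \<ge> 2" "finite A"
  shows "(\<Sum>i\<in>A. \<bar>a i\<bar> powr r) \<le> (\<Sum>i\<in>A. (a i)\<^sup>2) powr (r / 2)"
proof (cases "(\<Sum>i\<in>A. (a i)\<^sup>2) = 0")
  case True
  then have "\<forall>i\<in>A. a i = 0" using assms by (simp add: sum_nonneg_eq_0_iff)
  then show ?thesis using True by simp
next
  case False
  define S where "S = (\<Sum>i\<in>A. (a i)\<^sup>2)"
  have S: "S > 0" using False by (simp add: S_def sum_nonneg less_le)
  have "(\<Sum>i\<in>A. \<bar>a i\<bar> powr r) \<le> (\<Sum>i\<in>A. (a i)\<^sup>2 * S powr (r / 2 - 1))"
  proof (rule sum_mono)
    fix i assume i: "i \<in> A"
    show "\<bar>a i\<bar> powr r \<le> (a i)\<^sup>2 * S powr (r / 2 - 1)"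
    proof (cases "a i = 0")
      case False
      have eq: "(a i)\<^sup>2 = \<bar>a i\<bar> powr 2" using False by (simp add: powr_numeral)
      have "(a i)\<^sup>2 \<le> S" unfolding S_def using i assms by (intro member_le_sum) auto
      then have "((a i)\<^sup>2) powr (r / 2 - 1) \<le> S powr (r / 2 - 1)" using assms by (intro powr_mono2) auto
      moreover have "((a i)\<^sup>2) powr (r / 2 - 1) = \<bar>a i\<bar> powr (r - 2)"
        unfolding eq powr_powr by (simp add: algebra_simps)
      moreover have "\<bar>a i\<bar> powr r = (a i)\<^sup>2 * \<bar>a i\<bar> powr (r - 2)"
        unfolding eq powr_add[symmetric] by simp
      ultimately show ?thesis by (simp add: mult_left_mono)
    qed (use S in simp)
  qed
  also have "\<dots> = S * S powr (r / 2 - 1)" by (simp add: S_def sum_distrib_right)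
  also have "\<dots> = S powr (r / 2)" using S by (simp add: powr_mult_base)
  finally show ?thesis by (simp add: S_def)
qed

section \<open>Functionals on the quotient and the trace estimate\<close>

context Lp_quotient begin

lemma T_0: "AE t in I01. T 0 t = 0" using T_ker subspace_0[OF N] by simp

lemma T_sum: assumes "finite A"
  shows "AE t in I01. T (\<Sum>i\<in>A. a i *\<^sub>R x i) t = (\<Sum>i\<in>A. a i * T (x i) t)"
  using assms
proof (induction A)
  case empty
  then show ?case using T_0 by simp
next
  case (insert j A)
  show ?case
    using insert(3) T_add[of "a j *\<^sub>R x j" "\<Sum>i\<in>A. a i *\<^sub>R x i"] T_scale[of "a j" "x j"]
    by eventually_elim (use insert(1,2) in simp)
qed

lemma infdist_le_Q: "infdist x N \<le> Q x powr (1 / p) / c"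
  using T_lower[of x] c by (simp add: Lp_norm_T field_simps)

definition pairing :: "real set \<Rightarrow> linf \<Rightarrow> real" where
  "pairing A x = (\<integral>t. indicator A t * T x t \<partial>I01)"

lemma linear_pairing: assumes "A \<in> sets borel" shows "linear (pairing A)"
proof (rule linearI)
  have i: "integrable I01 (\<lambda>t. indicator A t * T x t)" for x
    by (rule integrable_indicator_mult[OF integrable_T assms])
  show "pairing A (x + y) = pairing A x + pairing A y" for x y
  proof -
    have "pairing A (x + y) = (\<integral>t. indicator A t * T x t + indicator A t * T y t \<partial>I01)"
      unfolding pairing_def
    proof (rule integral_cong_AE)
      show "AE t in I01. indicator A t * T (x + y) t = indicator A t * T x t + indicator A t * T y t"
        using T_add[of x y] by eventually_elim (simp add: algebra_simps)
    qed (use i[THEN borel_measurable_integrable] in auto)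
    then show ?thesis using i by (simp add: pairing_def)
  qed
  show "pairing A (a *\<^sub>R x) = a *\<^sub>R pairing A x" for a x
  proof -
    have "pairing A (a *\<^sub>R x) = (\<integral>t. a * (indicator A t * T x t) \<partial>I01)"
      unfolding pairing_def
    proof (rule integral_cong_AE)
      show "AE t in I01. indicator A t * T (a *\<^sub>R x) t = a * (indicator A t * T x t)"
        using T_scale[of a x] by eventually_elim simp
    qed (use i[THEN borel_measurable_integrable] in auto)
    then show ?thesis by (simp add: pairing_def)
  qed
qed

lemma abs_pairing_le: "\<bar>pairing A x\<bar> \<le> (\<integral>t. indicator A t * \<bar>T x t\<bar> \<partial>I01)"
  unfolding pairing_def
  by (rule order_trans[OF integral_abs_bound]) (simp add: abs_mult)

text \<open>Hoelder's inequality transported through \<open>T\<close>: on a cell of measure 1/n it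
  gives n^(1/p - 1) times the distance to \<open>N\<close>, up to constants.\<close>

lemma integral_indicator_T_le:
  assumes A: "A \<in> sets borel" "A \<subseteq> {0..1}" "measure lborel A > 0"
  shows "(\<integral>t. indicator A t * \<bar>T x t\<bar> \<partial>I01) \<le> 2 * measure lborel A powr (1 - 1 / p) * (C * infdist x N)"
proof -
  define I where "I = (\<integral>t. indicator A t * \<bar>T x t\<bar> \<partial>I01)"
  have I: "I \<ge> 0" unfolding I_def by (rule integral_nonneg_AE) simp
  have "(\<integral>t. indicator A t * \<bar>T x t\<bar> powr p \<partial>I01) \<le> Q x"
    unfolding Q_def using Lp_fun_integrable(1)[OF T_Lp] A(1)
    by (intro integral_mono integrable_indicator_mult) (auto simp: indicator_def)
  then have "I powr p \<le> 2 powr p * (measure lborel A powr (p - 1) * (C * infdist x N) powr p)"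
    using Lp_integral_indicator_le[OF T_Lp _ A, of x] p Q_le[of x]
    unfolding I_def by (smt (verit) mult_left_mono powr_ge_zero)
  then have "(I powr p) powr (1 / p) \<le> (2 powr p * (measure lborel A powr (p - 1) * (C * infdist x N) powr p)) powr (1 / p)"
    using p by (intro powr_mono2) auto
  also have "\<dots> = 2 * (measure lborel A powr ((p - 1) / p) * (C * infdist x N))"
    using p C by (simp add: powr_mult powr_powr infdist_nonneg)
  also have "(p - 1) / p = 1 - 1 / p" using p by (simp add: field_simps)
  finally show ?thesis using p I by (simp add: powr_powr I_def)
qed

end

text \<open>For n = 2^m, \<open>x i\<close> lifts the indicator of the i-th cell and
  \<open>\<beta> i\<close> integrates over that cell, so the numbers \<open>\<beta> i (x i)\<close>
  add up to 1. Writing the identity as VW - D splits this trace: VW gives the summand with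
  \<open>F\<close>, D the one with \<open>M\<close>.\<close>

lemma quotient_estimate:
  assumes "Lp_quotient Np p Tp Cp cp" and "Lp_quotient Nr r Tr Cr cr"
    and V: "linear V" "\<And>x. norm (V x) \<le> KV * norm x" "KV \<ge> 0" "\<And>u. u \<in> Np \<Longrightarrow> V u \<in> Nr"
    and W: "linear W" "\<And>x. norm (W x) \<le> KW * norm x" "KW \<ge> 0" "\<And>u. u \<in> Nr \<Longrightarrow> W u \<in> Np"
    and VW: "\<And>u. u \<in> Nr \<Longrightarrow> V (W u) = u"
  obtains M F where "\<And>m. 1 \<le> M * (2^m) powr (- (1 / r)) + F * (2^m) powr (1 / r - 1 / p)"
proof -
  interpret P: Lp_quotient Np p Tp Cp cp by fact
  interpret R: Lp_quotient Nr r Tr Cr cr by fact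
  have ne: "Np \<noteq> {}" "Nr \<noteq> {}" using subspace_0[OF P.N] subspace_0[OF R.N] by auto
  note pr = P.p R.p P.c R.c P.C R.C
  \<comment> \<open>\<open>1 / cr\<close> bounds the distance to \<open>Nr\<close> of a signed sum
    of the \<open>x i\<close>, whose image has modulus 1 almost everywhere. \<open>C1\<close> then
    bounds the moment of its image under \<open>W\<close>, and \<open>E\<close> the norm of
    \<open>V W - 1\<close> on lifts of the unit ball of L_r.\<close>
  define C1 where "C1 = (Cp * (KW * (1 / cr))) powr p"
  define E where "E = (KV * KW + 1) / cr"
  define M where "M = 2 * (Cr * exp (E\<^sup>2 / 2))"
  define F where "F = 2 * (Cr * (KV / cp)) * (1 + C1)"
  have "1 \<le> M * (2^m) powr (- (1 / r)) + F * (2^m) powr (1 / r - 1 / p)" for m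
  proof -
    define n :: nat where "n = 2^m"
    define \<nu> where "\<nu> = real n"
    have n: "\<nu> \<ge> 1" "\<nu> = 2^m" by (auto simp: n_def \<nu>_def)
    have "\<exists>x. AE t in I01. Tr x t = indicat_real (dyadic m i) t" if "i < n" for i
    proof (rule R.T_onto)
      have "AE t in I01. indicat_real (dyadic m i) t = step m (\<lambda>j. if j = i then 1 else 0) t"
        using that by (simp add: step_def if_distrib[of "\<lambda>u. u * _"] sum.delta n_def cong: if_cong)
      moreover have "\<bar>indicat_real (dyadic m i) t\<bar> powr r = indicat_real (dyadic m i) t" for t
        by (auto simp: indicator_def)
      ultimately show "indicat_real (dyadic m i) \<in> Lp_fun r"
        using integrable_dyadic by (auto simp: Lp_fun_def)
    qed
    then obtain x where x: "\<And>i. i < n \<Longrightarrow> AE t in I01. Tr (x i) t = indicat_real (dyadic m i) t" by metis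
    have Tx: "AE t in I01. Tr (\<Sum>i<n. a i *\<^sub>R x i) t = step m a t" for a
    proof -
      have "AE t in I01. \<forall>i\<in>{..<n}. Tr (x i) t = indicat_real (dyadic m i) t"
        by (rule AE_finite_allI) (use x in auto)
      with R.T_sum[OF finite_lessThan, of a x n] show ?thesis
        by eventually_elim (unfold step_def n_def[symmetric], auto intro!: sum.cong)
    qed
    have dist: "infdist (\<Sum>i<n. a i *\<^sub>R x i) Nr \<le> ((\<Sum>i<n. \<bar>a i\<bar> powr r) / \<nu>) powr (1 / r) / cr" for a
      using R.infdist_le_Q[of "\<Sum>i<n. a i *\<^sub>R x i"] R.Q_cong[OF Tx[of a]]
      by (simp add: integral_step_powr n_def \<nu>_def)
    define G where "G i = P.Q (W (x i))" for i
    \<comment> \<open>The cotype of L_p enters here: for suitable signs the sum of the moments is at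
      most the moment of a single signed sum.\<close>
    have G: "(\<Sum>i<n. G i) \<le> C1"
    proof -
      obtain s where s: "\<And>i. s i \<in> {-1, 1::real}" "(\<Sum>i<n. P.Q (W (x i))) \<le> P.Q (W (\<Sum>i<n. s i *\<^sub>R x i))"
        using signs_superadditive[of "{..<n}" UNIV "\<lambda>v. P.Q (W v)" x] P.Q_nonneg P.Q_two
        by (auto simp: linear_add[OF W(1)] linear_diff[OF W(1)])
      define X where "X = (\<Sum>i<n. s i *\<^sub>R x i)"
      have "\<bar>s i\<bar> powr r = 1" for i using s(1)[of i] by auto
      then have "infdist X Nr \<le> 1 / cr"
        using dist[of s] n by (simp add: X_def \<nu>_def)
      then have "infdist (W X) Np \<le> KW * (1 / cr)"
        using infdist_image_le[OF W(1-4) ne(2), of X] mult_left_mono[OF _ W(3)] by (meson order_trans)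
      then have "P.Q (W X) \<le> C1" unfolding C1_def
        using pr by (intro order_trans[OF P.Q_le] powr_mono2 mult_left_mono) (auto simp: infdist_nonneg)
      then show ?thesis using s(2) unfolding X_def G_def by linarith
    qed
    have Gp: "(\<Sum>i<n. G i powr (1 / p)) \<le> \<nu> powr (1 - 1 / p) * (1 + C1)"
    proof -
      \<comment> \<open>The order of \<open>G i powr (1 / p)\<close> when n equal moments have
        bounded sum; this threshold reproduces the exponent of Hoelder's inequality.\<close>
      define b where "b = \<nu> powr (- (1 / p))"
      have b: "b > 0" using n by (simp add: b_def)
      have b1: "b powr (1 - p) = \<nu> powr (1 - 1 / p)"
        unfolding b_def powr_powr by (rule arg_cong[where f = "\<lambda>e. \<nu> powr e"]) (use pr in \<open>simp add: field_simps\<close>)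
      have b2: "\<nu> * b = \<nu> powr (1 - 1 / p)"
        unfolding b_def using n by (simp add: powr_mult_base)
      have "(\<Sum>i<n. G i powr (1 / p)) \<le> (\<Sum>i<n. b + b powr (1 - p) * G i)"
      proof (rule sum_mono)
        fix i
        show "G i powr (1 / p) \<le> b + b powr (1 - p) * G i"
          using le_add_powr[of "G i powr (1 / p)" b p] b pr P.Q_nonneg[of "W (x i)"]
          by (simp add: G_def powr_powr)
      qed
      also have "\<dots> = \<nu> * b + b powr (1 - p) * (\<Sum>i<n. G i)"
        by (simp add: sum.distrib sum_distrib_left \<nu>_def)
      also have "\<dots> \<le> \<nu> * b + b powr (1 - p) * C1" using G by (simp add: mult_left_mono)
      finally show ?thesis unfolding b1 b2 by (simp add: algebra_simps)
    qed
    define D where "D v = V (W v) - v" for v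
    have D: "linear D" unfolding D_def[abs_def]
      using V(1) W(1) by (intro linear_compose_sub linear_id[unfolded id_def] linear_compose[of W V, unfolded o_def])
    have Dn: "norm (D v) \<le> (KV * KW + 1) * norm v" for v
    proof -
      have "norm (D v) \<le> norm (V (W v)) + norm v" unfolding D_def by (rule norm_triangle_ineq4)
      also have "norm (V (W v)) \<le> KV * (KW * norm v)"
        using V(2)[of "W v"] mult_left_mono[OF W(2)[of v] V(3)] by linarith
      finally show ?thesis by (simp add: algebra_simps)
    qed
    have Ddist: "norm (D v) \<le> (KV * KW + 1) * infdist v Nr" for v
      by (rule norm_le_infdist[OF D Dn _ _ ne(2)]) (use V(3) W(3) VW in \<open>auto simp: D_def\<close>)
    \<comment> \<open>The factor \<open>\<nu> powr (1 / r)\<close> normalises the indicator of a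
      cell in L_r.\<close>
    define u where "u i k = \<nu> powr (1 / r) * apply_bcontfun (D (x i)) k" for i k
    have u: "(\<Sum>i<n. (u i k)\<^sup>2) \<le> E\<^sup>2" for k
    proof -
      \<comment> \<open>\<open>D\<close> is tested on the combination whose coefficients are these
        k-th coordinates themselves. The k-th coordinate of the image is then \<open>S\<close>,
        while its norm is at most \<open>E * sqrt S / \<nu> powr (1 / r)\<close>, because
        \<open>r \<ge> 2\<close>.\<close>
      define a where "a i = apply_bcontfun (D (x i)) k" for i
      define S where "S = (\<Sum>i<n. (a i)\<^sup>2)"
      have S: "S \<ge> 0" unfolding S_def by (rule sum_nonneg) simp
      have E0: "E \<ge> 0" using V(3) W(3) pr by (simp add: E_def)
      have "S = apply_bcontfun (D (\<Sum>i<n. a i *\<^sub>R x i)) k"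
        by (simp add: linear_sum[OF D] linear_scale[OF D] apply_sum S_def power2_eq_square a_def)
      also have "\<dots> \<le> norm (D (\<Sum>i<n. a i *\<^sub>R x i))" using linf_abs_le_norm by (metis abs_le_D1)
      also have "\<dots> \<le> (KV * KW + 1) * (((\<Sum>i<n. \<bar>a i\<bar> powr r) / \<nu>) powr (1 / r) / cr)"
        using Ddist[of "\<Sum>i<n. a i *\<^sub>R x i"] mult_left_mono[OF dist[of a], of "KV * KW + 1"] V(3) W(3)
        by (meson add_nonneg_nonneg mult_nonneg_nonneg order_trans zero_le_one)
      also have "\<dots> = E * ((\<Sum>i<n. \<bar>a i\<bar> powr r) / \<nu>) powr (1 / r)" by (simp add: E_def)
      also have "\<dots> \<le> E * (S powr (r / 2) / \<nu>) powr (1 / r)"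
        using sum_powr_le_sum_squares[of r "{..<n}" a] pr n E0
        by (intro mult_left_mono powr_mono2 divide_right_mono) (auto simp: S_def sum_nonneg)
      also have "(S powr (r / 2) / \<nu>) powr (1 / r) = sqrt S / \<nu> powr (1 / r)"
        using n S pr by (simp add: powr_divide powr_powr powr_half_sqrt)
      finally have "S * \<nu> powr (1 / r) \<le> E * sqrt S" using n by (simp add: field_simps)
      then have "sqrt S * (sqrt S * \<nu> powr (1 / r)) \<le> sqrt S * E"
        using S by (simp add: algebra_simps flip: mult.assoc real_sqrt_mult)
      then have "sqrt S * \<nu> powr (1 / r) \<le> E \<or> S = 0" using S by (auto simp: mult_le_cancel_left)
      then have "sqrt S * \<nu> powr (1 / r) \<le> E" using E0 by auto
      then have "(sqrt S * \<nu> powr (1 / r))\<^sup>2 \<le> E\<^sup>2" using S by (intro power_mono) auto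
      then show ?thesis using S
        by (simp add: u_def power_mult_distrib S_def a_def sum_distrib_left mult.commute)
    qed
    \<comment> \<open>Riesz products in every coordinate k. They are bounded uniformly in n, and
      averaging them against \<omega>_i returns the normalised \<open>D (x i)\<close>.\<close>
    define Y where "Y \<omega> = Bcontfun (\<lambda>k. riesz n (\<lambda>i. u i k) \<omega>)" for \<omega>
    have Yk: "apply_bcontfun (Y \<omega>) k = riesz n (\<lambda>i. u i k) \<omega>" if "\<omega> \<in> signs n" for \<omega> k
      unfolding Y_def by (subst linf_apply_Bcontfun[where b = "exp (E\<^sup>2 / 2)"]) (use abs_riesz_le[OF that u] in auto)
    have Yn: "norm (Y \<omega>) \<le> exp (E\<^sup>2 / 2)" if "\<omega> \<in> signs n" for \<omega>
      by (rule linf_norm_le) (use Yk abs_riesz_le[OF _ u] that in auto)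
    have YD: "(\<Sum>\<omega>\<in>signs n. \<omega> i *\<^sub>R Y \<omega>) = (2^n * \<nu> powr (1 / r)) *\<^sub>R D (x i)" if "i < n" for i
    proof (rule bcontfun_eqI)
      fix k
      have "apply_bcontfun (\<Sum>\<omega>\<in>signs n. \<omega> i *\<^sub>R Y \<omega>) k = (\<Sum>\<omega>\<in>signs n. \<omega> i * riesz n (\<lambda>i. u i k) \<omega>)"
        unfolding apply_sum by (intro sum.cong) (auto simp: Yk)
      also have "\<dots> = 2^n * u i k" by (rule riesz_coeff[OF that])
      finally show "apply_bcontfun (\<Sum>\<omega>\<in>signs n. \<omega> i *\<^sub>R Y \<omega>) k = apply_bcontfun ((2^n * \<nu> powr (1 / r)) *\<^sub>R D (x i)) k"
        by (simp add: u_def)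
    qed
    define \<beta> where "\<beta> i = R.pairing (dyadic m i)" for i
    have \<beta>: "linear (\<beta> i)" for i unfolding \<beta>_def by (rule R.linear_pairing) simp
    \<comment> \<open>For one fixed \<omega> the signed pairings with all cells add up to at most
      the L_1 norm of \<open>Tr (Y \<omega>)\<close>, so no factor n is lost.\<close>
    have sumY: "\<bar>\<Sum>i<n. \<omega> i * \<beta> i (Y \<omega>)\<bar> \<le> M" if \<omega>: "\<omega> \<in> signs n" for \<omega>
    proof -
      have TY: "integrable I01 (\<lambda>t. \<bar>Tr (Y \<omega>) t\<bar>)" using R.integrable_T by simp
      have "\<bar>\<Sum>i<n. \<omega> i * \<beta> i (Y \<omega>)\<bar> \<le> (\<Sum>i<n. \<bar>\<omega> i * \<beta> i (Y \<omega>)\<bar>)" by (rule sum_abs)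
      also have "\<dots> \<le> (\<Sum>i<n. \<integral>t. indicator (dyadic m i) t * \<bar>Tr (Y \<omega>) t\<bar> \<partial>I01)"
      proof (rule sum_mono)
        fix i assume "i \<in> {..<n}"
        then have "\<bar>\<omega> i\<bar> = 1" using signsD[OF \<omega>, of i] by auto
        then show "\<bar>\<omega> i * \<beta> i (Y \<omega>)\<bar> \<le> (\<integral>t. indicator (dyadic m i) t * \<bar>Tr (Y \<omega>) t\<bar> \<partial>I01)"
          using R.abs_pairing_le by (simp add: abs_mult \<beta>_def)
      qed
      also have "\<dots> = (\<integral>t. (\<Sum>i<n. indicator (dyadic m i) t * \<bar>Tr (Y \<omega>) t\<bar>) \<partial>I01)"
        by (rule Bochner_Integration.integral_sum[symmetric]) (rule integrable_indicator_mult[OF TY], simp)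
      also have "\<dots> \<le> (\<integral>t. indicator {0..1} t * \<bar>Tr (Y \<omega>) t\<bar> \<partial>I01)"
      proof (rule integral_mono_AE)
        show "AE t in I01. (\<Sum>i<n. indicator (dyadic m i) t * \<bar>Tr (Y \<omega>) t\<bar>) \<le> indicator {0..1} t * \<bar>Tr (Y \<omega>) t\<bar>"
          using AE_I01_less_1
        proof eventually_elim
          case (elim t)
          have "(\<Sum>i<n. indicator (dyadic m i) t * \<bar>Tr (Y \<omega>) t\<bar>) = (\<Sum>i<2^m. \<bar>Tr (Y \<omega>) t\<bar> * indicat_real (dyadic m i) t)"
            unfolding n_def by (simp only: mult.commute)
          also have "\<dots> = \<bar>Tr (Y \<omega>) t\<bar>" using elim by (subst sum_dyadic) auto
          finally have eq: "(\<Sum>i<n. indicator (dyadic m i) t * \<bar>Tr (Y \<omega>) t\<bar>) = \<bar>Tr (Y \<omega>) t\<bar>" .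
          have "indicat_real {0..1} t = 1" using elim by simp
          then show ?case by (simp only: eq mult_1_left order_refl)
        qed
      qed (intro Bochner_Integration.integrable_sum integrable_indicator_mult[OF TY], auto intro: integrable_indicator_mult[OF TY])
      also have "\<dots> \<le> 2 * (Cr * infdist (Y \<omega>) Nr)"
        using R.integral_indicator_T_le[of "{0..1}" "Y \<omega>"] by simp
      also have "\<dots> \<le> M" unfolding M_def
        using R.infdist_N_le[of "Y \<omega>"] Yn[OF \<omega>] pr by (intro mult_left_mono) auto
      finally show ?thesis .
    qed
    have "2^n * \<nu> powr (1 / r) * (\<Sum>i<n. \<beta> i (D (x i))) = (\<Sum>i<n. \<beta> i ((2^n * \<nu> powr (1 / r)) *\<^sub>R D (x i)))"
      by (simp add: linear_scale[OF \<beta>] sum_distrib_left)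
    also have "\<dots> = (\<Sum>i<n. \<beta> i (\<Sum>\<omega>\<in>signs n. \<omega> i *\<^sub>R Y \<omega>))" using YD by (intro sum.cong) auto
    also have "\<dots> = (\<Sum>\<omega>\<in>signs n. \<Sum>i<n. \<omega> i * \<beta> i (Y \<omega>))"
      by (subst sum.swap) (simp add: linear_sum[OF \<beta>] linear_scale[OF \<beta>])
    finally have "\<bar>2^n * \<nu> powr (1 / r) * (\<Sum>i<n. \<beta> i (D (x i)))\<bar> \<le> (\<Sum>\<omega>\<in>signs n. M)"
      using sumY by (simp only:) (rule order_trans[OF sum_abs sum_mono], auto)
    then have "2^n * (\<nu> powr (1 / r) * \<bar>\<Sum>i<n. \<beta> i (D (x i))\<bar>) \<le> 2^n * M"
      by (simp add: card_signs abs_mult)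
    then have "\<nu> powr (1 / r) * \<bar>\<Sum>i<n. \<beta> i (D (x i))\<bar> \<le> M" by simp
    then have one: "\<bar>\<Sum>i<n. \<beta> i (D (x i))\<bar> \<le> M * \<nu> powr (- (1 / r))"
      using n by (simp add: powr_minus field_simps)
    have \<beta>x: "\<beta> i (x i) = 1 / \<nu>" if i: "i < n" for i
    proof -
      have "\<beta> i (x i) = (\<integral>t. indicat_real (dyadic m i) t \<partial>I01)"
        unfolding \<beta>_def R.pairing_def
      proof (rule integral_cong_AE)
        show "AE t in I01. indicat_real (dyadic m i) t * Tr (x i) t = indicat_real (dyadic m i) t"
          using x[OF i] by eventually_elim (simp add: indicator_def)
        show "(\<lambda>t. indicat_real (dyadic m i) t * Tr (x i) t) \<in> borel_measurable I01"
          by (rule borel_measurable_integrable[OF integrable_indicator_mult[OF R.integrable_T]]) simp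
      qed (use integrable_dyadic in blast)
      then show ?thesis
        using integral_indicator_I01[OF dyadic_borel dyadic_subset] i n by (simp add: measure_dyadic n_def)
    qed
    have \<beta>VW: "\<bar>\<beta> i (V (W (x i)))\<bar> \<le> 2 * (Cr * (KV / cp)) * \<nu> powr (1 / r - 1) * G i powr (1 / p)" if i: "i < n" for i
    proof -
      have "\<bar>\<beta> i (V (W (x i)))\<bar> \<le> 2 * (measure lborel (dyadic m i) powr (1 - 1 / r) * (Cr * infdist (V (W (x i))) Nr))"
        unfolding \<beta>_def using i
        by (intro order_trans[OF R.abs_pairing_le] R.integral_indicator_T_le[unfolded mult.assoc] dyadic_subset) (auto simp: n_def measure_dyadic)
      also have "measure lborel (dyadic m i) powr (1 - 1 / r) = \<nu> powr (1 / r - 1)"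
        using n by (simp add: measure_dyadic powr_divide divide_powr_uminus)
      also have "\<nu> powr (1 / r - 1) * (Cr * infdist (V (W (x i))) Nr)
          \<le> \<nu> powr (1 / r - 1) * (Cr * (KV * (G i powr (1 / p) / cp)))"
      proof (intro mult_left_mono)
        show "infdist (V (W (x i))) Nr \<le> KV * (G i powr (1 / p) / cp)"
          using infdist_image_le[OF V(1-4) ne(1), of "W (x i)"] P.infdist_le_Q[of "W (x i)"]
            mult_left_mono[OF _ V(3)] unfolding G_def by (meson order_trans)
      qed (use pr in auto)
      finally show ?thesis by (simp add: algebra_simps)
    qed
    have "(\<Sum>i<n. \<beta> i (D (x i))) = (\<Sum>i<n. \<beta> i (V (W (x i)))) - (\<Sum>i<n. \<beta> i (x i))"
      by (simp add: D_def linear_diff[OF \<beta>] sum_subtractf)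
    also have "(\<Sum>i<n. \<beta> i (x i)) = 1" using \<beta>x n by (simp add: \<nu>_def)
    finally have "1 \<le> \<bar>\<Sum>i<n. \<beta> i (D (x i))\<bar> + \<bar>\<Sum>i<n. \<beta> i (V (W (x i)))\<bar>" by linarith
    also have "\<bar>\<Sum>i<n. \<beta> i (V (W (x i)))\<bar> \<le> (\<Sum>i<n. 2 * (Cr * (KV / cp)) * \<nu> powr (1 / r - 1) * G i powr (1 / p))"
      by (rule order_trans[OF sum_abs sum_mono]) (use \<beta>VW in auto)
    also have "\<dots> = 2 * (Cr * (KV / cp)) * \<nu> powr (1 / r - 1) * (\<Sum>i<n. G i powr (1 / p))"
      by (simp only: sum_distrib_left)
    also have "\<dots> \<le> 2 * (Cr * (KV / cp)) * \<nu> powr (1 / r - 1) * (\<nu> powr (1 - 1 / p) * (1 + C1))"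
      using Gp pr V(3) by (intro mult_left_mono) auto
    also have "\<dots> = F * (\<nu> powr (1 / r - 1) * \<nu> powr (1 - 1 / p))" by (simp add: F_def algebra_simps)
    also have "\<nu> powr (1 / r - 1) * \<nu> powr (1 - 1 / p) = \<nu> powr (1 / r - 1 / p)" by (simp flip: powr_add)
    finally show ?thesis using one n by simp
  qed
  then show ?thesis by (rule that)
qed

text \<open>For p < r both exponents, -1/r and 1/r - 1/p, are negative, so the estimate fails for
  large m.\<close>

lemma no_factorization:
  assumes "Lp_quotient Np p Tp Cp cp" and "Lp_quotient Nr r Tr Cr cr" and lt: "p < r"
    and V: "linear V" "\<And>x. norm (V x) \<le> KV * norm x" "KV \<ge> 0" "\<And>u. u \<in> Np \<Longrightarrow> V u \<in> Nr"
    and W: "linear W" "\<And>x. norm (W x) \<le> KW * norm x" "KW \<ge> 0" "\<And>u. u \<in> Nr \<Longrightarrow> W u \<in> Np"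
    and VW: "\<And>u. u \<in> Nr \<Longrightarrow> V (W u) = u"
  shows False
proof -
  obtain M F where MF: "\<And>m. 1 \<le> M * (2^m) powr (- (1 / r)) + F * (2^m) powr (1 / r - 1 / p)"
    using quotient_estimate[OF assms(1,2) V W VW] by blast
  have p: "p > 0" using assms(1) by (simp add: Lp_quotient_def)
  have lim: "(\<lambda>m. (2^m) powr (- e)) \<longlonglongrightarrow> 0" if "e > 0" for e :: real
  proof -
    have "(2^m) powr (- e) = (2 powr (- e)) ^ m" for m
      by (simp add: powr_realpow[symmetric] powr_powr mult.commute)
    then show ?thesis using that by (simp add: LIMSEQ_power_zero powr_less_one)
  qed
  have "(\<lambda>m. M * (2^m) powr (- (1 / r)) + F * (2^m) powr (- (1 / p - 1 / r))) \<longlonglongrightarrow> M * 0 + F * 0"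
    using lt p by (intro tendsto_intros lim) (auto simp: frac_less2)
  then have "1 \<le> M * 0 + F * 0" using MF by (intro LIMSEQ_le_const) auto
  then show False by simp
qed

text \<open>The extensions to all bounded sequences are inverse to each other only on the two
  subspaces; the defect elsewhere is what the trace argument estimates.\<close>

lemma subspace_iso_extend:
  assumes "subspace_iso A B" and A: "subspace A" and B: "subspace B"
  obtains V W KV KW where
    "linear V" "\<And>x. norm (V x) \<le> KV * norm x" "KV \<ge> 0" "\<And>u. u \<in> A \<Longrightarrow> V u \<in> B"
    "linear W" "\<And>x. norm (W x) \<le> KW * norm x" "KW \<ge> 0" "\<And>u. u \<in> B \<Longrightarrow> W u \<in> A"
    "\<And>u. u \<in> A \<Longrightarrow> W (V u) = u" "\<And>u. u \<in> B \<Longrightarrow> V (W u) = u"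
proof -
  obtain U K1 K2 where U: "bij_betw U A B" "\<And>x y. x \<in> A \<Longrightarrow> y \<in> A \<Longrightarrow> U (x + y) = U x + U y"
     "\<And>c x. x \<in> A \<Longrightarrow> U (c *\<^sub>R x) = c *\<^sub>R U x" "\<And>x. x \<in> A \<Longrightarrow> norm (U x) \<le> K1 * norm x"
     "\<And>x. x \<in> A \<Longrightarrow> norm x \<le> K2 * norm (U x)"
    using assms(1) unfolding subspace_iso_def by blast
  define U' where "U' = inv_into A U"
  have U'A: "U' x \<in> A" and UU': "U (U' x) = x" if "x \<in> B" for x
    using that U(1) unfolding U'_def by (auto simp: bij_betw_def f_inv_into_f inv_into_into)
  have UB: "U x \<in> B" and U'U: "U' (U x) = x" if "x \<in> A" for x
    using that U(1) unfolding U'_def by (auto simp: bij_betw_def)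
  obtain V KV where V: "linear V" "\<And>x. x \<in> A \<Longrightarrow> V x = U x" "\<And>x. norm (V x) \<le> KV * norm x" "KV \<ge> 0"
    using extend_operator_linf[OF A, of U K1] U by metis
  obtain W KW where W: "linear W" "\<And>x. x \<in> B \<Longrightarrow> W x = U' x" "\<And>x. norm (W x) \<le> KW * norm x" "KW \<ge> 0"
  proof (rule extend_operator_linf[OF B, of U' K2])
    show "U' (x + y) = U' x + U' y" if "x \<in> B" "y \<in> B" for x y
      using U'U[of "U' x + U' y"] U(2)[of "U' x" "U' y"] U'A UU' that subspace_add[OF A] by metis
    show "U' (a *\<^sub>R x) = a *\<^sub>R U' x" if "x \<in> B" for a x
      using U'U[of "a *\<^sub>R U' x"] U(3)[of "U' x" a] U'A UU' that subspace_scale[OF A] by metis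
    show "norm (U' x) \<le> K2 * norm x" if "x \<in> B" for x using U(5)[of "U' x"] U'A UU' that by simp
  qed blast
  show ?thesis
    by (rule that[OF V(1,3,4) _ W(1,3,4)]) (simp_all add: V(2) W(2) UB U'U U'A UU')
qed

section \<open>Averages over finite products\<close>

definition avg :: "'a set \<Rightarrow> ('a \<Rightarrow> real) \<Rightarrow> real" where
  "avg A g = (\<Sum>a\<in>A. g a) / card A"

lemma avg_cmult: "avg A (\<lambda>a. c * g a) = c * avg A g"
  by (simp add: avg_def sum_distrib_left)

lemma avg_add: "avg A (\<lambda>a. g a + h a) = avg A g + avg A h"
  by (simp add: avg_def sum.distrib add_divide_distrib)

lemma avg_diff: "avg A (\<lambda>a. g a - h a) = avg A g - avg A h"
  by (simp add: avg_def sum_subtractf diff_divide_distrib)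

lemma avg_sum: "avg A (\<lambda>a. \<Sum>i\<in>I. g i a) = (\<Sum>i\<in>I. avg A (g i))"
  unfolding avg_def by (subst sum.swap) (simp add: sum_divide_distrib)

lemma avg_mono: "(\<And>a. a \<in> A \<Longrightarrow> g a \<le> h a) \<Longrightarrow> avg A g \<le> avg A h"
  by (simp add: avg_def divide_right_mono sum_mono)

lemma avg_const: "finite A \<Longrightarrow> A \<noteq> {} \<Longrightarrow> avg A (\<lambda>_. c) = c"
  by (simp add: avg_def)

lemma avg_cong: "(\<And>a. a \<in> A \<Longrightarrow> g a = h a) \<Longrightarrow> avg A g = avg A h"
  by (simp add: avg_def)

text \<open>\<open>\<bar>u\<bar> \<le> (1 + u\<^sup>2) / 2\<close> stands in for the Cauchy-Schwarz
  inequality.\<close>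

lemma avg_mult_le:
  assumes W: "finite W" "W \<noteq> {}" and x: "\<And>\<omega>. \<omega> \<in> W \<Longrightarrow> \<bar>x \<omega>\<bar> \<le> 1"
  shows "avg W (\<lambda>\<omega>. u \<omega> * x \<omega>) \<le> 1/2 + (1/2) * avg W (\<lambda>\<omega>. (u \<omega>)\<^sup>2)"
proof -
  have "avg W (\<lambda>\<omega>. u \<omega> * x \<omega>) \<le> avg W (\<lambda>\<omega>. (1/2) * 1 + (1/2) * (u \<omega>)\<^sup>2)"
  proof (rule avg_mono)
    fix \<omega> assume "\<omega> \<in> W"
    have "u \<omega> * x \<omega> \<le> \<bar>u \<omega>\<bar> * \<bar>x \<omega>\<bar>" by (metis abs_ge_self abs_mult)
    also have "\<dots> \<le> \<bar>u \<omega>\<bar> * 1" using x[OF \<open>\<omega> \<in> W\<close>] by (intro mult_left_mono) auto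
    also have "\<dots> \<le> (1/2) * 1 + (1/2) * (u \<omega>)\<^sup>2"
      using zero_le_power2[of "\<bar>u \<omega>\<bar> - 1"] by (simp add: power2_diff)
    finally show "u \<omega> * x \<omega> \<le> (1/2) * 1 + (1/2) * (u \<omega>)\<^sup>2" .
  qed
  also have "\<dots> = 1/2 + (1/2) * avg W (\<lambda>\<omega>. (u \<omega>)\<^sup>2)"
    unfolding avg_add avg_cmult avg_const[OF W] by simp
  finally show ?thesis .
qed

abbreviation cube :: "nat \<Rightarrow> 'a set \<Rightarrow> (nat \<Rightarrow> 'a) set" where
  "cube n A \<equiv> PiE {..<n} (\<lambda>_. A)"

text \<open>Independence of the coordinates of a uniformly distributed point.\<close>

lemma avg_cube_prod:
  assumes "finite A"
  shows "avg (cube n A) (\<lambda>\<omega>. \<Prod>k<n. F k (\<omega> k)) = (\<Prod>k<n. avg A (F k))"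
  unfolding avg_def using assms
  by (simp add: prod_sum_PiE[symmetric] prod_dividef card_PiE)

lemma avg_cube_single:
  assumes A: "finite A" "A \<noteq> {}" and i: "i < n"
  shows "avg (cube n A) (\<lambda>\<omega>. g (\<omega> i)) = avg A g"
proof -
  have "avg (cube n A) (\<lambda>\<omega>. g (\<omega> i)) = avg (cube n A) (\<lambda>\<omega>. \<Prod>k<n. (if k = i then g (\<omega> k) else 1))"
    using i by (simp add: prod.delta)
  also have "\<dots> = (\<Prod>k<n. avg A (\<lambda>a. if k = i then g a else 1))"
    by (rule avg_cube_prod[OF A(1), of n "\<lambda>k a. if k = i then g a else 1"])
  also have "\<dots> = (\<Prod>k<n. if k = i then avg A g else 1)"
    using avg_const[OF A, of 1] by (intro prod.cong) auto
  also have "\<dots> = avg A g" using i by (simp add: prod.delta)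
  finally show ?thesis .
qed

lemma avg_cube_pair:
  assumes A: "finite A" "A \<noteq> {}" and i: "i < n" "j < n" "i \<noteq> j"
  shows "avg (cube n A) (\<lambda>\<omega>. g (\<omega> i) * h (\<omega> j)) = avg A g * avg A h"
proof -
  define F where "F k a = (if k = i then g a else 1) * (if k = j then h a else 1)" for k a
  have "(\<lambda>\<omega>. g (\<omega> i) * h (\<omega> j)) = (\<lambda>\<omega>. \<Prod>k<n. F k (\<omega> k))"
    unfolding F_def prod.distrib using i by (simp add: prod.delta)
  then have "avg (cube n A) (\<lambda>\<omega>. g (\<omega> i) * h (\<omega> j)) = (\<Prod>k<n. avg A (F k))"
    using avg_cube_prod[OF A(1), of n F] by simp
  also have "\<dots> = (\<Prod>k<n. (if k = i then avg A g else 1) * (if k = j then avg A h else 1))"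
    using avg_const[OF A, of 1] i by (intro prod.cong) (auto simp: F_def[abs_def])
  also have "\<dots> = avg A g * avg A h" unfolding prod.distrib using i by (simp add: prod.delta)
  finally show ?thesis .
qed

text \<open>Centred independent summands are orthogonal, so the mixed terms drop out.\<close>

lemma avg_cube_square:
  assumes A: "finite A" "A \<noteq> {}" and mean: "\<And>i. i < n \<Longrightarrow> avg A (\<psi> i) = 0"
  shows "avg (cube n A) (\<lambda>\<omega>. (\<Sum>i<n. \<psi> i (\<omega> i))\<^sup>2) = (\<Sum>i<n. avg A (\<lambda>a. (\<psi> i a)\<^sup>2))"
proof -
  have "avg (cube n A) (\<lambda>\<omega>. (\<Sum>i<n. \<psi> i (\<omega> i))\<^sup>2)
      = (\<Sum>i<n. \<Sum>j<n. avg (cube n A) (\<lambda>\<omega>. \<psi> i (\<omega> i) * \<psi> j (\<omega> j)))"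
    unfolding power2_eq_square sum_product avg_sum ..
  also have "\<dots> = (\<Sum>i<n. \<Sum>j<n. if j = i then avg A (\<lambda>a. (\<psi> i a)\<^sup>2) else 0)"
  proof (intro sum.cong refl)
    fix i j assume ij: "i \<in> {..<n}" "j \<in> {..<n}"
    show "avg (cube n A) (\<lambda>\<omega>. \<psi> i (\<omega> i) * \<psi> j (\<omega> j)) = (if j = i then avg A (\<lambda>a. (\<psi> i a)\<^sup>2) else 0)"
    proof (cases "j = i")
      case True
      then show ?thesis using avg_cube_single[OF A, of i n "\<lambda>a. (\<psi> i a)\<^sup>2"] ij by (simp add: power2_eq_square)
    next
      case False
      then show ?thesis using avg_cube_pair[OF A, of i n j "\<psi> i" "\<psi> j"] ij mean by simp
    qed
  qed
  also have "\<dots> = (\<Sum>i<n. avg A (\<lambda>a. (\<psi> i a)\<^sup>2))" by (intro sum.cong) (auto simp: sum.delta)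
  finally show ?thesis .
qed

section \<open>Finite-dimensional quotients of bounded sequences\<close>

text \<open>For w = |v| / R, with R the p-norm of v, the pairing equals R. The vectors with entries
  \<open>w i powr (p - 1)\<close> run through the nonnegative part of the dual unit sphere, so no
  conjugate exponent appears.\<close>

lemma sum_powr_le_dual:
  fixes v :: "nat \<Rightarrow> real"
  assumes p: "p > 1" and B: "B \<ge> 0"
    and dual: "\<And>w. (\<And>i. w i \<ge> 0) \<Longrightarrow> (\<Sum>i<n. w i powr p) = 1 \<Longrightarrow>
       (\<Sum>i<n. (sgn (v i) * w i powr (p - 1)) * v i) \<le> B"
  shows "(\<Sum>i<n. \<bar>v i\<bar> powr p) \<le> B powr p"
proof (cases "(\<Sum>i<n. \<bar>v i\<bar> powr p) = 0")
  case False
  define S where "S = (\<Sum>i<n. \<bar>v i\<bar> powr p)"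
  define R where "R = S powr (1 / p)"
  have S: "S > 0" using False by (simp add: S_def sum_nonneg less_le)
  have R: "R > 0" "R powr p = S" using S p by (auto simp: R_def powr_powr)
  define w where "w i = \<bar>v i\<bar> / R" for i
  have w0: "w i \<ge> 0" for i using R by (simp add: w_def)
  have wp: "w i powr p = \<bar>v i\<bar> powr p / S" for i using R by (simp add: w_def powr_divide)
  have w1: "(\<Sum>i<n. w i powr p) = 1"
    using S by (simp add: wp S_def[symmetric] flip: sum_divide_distrib)
  have "(sgn (v i) * w i powr (p - 1)) * v i = R * w i powr p" for i
  proof -
    have "(sgn (v i) * w i powr (p - 1)) * v i = w i powr (p - 1) * \<bar>v i\<bar>"
      by (simp add: abs_sgn mult.commute)
    also have "\<dots> = R * (w i * w i powr (p - 1))" using R by (simp add: w_def)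
    also have "w i * w i powr (p - 1) = w i powr p"
      using w0[of i] p by (cases "w i = 0") (auto simp: powr_mult_base)
    finally show ?thesis .
  qed
  then have "R \<le> B" using dual[OF w0 w1] w1 by (simp flip: sum_distrib_left)
  then have "R powr p \<le> B powr p" using R p by (intro powr_mono2) auto
  then show ?thesis using R by (simp add: S_def)
qed simp

text \<open>\<open>X\<close> is the matrix of an operator from functions on \<open>W\<close> with
  the maximum norm to l_p^n; one clause bounds it, the other lifts the unit ball. \<open>C\<close>
  bounds a p-th power in the former and a norm in the latter.\<close>

definition Lp_kernel :: "real \<Rightarrow> real \<Rightarrow> nat \<Rightarrow> 'w set \<Rightarrow> (nat \<Rightarrow> 'w \<Rightarrow> real) \<Rightarrow> bool" where
  "Lp_kernel p C n W X \<longleftrightarrow> finite W \<and>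
     (\<forall>x. (\<forall>w\<in>W. \<bar>x w\<bar> \<le> 1) \<longrightarrow> (\<Sum>i<n. \<bar>\<Sum>w\<in>W. X i w * x w\<bar> powr p) \<le> C) \<and>
     (\<forall>f. (\<Sum>i<n. \<bar>f i\<bar> powr p) \<le> 1 \<longrightarrow> (\<exists>x. (\<forall>w\<in>W. \<bar>x w\<bar> \<le> C) \<and> (\<forall>i<n. (\<Sum>w\<in>W. X i w * x w) = f i)))"

text \<open>Columns become numbers, so that the blocks of all levels can be stored in one
  sequence.\<close>

lemma Lp_kernel_reindex:
  assumes "Lp_kernel p C n W X"
  shows "\<exists>K Y. Lp_kernel p C n {..<K::nat} Y"
proof -
  have "finite W" using assms by (simp add: Lp_kernel_def)
  then obtain h where h: "bij_betw h {..<card W} W" using ex_bij_betw_nat_finite[of W] by (auto simp: atLeast0LessThan)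
  define g where "g = inv_into {..<card W} h"
  have hg: "h (g w) = w" "g w \<in> {..<card W}" if "w \<in> W" for w
    using h that unfolding g_def bij_betw_def by (metis f_inv_into_f, metis inv_into_into)
  have gh: "g (h k) = k" "h k \<in> W" if "k \<in> {..<card W}" for k
    using h that by (auto simp: g_def bij_betw_def)
  have sum_eq: "(\<Sum>k<card W. X i (h k) * x k) = (\<Sum>w\<in>W. X i w * x (g w))" for i x
    by (rule sum.reindex_bij_witness[of _ g h]) (use hg gh in auto)
  have sum_eq': "(\<Sum>k<card W. X i (h k) * x (h k)) = (\<Sum>w\<in>W. X i w * x w)" for i x
    by (rule sum.reindex_bij_witness[of _ g h]) (use hg gh in auto)
  have "Lp_kernel p C n {..<card W} (\<lambda>i k. X i (h k))"
    unfolding Lp_kernel_def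
  proof (intro conjI allI impI)
    fix x assume "\<forall>k\<in>{..<card W}. \<bar>x k\<bar> \<le> (1::real)"
    then have "\<forall>w\<in>W. \<bar>x (g w)\<bar> \<le> 1" using hg by blast
    then show "(\<Sum>i<n. \<bar>\<Sum>k<card W. X i (h k) * x k\<bar> powr p) \<le> C"
      unfolding sum_eq using assms by (auto simp: Lp_kernel_def)
  next
    fix f assume "(\<Sum>i<n. \<bar>f i\<bar> powr p) \<le> 1"
    then obtain x where "\<forall>w\<in>W. \<bar>x w\<bar> \<le> C" "\<forall>i<n. (\<Sum>w\<in>W. X i w * x w) = f i"
      using assms by (auto simp: Lp_kernel_def)
    then show "\<exists>x. (\<forall>k\<in>{..<card W}. \<bar>x k\<bar> \<le> C) \<and> (\<forall>i<n. (\<Sum>k<card W. X i (h k) * x k) = f i)"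
      using gh by (intro exI[of _ "\<lambda>k. x (h k)"]) (simp add: sum_eq')
  qed simp
  then show ?thesis by blast
qed

text \<open>Orthogonality of the Rademacher variables bounds the operator, and Riesz products are
  the lifts; \<open>exp (1/2)\<close> is \<open>abs_riesz_le\<close> at
  \<open>D = 1\<close>.\<close>

lemma Lp_kernel_2: "Lp_kernel 2 (exp (1/2)) n (signs n) (\<lambda>i \<omega>. \<omega> i / 2 ^ n)"
  unfolding Lp_kernel_def
proof (intro conjI allI impI)
  show "finite (signs n)" by (rule finite_signs)
  have signs_ne: "signs n \<noteq> {}" using card_signs[of n] by auto
  have eq: "(\<Sum>\<omega>\<in>signs n. \<omega> i / 2 ^ n * x \<omega>) = avg (signs n) (\<lambda>\<omega>. \<omega> i * x \<omega>)" for i x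
    by (simp add: avg_def card_signs sum_divide_distrib)
  fix x assume x: "\<forall>\<omega>\<in>signs n. \<bar>x \<omega>\<bar> \<le> (1::real)"
  define v where "v i = avg (signs n) (\<lambda>\<omega>. \<omega> i * x \<omega>)" for i
  have "(\<Sum>i<n. \<bar>v i\<bar> powr 2) \<le> 1 powr 2"
  proof (rule sum_powr_le_dual)
    fix w :: "nat \<Rightarrow> real" assume w0: "\<And>i. w i \<ge> 0" and w1: "(\<Sum>i<n. w i powr 2) = 1"
    define a where "a i = sgn (v i) * w i powr (2 - 1)" for i
    have a: "(a i)\<^sup>2 \<le> w i powr 2" for i
      using w0[of i] by (cases "w i = 0") (auto simp: a_def power_mult_distrib powr_numeral sgn_if)
    have "(\<Sum>i<n. a i * v i) = avg (signs n) (\<lambda>\<omega>. (\<Sum>i<n. a i * \<omega> i) * x \<omega>)"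
      by (simp add: v_def sum_distrib_right avg_sum mult.assoc avg_cmult)
    also have "\<dots> \<le> 1/2 + (1/2) * avg (signs n) (\<lambda>\<omega>. (\<Sum>i<n. a i * \<omega> i)\<^sup>2)"
      by (rule avg_mult_le[OF finite_signs signs_ne]) (use x in blast)
    also have "avg (signs n) (\<lambda>\<omega>. (\<Sum>i<n. a i * \<omega> i)\<^sup>2) = (\<Sum>i<n. avg {-1, 1} (\<lambda>b. (a i * b)\<^sup>2))"
      unfolding signs_def by (rule avg_cube_square) (auto simp: avg_def)
    also have "\<dots> = (\<Sum>i<n. (a i)\<^sup>2)" by (simp add: avg_def)
    also have "\<dots> \<le> 1" by (rule order_trans[OF sum_mono[OF a]]) (simp only: w1 order_refl)
    finally show "(\<Sum>i<n. (sgn (v i) * w i powr (2 - 1)) * v i) \<le> 1" by (simp add: a_def)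
  qed auto
  also have "\<dots> \<le> exp (1/2)" by simp
  finally show "(\<Sum>i<n. \<bar>\<Sum>\<omega>\<in>signs n. \<omega> i / 2 ^ n * x \<omega>\<bar> powr 2) \<le> exp (1/2)"
    by (simp only: eq v_def)
next
  fix f :: "nat \<Rightarrow> real" assume "(\<Sum>i<n. \<bar>f i\<bar> powr 2) \<le> 1"
  then have f: "(\<Sum>i<n. (f i)\<^sup>2) \<le> 1" by (simp add: powr_numeral)
  show "\<exists>x. (\<forall>\<omega>\<in>signs n. \<bar>x \<omega>\<bar> \<le> exp (1/2)) \<and> (\<forall>i<n. (\<Sum>\<omega>\<in>signs n. \<omega> i / 2 ^ n * x \<omega>) = f i)"
  proof (intro exI[of _ "riesz n f"] conjI ballI allI impI)
    show "\<bar>riesz n f \<omega>\<bar> \<le> exp (1/2)" if "\<omega> \<in> signs n" for \<omega> using abs_riesz_le[OF that f] .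
    show "(\<Sum>\<omega>\<in>signs n. \<omega> i / 2 ^ n * riesz n f \<omega>) = f i" if "i < n" for i
    proof -
      have "(\<Sum>\<omega>\<in>signs n. \<omega> i / 2 ^ n * riesz n f \<omega>) = (\<Sum>\<omega>\<in>signs n. \<omega> i * riesz n f \<omega>) / 2 ^ n"
        by (simp add: sum_divide_distrib)
      then show ?thesis by (simp only: riesz_coeff[OF that]) simp
    qed
  qed
qed

section \<open>Comparison of power sums with integrals\<close>

lemma powr_step:
  fixes x t :: real
  assumes "x > 0" "t > 0" "t \<noteq> 1"
  shows "(x + 1) powr (- t) \<le> ((x + 1) powr (1 - t) - x powr (1 - t)) / (1 - t)"
proof -
  have "\<exists>z. x < z \<and> z < x + 1 \<and> (x + 1) powr (1 - t) - x powr (1 - t) = (x + 1 - x) * ((1 - t) * z powr (1 - t - 1))"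
  proof (rule MVT2)
    show "((\<lambda>z. z powr (1 - t)) has_real_derivative (1 - t) * z powr (1 - t - 1)) (at z)" if "x \<le> z" for z
      using that assms by (auto intro!: derivative_eq_intros)
  qed simp
  then obtain z where z: "x < z" "z < x + 1" "(x + 1) powr (1 - t) - x powr (1 - t) = (1 - t) * z powr (- t)"
    by auto
  have "(x + 1) powr (- t) \<le> z powr (- t)" using z assms by (intro powr_mono2') auto
  then show ?thesis using z assms by simp
qed

lemma sum_powr_head:
  fixes s :: real assumes s: "0 < s" "s < 1"
  shows "(\<Sum>u=1..k. real u powr (- s)) \<le> real k powr (1 - s) / (1 - s)"
proof (induction k)
  case (Suc k)
  show ?case
  proof (cases "k = 0")
    case True then show ?thesis using s by simp
  next
    case False
    then have "real (Suc k) powr (- s) \<le> (real (Suc k) powr (1 - s) - real k powr (1 - s)) / (1 - s)"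
      using powr_step[of "real k" s] s by (simp add: add.commute)
    then show ?thesis using Suc.IH by (simp add: diff_divide_distrib)
  qed
qed simp

lemma sum_powr_tail:
  fixes t :: real assumes t: "t > 1" and k: "k \<ge> 1"
  shows "(\<Sum>u=k..n. real u powr (- t)) \<le> (1 + 1 / (t - 1)) * real k powr (1 - t)"
proof (cases "k \<le> n")
  case True
  have "(\<Sum>u=k..n. real u powr (- t)) \<le> real k powr (- t) + (real k powr (1 - t) - real n powr (1 - t)) / (t - 1)"
    using True
  proof (induction n rule: dec_induct)
    case (step n)
    have "real (Suc n) powr (- t) \<le> (real (Suc n) powr (1 - t) - real n powr (1 - t)) / (1 - t)"
      using powr_step[of "real n" t] step.hyps k t by (simp add: add.commute)
    also have "\<dots> = (real n powr (1 - t) - real (Suc n) powr (1 - t)) / (t - 1)"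
      using t by (simp add: field_simps)
    finally show ?case using step.IH step.hyps by (simp add: diff_divide_distrib)
  qed simp
  also have "real k powr (- t) \<le> real k powr (1 - t)" using k by (intro powr_mono) auto
  also have "(real k powr (1 - t) - real n powr (1 - t)) / (t - 1) \<le> real k powr (1 - t) / (t - 1)"
    using t by (intro divide_right_mono) auto
  finally show ?thesis by (simp add: algebra_simps)
qed (use t in auto)

section \<open>Heavy-tailed variables\<close>

text \<open>Sample space of one variable: a sign and an independent rank u, uniform on 1..P. Large
  values occur at small ranks.\<close>

definition heavy_set :: "nat \<Rightarrow> (real \<times> nat) set" where
  "heavy_set P = {-1, 1} \<times> {1..P}"

text \<open>Up to symmetrisation and truncation, \<open>heavy p P\<close> is a Pareto variable whose tail exponent
  is the conjugate of \<open>p\<close>.\<close>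

definition heavy :: "real \<Rightarrow> nat \<Rightarrow> real \<times> nat \<Rightarrow> real" where
  "heavy p P a = fst a * (real P / real (snd a)) powr (1 - 1 / p)"

lemma finite_heavy_set: "finite (heavy_set P)" by (simp add: heavy_set_def)

lemma heavy_set_ne: "P \<ge> 1 \<Longrightarrow> heavy_set P \<noteq> {}" by (auto simp: heavy_set_def)

lemma card_heavy_set: "card (heavy_set P) = 2 * P"
  unfolding heavy_set_def by (subst card_cartesian_product) simp

lemma avg_heavy_even: "avg (heavy_set P) (\<lambda>a. h (snd a)) = (\<Sum>u=1..P. h u) / real P"
proof -
  have "(\<Sum>a\<in>heavy_set P. h (snd a)) = 2 * (\<Sum>u=1..P. h u)"
    unfolding heavy_set_def using sum.cartesian_product[of "\<lambda>_ u. h u" "{1..P}" "{-1, 1::real}"]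
    by (simp add: split_def)
  then show ?thesis by (simp add: avg_def card_heavy_set)
qed

lemma avg_heavy_odd: "avg (heavy_set P) (\<lambda>a. fst a * h (snd a)) = 0"
proof -
  have "(\<Sum>a\<in>heavy_set P. fst a * h (snd a)) = (\<Sum>e\<in>{-1,1}. \<Sum>u\<in>{1..P}. e * h u)"
    unfolding heavy_set_def using sum.cartesian_product[of "\<lambda>e u. e * h u" "{1..P}" "{-1, 1::real}"]
    by (simp only: split_def)
  also have "\<dots> = 0" by (simp add: sum_negf)
  finally show ?thesis by (simp add: avg_def)
qed

lemma heavy_set_abs_fst: "a \<in> heavy_set P \<Longrightarrow> \<bar>fst a\<bar> = 1" by (auto simp: heavy_set_def)

text \<open>Against dual weights w, each variable is cut at a rank \<open>\<tau> i\<close>. The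
  large parts are estimated by their mean absolute values and contribute p; the remainders are
  estimated jointly by a second moment, where independence gives orthogonality, and contribute 1/2 +
  B/2.\<close>

lemma heavy_upper:
  assumes p: "p > 2" and P: "P \<ge> 1"
    and x: "\<And>\<omega>. \<omega> \<in> cube n (heavy_set P) \<Longrightarrow> \<bar>x \<omega>\<bar> \<le> 1"
  defines "B \<equiv> 1 + 1 / (2 * (1 - 1 / p) - 1)"
  shows "(\<Sum>i<n. \<bar>avg (cube n (heavy_set P)) (\<lambda>\<omega>. heavy p P (\<omega> i) * x \<omega>)\<bar> powr p) \<le> (p + (1/2 + B/2)) powr p"
proof (rule sum_powr_le_dual)
  define s where "s = 1 - 1 / p"
  have s: "0 < s" "s < 1" "2 * s > 1" using p by (auto simp: s_def field_simps)
  define A where "A = heavy_set P"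
  have A: "finite A" "A \<noteq> {}" using finite_heavy_set heavy_set_ne[OF P] by (auto simp: A_def)
  have cA: "finite (cube n A)" "cube n A \<noteq> {}" using A by (auto intro!: finite_PiE simp: PiE_eq_empty_iff)
  show "p > 1" using p by simp
  have B: "B > 0" using s p unfolding B_def s_def[symmetric] by (intro add_pos_nonneg) auto
  show "0 \<le> p + (1/2 + B/2)" using B p by simp
  define v where "v i = avg (cube n A) (\<lambda>\<omega>. heavy p P (\<omega> i) * x \<omega>)" for i
  fix w :: "nat \<Rightarrow> real" assume w0: "\<And>i. w i \<ge> 0" and w1: "(\<Sum>i<n. w i powr p) = 1"
  define a where "a i = sgn (v i) * w i powr (p - 1)" for i
  have absa: "\<bar>a i\<bar> \<le> w i powr (p - 1)" for i by (auto simp: a_def abs_mult sgn_if)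
  \<comment> \<open>The event of a large value gets probability about \<open>w i powr p\<close>,
    which balances the parts: each contributes a multiple of \<open>w i powr p\<close>.\<close>
  define \<tau> where "\<tau> i = w i powr p * real P" for i
  define big where "big i b = (if real (snd b) \<le> \<tau> i then heavy p P b else 0)" for i b
  define small where "small i b = (if real (snd b) \<le> \<tau> i then 0 else heavy p P b)" for i b
  have split: "heavy p P b = big i b + small i b" for i b by (simp add: big_def small_def)
  have P0: "real P > 0" using P by simp
  have bigbound: "avg A (\<lambda>b. \<bar>big i b\<bar>) \<le> p * w i" for i
  proof -
    have "avg A (\<lambda>b. \<bar>big i b\<bar>) = avg A (\<lambda>b. (\<lambda>u. if real u \<le> \<tau> i then (real P / real u) powr s else 0) (snd b))"
      by (rule avg_cong) (auto simp: big_def heavy_def abs_mult heavy_set_abs_fst A_def s_def)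
    also have "\<dots> = (\<Sum>u=1..P. if real u \<le> \<tau> i then (real P / real u) powr s else 0) / real P"
      unfolding A_def by (rule avg_heavy_even)
    also have "(\<Sum>u=1..P. if real u \<le> \<tau> i then (real P / real u) powr s else 0)
        \<le> (\<Sum>u=1..nat \<lfloor>\<tau> i\<rfloor>. (real P / real u) powr s)"
    proof -
      have "(\<Sum>u=1..P. if real u \<le> \<tau> i then (real P / real u) powr s else 0)
          = (\<Sum>u\<in>{u\<in>{1..P}. real u \<le> \<tau> i}. (real P / real u) powr s)"
        by (rule sum.inter_filter[symmetric]) simp
      also have "\<dots> \<le> (\<Sum>u=1..nat \<lfloor>\<tau> i\<rfloor>. (real P / real u) powr s)"
        by (rule sum_mono2) (auto simp: le_nat_iff le_floor_iff)
      finally show ?thesis .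
    qed
    also have "\<dots> = real P powr s * (\<Sum>u=1..nat \<lfloor>\<tau> i\<rfloor>. real u powr (- s))"
      unfolding sum_distrib_left by (rule sum.cong) (auto simp: powr_divide powr_minus field_simps)
    also have "\<dots> \<le> real P powr s * (real (nat \<lfloor>\<tau> i\<rfloor>) powr (1 - s) / (1 - s))"
      using sum_powr_head[OF s(1,2)] by (intro mult_left_mono) auto
    also have "\<dots> \<le> real P powr s * (\<tau> i powr (1 - s) / (1 - s))"
      using s w0 P0 by (intro mult_left_mono divide_right_mono powr_mono2) (auto simp: \<tau>_def)
    also have "\<dots> = real P * (p * w i)"
    proof -
      have 1: "\<tau> i powr (1 - s) = w i * real P powr (1 - s)"
        using w0[of i] p by (simp add: \<tau>_def powr_mult powr_powr s_def)
      have 2: "real P powr s * real P powr (1 - s) = real P" using P0 by (simp flip: powr_add)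
      have "real P powr s * (w i * real P powr (1 - s) * p) = (real P powr s * real P powr (1 - s)) * (p * w i)"
        by (simp only: ac_simps)
      moreover have "u / (1 - s) = u * p" for u by (simp add: s_def)
      ultimately show ?thesis unfolding 1 2 by simp
    qed
    finally show ?thesis using P0 by (simp add: divide_right_mono field_simps)
  qed
  \<comment> \<open>The tail of the sum of u^(-2 s) converges because 2 s > 1, that is p >
    2.\<close>
  have smallbound: "(a i)\<^sup>2 * avg A (\<lambda>b. (small i b)\<^sup>2) \<le> B * w i powr p" for i
  proof (cases "w i = 0")
    case True
    then show ?thesis using absa[of i] p by simp
  next
    case False
    then have wi: "w i > 0" using w0[of i] by simp
    then have \<tau>: "\<tau> i > 0" using P0 by (simp add: \<tau>_def)
    define k where "k = Suc (nat \<lfloor>\<tau> i\<rfloor>)"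
    have "avg A (\<lambda>b. (small i b)\<^sup>2) = avg A (\<lambda>b. (\<lambda>u. if real u \<le> \<tau> i then 0 else (real P / real u) powr (2 * s)) (snd b))"
    proof (rule avg_cong)
      fix b assume "b \<in> A"
      then have "(fst b)\<^sup>2 = 1" using heavy_set_abs_fst[of b P] by (simp add: A_def abs_square_eq_1)
      moreover have "((real P / real (snd b)) powr s)\<^sup>2 = (real P / real (snd b)) powr (2 * s)"
        by (simp add: power2_eq_square flip: powr_add)
      ultimately show "(small i b)\<^sup>2 = (\<lambda>u. if real u \<le> \<tau> i then 0 else (real P / real u) powr (2 * s)) (snd b)"
        by (simp add: small_def heavy_def power_mult_distrib s_def)
    qed
    also have "\<dots> = (\<Sum>u=1..P. if real u \<le> \<tau> i then 0 else (real P / real u) powr (2 * s)) / real P"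
      unfolding A_def by (rule avg_heavy_even)
    also have "(\<Sum>u=1..P. if real u \<le> \<tau> i then 0 else (real P / real u) powr (2 * s))
        \<le> (\<Sum>u=k..P. (real P / real u) powr (2 * s))"
    proof -
      have "(\<Sum>u=1..P. if real u \<le> \<tau> i then 0 else (real P / real u) powr (2 * s))
          = (\<Sum>u=1..P. if \<not> real u \<le> \<tau> i then (real P / real u) powr (2 * s) else 0)"
        by (rule sum.cong) auto
      also have "\<dots> = (\<Sum>u\<in>{u\<in>{1..P}. \<not> real u \<le> \<tau> i}. (real P / real u) powr (2 * s))"
        by (rule sum.inter_filter[symmetric]) simp
      also have "\<dots> \<le> (\<Sum>u=k..P. (real P / real u) powr (2 * s))"
      proof (rule sum_mono2)
        show "{u \<in> {1..P}. \<not> real u \<le> \<tau> i} \<subseteq> {k..P}"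
          using \<tau> by (auto simp: k_def Suc_le_eq nat_less_iff floor_less_iff)
      qed auto
      finally show ?thesis .
    qed
    also have "\<dots> = real P powr (2 * s) * (\<Sum>u=k..P. real u powr (- (2 * s)))"
      unfolding sum_distrib_left by (rule sum.cong) (auto simp: powr_divide powr_minus field_simps k_def)
    also have "\<dots> \<le> real P powr (2 * s) * (B * real k powr (1 - 2 * s))"
      using sum_powr_tail[OF s(3), of k P] unfolding B_def s_def[symmetric]
      by (intro mult_left_mono) (auto simp: k_def)
    also have "\<dots> \<le> real P powr (2 * s) * (B * \<tau> i powr (1 - 2 * s))"
    proof -
      have "\<tau> i \<le> real k" unfolding k_def by linarith
      then show ?thesis using s \<tau> B by (intro mult_left_mono powr_mono2') auto
    qed
    also have "\<dots> = real P * (B * w i powr (p * (1 - 2 * s)))"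
    proof -
      have 1: "\<tau> i powr (1 - 2 * s) = w i powr (p * (1 - 2 * s)) * real P powr (1 - 2 * s)"
        using w0[of i] by (simp add: \<tau>_def powr_mult powr_powr)
      have 2: "real P powr (2 * s) * real P powr (1 - 2 * s) = real P" using P0 by (simp flip: powr_add)
      have "real P powr (2 * s) * (B * (w i powr (p * (1 - 2 * s)) * real P powr (1 - 2 * s)))
          = (real P powr (2 * s) * real P powr (1 - 2 * s)) * (B * w i powr (p * (1 - 2 * s)))"
        by (simp only: ac_simps)
      then show ?thesis unfolding 1 2 .
    qed
    finally have "avg A (\<lambda>b. (small i b)\<^sup>2) \<le> B * w i powr (p * (1 - 2 * s))"
      using P0 by (simp add: divide_right_mono field_simps)
    moreover have "(a i)\<^sup>2 \<le> (w i powr (p - 1))\<^sup>2" using absa[of i] by (simp add: abs_le_square_iff[symmetric])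
    ultimately have "(a i)\<^sup>2 * avg A (\<lambda>b. (small i b)\<^sup>2) \<le> (w i powr (p - 1))\<^sup>2 * (B * w i powr (p * (1 - 2 * s)))"
      by (intro mult_mono) (auto simp: avg_def intro!: divide_nonneg_nonneg sum_nonneg)
    also have "\<dots> = B * w i powr ((p - 1) + (p - 1) + p * (1 - 2 * s))"
      by (simp only: powr_add power2_eq_square ac_simps)
    also have "(p - 1) + (p - 1) + p * (1 - 2 * s) = p" using p by (simp add: s_def field_simps)
    finally show ?thesis .
  qed
  have xb: "\<bar>x \<omega>\<bar> \<le> 1" if "\<omega> \<in> cube n A" for \<omega> using x that by (simp add: A_def)
  have "(\<Sum>i<n. a i * v i) = (\<Sum>i<n. a i * avg (cube n A) (\<lambda>\<omega>. big i (\<omega> i) * x \<omega>))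
      + avg (cube n A) (\<lambda>\<omega>. (\<Sum>i<n. a i * small i (\<omega> i)) * x \<omega>)"
  proof -
    have "v i = avg (cube n A) (\<lambda>\<omega>. big i (\<omega> i) * x \<omega>) + avg (cube n A) (\<lambda>\<omega>. small i (\<omega> i) * x \<omega>)" for i
      unfolding v_def avg_add[symmetric] by (simp add: split[of _ i] distrib_right)
    moreover have "avg (cube n A) (\<lambda>\<omega>. (\<Sum>i<n. a i * small i (\<omega> i)) * x \<omega>)
        = (\<Sum>i<n. a i * avg (cube n A) (\<lambda>\<omega>. small i (\<omega> i) * x \<omega>))"
      by (simp add: sum_distrib_right avg_sum mult.assoc avg_cmult)
    ultimately show ?thesis by (simp add: distrib_left sum.distrib)
  qed
  also have "(\<Sum>i<n. a i * avg (cube n A) (\<lambda>\<omega>. big i (\<omega> i) * x \<omega>)) \<le> (\<Sum>i<n. p * w i powr p)"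
  proof (rule sum_mono)
    fix i assume i: "i \<in> {..<n}"
    have up: "avg (cube n A) (\<lambda>\<omega>. e * big i (\<omega> i) * x \<omega>) \<le> avg A (\<lambda>b. \<bar>big i b\<bar>)" if "\<bar>e\<bar> = 1" for e
    proof -
      have "avg (cube n A) (\<lambda>\<omega>. e * big i (\<omega> i) * x \<omega>) \<le> avg (cube n A) (\<lambda>\<omega>. (\<lambda>b. \<bar>big i b\<bar>) (\<omega> i))"
      proof (rule avg_mono)
        fix \<omega> assume "\<omega> \<in> cube n A"
        have "e * big i (\<omega> i) * x \<omega> \<le> \<bar>big i (\<omega> i)\<bar> * \<bar>x \<omega>\<bar>"
          using that by (metis abs_ge_self abs_mult mult_1)
        also have "\<dots> \<le> \<bar>big i (\<omega> i)\<bar> * 1" using xb[OF \<open>\<omega> \<in> cube n A\<close>] by (intro mult_left_mono) auto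
        finally show "e * big i (\<omega> i) * x \<omega> \<le> \<bar>big i (\<omega> i)\<bar>" by simp
      qed
      also have "\<dots> = avg A (\<lambda>b. \<bar>big i b\<bar>)" by (rule avg_cube_single[OF A]) (use i in auto)
      finally show ?thesis .
    qed
    have "\<bar>avg (cube n A) (\<lambda>\<omega>. big i (\<omega> i) * x \<omega>)\<bar> \<le> p * w i"
      using up[of 1] up[of "-1"] bigbound[of i] avg_cmult[of "cube n A" "-1" "\<lambda>\<omega>. big i (\<omega> i) * x \<omega>"]
      by (simp add: mult.assoc)
    then have "\<bar>a i\<bar> * \<bar>avg (cube n A) (\<lambda>\<omega>. big i (\<omega> i) * x \<omega>)\<bar> \<le> w i powr (p - 1) * (p * w i)"
      using absa[of i] by (intro mult_mono) auto
    moreover have "w i * w i powr (p - 1) = w i powr p"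
      using w0[of i] p by (cases "w i = 0") (auto simp: powr_mult_base)
    ultimately show "a i * avg (cube n A) (\<lambda>\<omega>. big i (\<omega> i) * x \<omega>) \<le> p * w i powr p"
      by (metis (no_types, lifting) abs_ge_self abs_mult mult.assoc mult.commute order_trans)
  qed
  also have "(\<Sum>i<n. p * w i powr p) = p" using w1 by (simp flip: sum_distrib_left)
  also have "avg (cube n A) (\<lambda>\<omega>. (\<Sum>i<n. a i * small i (\<omega> i)) * x \<omega>)
      \<le> 1/2 + (1/2) * avg (cube n A) (\<lambda>\<omega>. (\<Sum>i<n. a i * small i (\<omega> i))\<^sup>2)"
    by (rule avg_mult_le[OF cA xb])
  also have "avg (cube n A) (\<lambda>\<omega>. (\<Sum>i<n. a i * small i (\<omega> i))\<^sup>2) = (\<Sum>i<n. avg A (\<lambda>b. (a i * small i b)\<^sup>2))"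
  \<comment> \<open>The cut depends on the rank alone, so the truncated variable is still odd in the
    sign and has mean 0.\<close>
  proof (rule avg_cube_square[OF A])
    fix i
    have "small i b = fst b * (if real (snd b) \<le> \<tau> i then 0 else (real P / real (snd b)) powr s)" for b
      by (simp add: small_def heavy_def s_def)
    then show "avg A (\<lambda>b. a i * small i b) = 0"
      unfolding avg_cmult A_def
      using avg_heavy_odd[of P "\<lambda>u. if real u \<le> \<tau> i then 0 else (real P / real u) powr s"] by simp
  qed
  also have "\<dots> = (\<Sum>i<n. (a i)\<^sup>2 * avg A (\<lambda>b. (small i b)\<^sup>2))" by (simp add: power_mult_distrib avg_cmult)
  also have "\<dots> \<le> (\<Sum>i<n. B * w i powr p)" by (rule sum_mono) (rule smallbound)
  also have "\<dots> = B" using w1 by (simp flip: sum_distrib_left)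
  finally show "(\<Sum>i<n. sgn (avg (cube n (heavy_set P)) (\<lambda>\<omega>. heavy p P (\<omega> i) * x \<omega>)) * w i powr (p - 1)
      * avg (cube n (heavy_set P)) (\<lambda>\<omega>. heavy p P (\<omega> i) * x \<omega>)) \<le> p + (1/2 + B/2)"
    by (simp add: a_def v_def A_def)
qed

text \<open>The lift lives where exactly one coordinate is large. Its summands thus have disjoint
  supports and the bound is that of the largest coefficient. The size of P limits the total cost of
  rounding n probabilities to 1/4.\<close>

lemma heavy_lower:
  assumes p: "p > 2" and P: "P = 4 * (n + 1)" and f: "(\<Sum>i<n. \<bar>f i\<bar> powr p) \<le> 1"
  shows "\<exists>x. (\<forall>\<omega>. \<bar>x \<omega>\<bar> \<le> 8) \<and>
    (\<forall>i<n. avg (cube n (heavy_set P)) (\<lambda>\<omega>. heavy p P (\<omega> i) * x \<omega>) = f i)"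
proof -
  define A where "A = heavy_set P"
  have P1: "P \<ge> 1" "real P > 0" using P by auto
  have A: "finite A" "A \<noteq> {}" using finite_heavy_set heavy_set_ne[OF P1(1)] by (auto simp: A_def)
  \<comment> \<open>The event that the rank is at most \<open>k i\<close> has probability about
    \<open>\<bar>f i\<bar> powr p / 4\<close>. The 4 helps to keep the sum of these probabilities
    below 1/2; the + 1 keeps each event nonempty, even if f i = 0.\<close>
  define k where "k i = nat \<lfloor>\<bar>f i\<bar> powr p * real P / 4\<rfloor> + 1" for i
  have k: "k i \<ge> 1" "\<bar>f i\<bar> powr p * real P / 4 \<le> real (k i)" "real (k i) \<le> \<bar>f i\<bar> powr p * real P / 4 + 1" for i
  proof -
    have "0 \<le> \<bar>f i\<bar> powr p * real P / 4" by simp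
    then show "k i \<ge> 1" "\<bar>f i\<bar> powr p * real P / 4 \<le> real (k i)" "real (k i) \<le> \<bar>f i\<bar> powr p * real P / 4 + 1"
      unfolding k_def by linarith+
  qed
  have kP: "k i \<le> P" if i: "i < n" for i
  proof -
    have "\<bar>f i\<bar> powr p \<le> (\<Sum>i<n. \<bar>f i\<bar> powr p)" using i by (intro member_le_sum) auto
    then have "\<bar>f i\<bar> powr p * real P \<le> 1 * real P" using f by (intro mult_right_mono) auto
    then have "real (k i) \<le> real P / 4 + 1" using k(3)[of i] by linarith
    also have "\<dots> \<le> real P" using P by simp
    finally show ?thesis by simp
  qed
  define e where "e i b = (if snd b \<le> k i then 1 else 0 :: real)" for i and b :: "real \<times> nat"
  define \<pi> where "\<pi> i = real (k i) / real P" for i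
  have sub: "(\<Sum>u=1..P. if u \<le> k i then h u else 0) = (\<Sum>u=1..k i. h u)" if "i < n" for i and h :: "nat \<Rightarrow> real"
    using kP[OF that] by (intro sum.mono_neutral_cong_right) auto
  have avg_e: "avg A (e i) = \<pi> i" if "i < n" for i
    using avg_heavy_even[of P "\<lambda>u. if u \<le> k i then 1 else 0"] sub[OF that, of "\<lambda>_. 1"]
    by (simp add: A_def e_def[abs_def] \<pi>_def)
  have \<pi>1: "0 \<le> \<pi> i" "i < n \<Longrightarrow> \<pi> i \<le> 1" for i using P1 kP[of i] by (auto simp: \<pi>_def)
  have \<pi>_sum: "(\<Sum>i<n. \<pi> i) \<le> 1/2"
  proof -
    have "(\<Sum>i<n. \<pi> i) \<le> (\<Sum>i<n. \<bar>f i\<bar> powr p / 4 + 1 / real P)"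
    proof (rule sum_mono)
      fix i
      have "\<pi> i \<le> (\<bar>f i\<bar> powr p * real P / 4 + 1) / real P"
        unfolding \<pi>_def using k(3) P1 by (intro divide_right_mono) auto
      also have "\<dots> = \<bar>f i\<bar> powr p / 4 + 1 / real P" using P1 by (simp add: field_simps)
      finally show "\<pi> i \<le> \<bar>f i\<bar> powr p / 4 + 1 / real P" .
    qed
    also have "\<dots> = (\<Sum>i<n. \<bar>f i\<bar> powr p) / 4 + real n / real P"
      by (simp add: sum.distrib sum_divide_distrib)
    also have "\<dots> \<le> 1/4 + 1/4" using f P by (intro add_mono) (auto simp: field_simps)
    finally show ?thesis by simp
  qed
  \<comment> \<open>The mean of the variable against its own sign on that event; it is at least
    \<open>\<pi> i powr (1 / p)\<close>, hence at least a quarter of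
    \<open>\<bar>f i\<bar>\<close>.\<close>
  define \<theta> where "\<theta> i = avg A (\<lambda>b. heavy p P b * (fst b * e i b))" for i
  have \<theta>: "\<theta> i > 0" "\<bar>f i\<bar> \<le> 4 * \<theta> i" if i: "i < n" for i
  proof -
    have "\<theta> i = avg A (\<lambda>b. (\<lambda>u. if u \<le> k i then (real P / real u) powr (1 - 1 / p) else 0) (snd b))"
      unfolding \<theta>_def
    proof (rule avg_cong)
      fix b assume "b \<in> A"
      then have "fst b = 1 \<or> fst b = -1" by (auto simp: A_def heavy_set_def)
      then show "heavy p P b * (fst b * e i b) = (\<lambda>u. if u \<le> k i then (real P / real u) powr (1 - 1 / p) else 0) (snd b)"
        by (auto simp: heavy_def e_def)
    qed
    also have "\<dots> = (\<Sum>u=1..k i. (real P / real u) powr (1 - 1 / p)) / real P"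
      unfolding sub[OF i, symmetric] A_def by (rule avg_heavy_even)
    finally have \<theta>_eq: "\<theta> i = (\<Sum>u=1..k i. (real P / real u) powr (1 - 1 / p)) / real P" .
    have "real (k i) * (real P / real (k i)) powr (1 - 1 / p) = (\<Sum>u=1..k i. (real P / real (k i)) powr (1 - 1 / p))"
      by simp
    also have "\<dots> \<le> (\<Sum>u=1..k i. (real P / real u) powr (1 - 1 / p))"
      using p P1 by (intro sum_mono powr_mono2 divide_left_mono) auto
    finally have "real (k i) * (real P / real (k i)) powr (1 - 1 / p) / real P \<le> \<theta> i"
      unfolding \<theta>_eq using P1 by (intro divide_right_mono) auto
    moreover have "real (k i) * (real P / real (k i)) powr (1 - 1 / p) / real P = \<pi> i powr (1 / p)"
    proof -
      have "(real P / real (k i)) powr (1 - 1 / p) = \<pi> i powr (1 / p - 1)"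
        using P1 k(1)[of i] by (simp add: \<pi>_def powr_divide powr_diff field_simps)
      moreover have "\<pi> i * \<pi> i powr (1 / p - 1) = \<pi> i powr (1 / p)"
      proof -
        have "\<pi> i > 0" using P1 k(1)[of i] by (simp add: \<pi>_def)
        then show ?thesis by (simp add: powr_mult_base)
      qed
      ultimately show ?thesis by (simp add: \<pi>_def)
    qed
    ultimately have low: "\<pi> i powr (1 / p) \<le> \<theta> i" by simp
    have \<pi>0: "\<pi> i > 0" using P1 k(1)[of i] by (simp add: \<pi>_def)
    then have "\<pi> i powr (1 / p) > 0" by simp
    then show "\<theta> i > 0" using low by linarith
    have "\<bar>f i\<bar> powr p * real P / 4 / real P \<le> \<pi> i"
      unfolding \<pi>_def using k(2) P1 by (intro divide_right_mono) auto
    then have "\<bar>f i\<bar> powr p / 4 \<le> \<pi> i" using P1 by simp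
    then have "(\<bar>f i\<bar> powr p / 4) powr (1 / p) \<le> \<pi> i powr (1 / p)" using p by (intro powr_mono2) auto
    also have "(\<bar>f i\<bar> powr p / 4) powr (1 / p) = \<bar>f i\<bar> / 4 powr (1 / p)"
      using p by (simp add: powr_divide powr_powr)
    finally have "\<bar>f i\<bar> / 4 powr (1 / p) \<le> \<theta> i" using low by linarith
    then have "\<bar>f i\<bar> \<le> 4 powr (1 / p) * \<theta> i" by (simp add: field_simps)
    also have "\<dots> \<le> 4 * \<theta> i"
    proof (rule mult_right_mono)
      have "4 powr (1 / p) \<le> 4 powr 1" using p by (intro powr_mono) auto
      then show "4 powr (1 / p) \<le> 4" by simp
    qed (use \<open>\<theta> i > 0\<close> in simp)
    finally show "\<bar>f i\<bar> \<le> 4 * \<theta> i" .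
  qed
  \<comment> \<open>The probability that every other coordinate avoids its event; by the Weierstrass
    product inequality it is at least 1 minus the sum of the \<open>\<pi> l\<close>.\<close>
  define \<rho> where "\<rho> i = (\<Prod>l<n. if l = i then 1 else 1 - \<pi> l)" for i
  have \<rho>: "\<rho> i \<ge> 1/2" for i
  proof -
    have "1 - (\<Sum>l<n. if l = i then 0 else \<pi> l) \<le> (\<Prod>l<n. 1 - (if l = i then 0 else \<pi> l))"
      using \<pi>1 by (intro Weierstrass_prod_ineq) auto
    also have "\<dots> = \<rho> i" unfolding \<rho>_def by (rule prod.cong) auto
    finally have "1 - (\<Sum>l<n. if l = i then 0 else \<pi> l) \<le> \<rho> i" .
    moreover have "(\<Sum>l<n. if l = i then 0 else \<pi> l) \<le> (\<Sum>l<n. \<pi> l)" using \<pi>1 by (intro sum_mono) auto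
    ultimately show ?thesis using \<pi>_sum by linarith
  qed
  \<comment> \<open>Dividing by mean and probability makes coordinate i of the image equal to f i.
    The bound 8 is 4 from \<theta> times 2 from \<rho>.\<close>
  define c where "c i = f i / (\<theta> i * \<rho> i)" for i
  have c: "\<bar>c i\<bar> \<le> 8" if i: "i < n" for i
  proof -
    have "4 * \<theta> i \<le> 8 * (\<theta> i * \<rho> i)" using \<theta>(1)[OF i] \<rho>[of i] mult_left_mono[of "1/2" "\<rho> i" "8 * \<theta> i"] by simp
    moreover have pos: "\<theta> i * \<rho> i > 0" using \<theta>(1)[OF i] \<rho>[of i] by simp
    ultimately have "\<bar>f i\<bar> \<le> 8 * (\<theta> i * \<rho> i)" using \<theta>(2)[OF i] by linarith
    then have "\<bar>f i\<bar> / (\<theta> i * \<rho> i) \<le> 8" using pos by (simp add: divide_le_eq)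
    moreover have "\<bar>c i\<bar> = \<bar>f i\<bar> / (\<theta> i * \<rho> i)" using pos unfolding c_def abs_divide by simp
    ultimately show ?thesis by simp
  qed
  \<comment> \<open>\<open>g i\<close> is the sign of coordinate \<open>i\<close>, on the event that \<open>i\<close> is the only coordinate with a large value.\<close>
  define g where "g i \<omega> = (\<Prod>l<n. if l = i then sgn (fst (\<omega> l)) * e l (\<omega> l) else 1 - e l (\<omega> l))" for i \<omega>
  define x where "x \<omega> = (\<Sum>i<n. c i * g i \<omega>)" for \<omega>
  have g1: "\<bar>g i \<omega>\<bar> \<le> 1" for i \<omega>
    unfolding g_def abs_prod by (rule prod_le_1) (auto simp: e_def sgn_if)
  have x8: "\<bar>x \<omega>\<bar> \<le> 8" for \<omega>
  proof (cases "\<exists>i<n. g i \<omega> \<noteq> 0")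
    case True
    then obtain i where i: "i < n" "g i \<omega> \<noteq> 0" by blast
    then have ei: "e i (\<omega> i) = 1" by (auto simp: g_def e_def split: if_splits)
    have "g j \<omega> = 0" if "j \<noteq> i" for j
      unfolding g_def using ei i(1) that by (intro prod_zero) auto
    then have "x \<omega> = (\<Sum>j<n. if j = i then c i * g i \<omega> else 0)" unfolding x_def by (intro sum.cong) auto
    also have "\<dots> = c i * g i \<omega>" using i by simp
    finally show ?thesis using mult_mono[OF c[OF i(1)] g1[of i \<omega>]] by (simp add: abs_mult)
  next
    case False
    then show ?thesis by (simp add: x_def)
  qed
  have "avg (cube n A) (\<lambda>\<omega>. heavy p P (\<omega> j) * x \<omega>) = f j" if j: "j < n" for j
  proof -
    define F where "F i l b = (if l = j then heavy p P b else 1) * (if l = i then sgn (fst b) * e l b else 1 - e l b)" for i l b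
    have "avg (cube n A) (\<lambda>\<omega>. heavy p P (\<omega> j) * x \<omega>) = (\<Sum>i<n. c i * avg (cube n A) (\<lambda>\<omega>. heavy p P (\<omega> j) * g i \<omega>))"
      unfolding x_def sum_distrib_left avg_sum
      by (intro sum.cong refl) (simp only: mult.left_commute[of "heavy p P _" "c _"] avg_cmult)
    also have "\<dots> = (\<Sum>i<n. if i = j then f j else 0)"
    proof (intro sum.cong refl)
      fix i assume i: "i \<in> {..<n}"
      have "(\<lambda>\<omega>. heavy p P (\<omega> j) * g i \<omega>) = (\<lambda>\<omega>. \<Prod>l<n. F i l (\<omega> l))"
        unfolding F_def prod.distrib g_def using j by (simp add: prod.delta)
      then have pr: "avg (cube n A) (\<lambda>\<omega>. heavy p P (\<omega> j) * g i \<omega>) = (\<Prod>l<n. avg A (F i l))"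
        using avg_cube_prod[OF A(1), of n "F i"] by simp
      show "c i * avg (cube n A) (\<lambda>\<omega>. heavy p P (\<omega> j) * g i \<omega>) = (if i = j then f j else 0)"
      proof (cases "i = j")
        case True
        have sgn_fst: "sgn (fst b) = fst b" if "b \<in> A" for b using that by (auto simp: A_def heavy_set_def)
        have "(\<Prod>l<n. avg A (F i l)) = (\<Prod>l<n. (if l = i then \<theta> i else 1) * (if l = i then 1 else 1 - \<pi> l))"
        proof (rule prod.cong[OF refl])
          fix l assume l: "l \<in> {..<n}"
          show "avg A (F i l) = (if l = i then \<theta> i else 1) * (if l = i then 1 else 1 - \<pi> l)"
          proof (cases "l = i")
            case True
            then show ?thesis using \<open>i = j\<close> sgn_fst
              by (simp add: \<theta>_def F_def[abs_def]) (intro avg_cong, simp)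
          next
            case False
            then show ?thesis using \<open>i = j\<close> l avg_diff[of A "\<lambda>_. 1" "e l"] avg_const[OF A] avg_e[of l]
              by (simp add: F_def[abs_def])
          qed
        qed
        also have "\<dots> = \<theta> i * \<rho> i" unfolding prod.distrib \<rho>_def using i by (simp add: prod.delta)
        finally show ?thesis using \<theta>(1)[of i] \<rho>[of i] i True unfolding pr by (simp add: c_def)
      next
        case False
        \<comment> \<open>Off the diagonal the sign of coordinate j occurs exactly once, so the
          average over this coordinate vanishes.\<close>
        have "F i j b = fst b * (\<lambda>u. (real P / real u) powr (1 - 1 / p) * (1 - (if u \<le> k j then 1 else 0))) (snd b)" for b
          using False by (simp add: F_def heavy_def e_def)
        then have "avg A (F i j) = 0"
          unfolding A_def using avg_heavy_odd[of P "\<lambda>u. (real P / real u) powr (1 - 1 / p) * (1 - (if u \<le> k j then 1 else 0))"]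
          by (metis (mono_tags, lifting) avg_cong)
        then have "(\<Prod>l<n. avg A (F i l)) = 0" using j by (intro prod_zero) auto
        then show ?thesis unfolding pr using False by simp
      qed
    qed
    also have "\<dots> = f j" using j by simp
    finally show ?thesis .
  qed
  then show ?thesis using x8 unfolding A_def by blast
qed

text \<open>At p = 2 the exponent 2 (1 - 1/p) drops to 1 and the second-moment estimate is lost;
  signs take over there.\<close>

theorem finite_Lp_kernel:
  assumes p: "p \<ge> 2"
  shows "\<exists>C>0. \<forall>n. \<exists>K X. Lp_kernel p C n {..<K::nat} X"
proof (cases "p = 2")
  case True
  then show ?thesis using Lp_kernel_reindex[OF Lp_kernel_2] by (intro exI[of _ "exp (1/2)"]) simp
next
  case False
  then have p: "p > 2" using p by simp
  define B where "B = (p + (1/2 + (1 + 1 / (2 * (1 - 1 / p) - 1))/2)) powr p"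
  have "Lp_kernel p (max 8 B) n (cube n (heavy_set (4 * (n + 1))))
      (\<lambda>i \<omega>. heavy p (4 * (n + 1)) (\<omega> i) / card (cube n (heavy_set (4 * (n + 1)))))" for n
  proof -
    define P where "P = 4 * (n + 1)"
    define W where "W = cube n (heavy_set P)"
    have P1: "P \<ge> 1" by (simp add: P_def)
    have eq: "(\<Sum>\<omega>\<in>W. heavy p P (\<omega> i) / card W * x \<omega>) = avg W (\<lambda>\<omega>. heavy p P (\<omega> i) * x \<omega>)" for i and x :: "_ \<Rightarrow> real"
      by (simp add: avg_def sum_divide_distrib)
    have "Lp_kernel p (max 8 B) n W (\<lambda>i \<omega>. heavy p P (\<omega> i) / card W)"
      unfolding Lp_kernel_def eq
    proof (intro conjI allI impI)
      show "finite W" unfolding W_def by (intro finite_PiE) (auto simp: finite_heavy_set)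
      fix x :: "_ \<Rightarrow> real" assume "\<forall>\<omega>\<in>W. \<bar>x \<omega>\<bar> \<le> 1"
      then have "(\<Sum>i<n. \<bar>avg W (\<lambda>\<omega>. heavy p P (\<omega> i) * x \<omega>)\<bar> powr p) \<le> B"
        unfolding W_def B_def by (intro heavy_upper[OF p P1]) auto
      then show "(\<Sum>i<n. \<bar>avg W (\<lambda>\<omega>. heavy p P (\<omega> i) * x \<omega>)\<bar> powr p) \<le> max 8 B" by simp
    next
      fix f assume "(\<Sum>i<n. \<bar>f i\<bar> powr p) \<le> 1"
      from heavy_lower[OF p P_def this]
      show "\<exists>x. (\<forall>w\<in>W. \<bar>x w\<bar> \<le> max 8 B) \<and> (\<forall>i<n. avg W (\<lambda>\<omega>. heavy p P (\<omega> i) * x \<omega>) = f i)"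
        unfolding W_def by (meson max.coboundedI1)
    qed
    then show ?thesis by (simp add: P_def W_def)
  qed
  then show ?thesis using Lp_kernel_reindex
    by (intro exI[of _ "max 8 B"] conjI allI) (simp add: max_def, blast)
qed

section \<open>Dyadic densities\<close>

lemma sets_I01_lebesgue: "{0..1} \<inter> space lebesgue \<in> sets (lebesgue :: real measure)" by simp

lemma integral_I01: "(\<integral>t. f t \<partial>I01) = (\<integral>t. indicator {0..1} t * f t \<partial>lebesgue)" for f :: "real \<Rightarrow> real"
  using integral_restrict_space[OF sets_I01_lebesgue, of f] by simp

lemma dyadic_split:
  "indicat_real (dyadic n i) t = indicat_real (dyadic (Suc n) (2 * i)) t + indicat_real (dyadic (Suc n) (2 * i + 1)) t"
proof (cases "t \<ge> 0")
  case True
  have "nat \<lfloor>t * 2 ^ n\<rfloor> = nat \<lfloor>t * 2 ^ Suc n\<rfloor> div 2"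
  proof -
    have "\<lfloor>t * 2 ^ n\<rfloor> = \<lfloor>t * 2 ^ Suc n / real_of_int 2\<rfloor>" by simp
    also have "\<dots> = \<lfloor>t * 2 ^ Suc n\<rfloor> div 2" by (rule floor_divide_real_eq_div) simp
    finally show ?thesis by (simp add: nat_div_distrib)
  qed
  then have "nat \<lfloor>t * 2 ^ n\<rfloor> = i \<longleftrightarrow> nat \<lfloor>t * 2 ^ Suc n\<rfloor> = 2 * i \<or> nat \<lfloor>t * 2 ^ Suc n\<rfloor> = 2 * i + 1"
  proof -
    have "a = b div 2 \<Longrightarrow> a = i \<longleftrightarrow> b = 2 * i \<or> b = 2 * i + 1" for a b :: nat by presburger
    from this[OF \<open>nat \<lfloor>t * 2 ^ n\<rfloor> = nat \<lfloor>t * 2 ^ Suc n\<rfloor> div 2\<close>] show ?thesis .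
  qed
  then show ?thesis using in_dyadic_iff[OF True] by (auto simp: indicator_def)
next
  case False
  have "0 \<le> real j / 2 ^ k" for j k by simp
  then have "t \<notin> dyadic k j" for k j using False unfolding dyadic_def atLeastLessThan_iff by (meson order_trans)
  then show ?thesis by simp
qed

lemma integral_dyadic_split:
  fixes h :: "real \<Rightarrow> real"
  assumes "integrable I01 h"
  shows "dyadic_int n i h
    = dyadic_int (Suc n) (2 * i) h + dyadic_int (Suc n) (2 * i + 1) h"
  unfolding dyadic_split[of n i] distrib_right
  by (intro Bochner_Integration.integral_add integrable_indicator_mult assms) auto

lemma sum_indicator_initial_dyadic:
  assumes "t \<ge> 0"
  shows "(\<Sum>i<k. indicat_real (dyadic n i) t) = indicat_real {..<real k / 2^n} t"
proof -
  have "(\<Sum>i<k. indicat_real (dyadic n i) t) = (\<Sum>i<k. if i = nat \<lfloor>t * 2^n\<rfloor> then 1 else 0)"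
    using in_dyadic_iff[OF assms] by (intro sum.cong) (auto simp: indicator_def)
  also have "\<dots> = (if nat \<lfloor>t * 2^n\<rfloor> < k then 1 else 0)" by simp
  also have "nat \<lfloor>t * 2^n\<rfloor> < k \<longleftrightarrow> t < real k / 2^n"
  proof -
    have "nat \<lfloor>t * 2^n\<rfloor> < k \<longleftrightarrow> \<lfloor>t * 2^n\<rfloor> < int k" using assms by (auto simp: nat_less_iff)
    also have "\<dots> \<longleftrightarrow> t * 2^n < real k" by (simp add: floor_less_iff)
    finally show ?thesis by (simp add: field_simps)
  qed
  finally show ?thesis by (simp add: indicator_def)
qed

text \<open>The half-line up to x is the limit, off the null set {x}, of initial unions of dyadic
  cells ending at the next dyadic point; dominated convergence applies.\<close>

lemma integral_initial_segment_zero: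
  fixes h :: "real \<Rightarrow> real"
  assumes h: "integrable I01 h"
    and zero: "\<And>n i. i < 2^n \<Longrightarrow> dyadic_int n i h = 0"
  shows "(\<integral>t. indicator {..x} t * h t \<partial>I01) = 0"
proof (cases "0 \<le> x \<and> x < 1")
  case True
  define k where "k n = nat \<lceil>x * 2^n\<rceil>" for n
  have kle: "k n \<le> 2^n" for n
  proof -
    have "x * 2^n \<le> real (2^n)" using True by simp
    then have "\<lceil>x * 2^n\<rceil> \<le> int (2^n)" by (simp add: ceiling_le_iff)
    then show ?thesis unfolding k_def by simp
  qed
  have kb: "x \<le> real (k n) / 2^n" "real (k n) / 2^n \<le> x + 1 / 2^n" for n
  proof -
    have "0 \<le> x * 2^n" using True by simp
    then have "x * 2^n \<le> real (k n)" "real (k n) \<le> x * 2^n + 1" unfolding k_def by linarith+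
    then show "x \<le> real (k n) / 2^n" "real (k n) / 2^n \<le> x + 1 / 2^n" by (auto simp: field_simps)
  qed
  have z: "(\<integral>t. indicator {..<real (k n) / 2^n} t * h t \<partial>I01) = 0" for n
  proof -
    have "(\<integral>t. indicator {..<real (k n) / 2^n} t * h t \<partial>I01) = (\<integral>t. (\<Sum>i<k n. indicat_real (dyadic n i) t * h t) \<partial>I01)"
      by (rule Bochner_Integration.integral_cong)
         (auto simp only: space_I01 sum_distrib_right[symmetric] sum_indicator_initial_dyadic atLeastAtMost_iff)
    also have "\<dots> = (\<Sum>i<k n. \<integral>t. indicat_real (dyadic n i) t * h t \<partial>I01)"
      by (intro Bochner_Integration.integral_sum integrable_indicator_mult h) simp
    also have "\<dots> = 0" using zero kle[of n] by (intro sum.neutral ballI) auto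
    finally show ?thesis .
  qed
  have "(\<lambda>n. \<integral>t. indicator {..<real (k n) / 2^n} t * h t \<partial>I01) \<longlonglongrightarrow> (\<integral>t. indicator {..x} t * h t \<partial>I01)"
  proof (rule integral_dominated_convergence[where w = "\<lambda>t. \<bar>h t\<bar>"])
    show "AE t in I01. (\<lambda>n. indicator {..<real (k n) / 2^n} t * h t) \<longlonglongrightarrow> indicator {..x} t * h t"
    proof -
      have "AE t in lebesgue. t \<noteq> x" by (rule AE_completion) (rule AE_lborel_singleton)
      then have "AE t in I01. t \<noteq> x" by (auto simp: AE_restrict_space_iff elim: eventually_mono)
      then show ?thesis
      proof eventually_elim
        case (elim t)
        have "\<forall>\<^sub>F n in sequentially. indicat_real {..<real (k n) / 2^n} t = indicator {..x} t"
        proof (cases "t < x")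
          case True
          then show ?thesis using kb(1) by (intro always_eventually allI) (auto simp: indicator_def intro: less_le_trans)
        next
          case False
          then have "x < t" using elim by simp
          have "(\<lambda>n. x + (1/2)^n) \<longlonglongrightarrow> x + 0" by (intro tendsto_intros LIMSEQ_power_zero) simp
          then have "\<forall>\<^sub>F n in sequentially. x + (1/2)^n < t" using \<open>x < t\<close> by (intro order_tendstoD(2)) auto
          then show ?thesis
          proof eventually_elim
            case (elim n)
            then show ?case using kb(2)[of n] \<open>x < t\<close> by (simp add: indicator_def power_one_over)
          qed
        qed
        then have "\<forall>\<^sub>F n in sequentially. indicat_real {..<real (k n) / 2^n} t * h t = indicator {..x} t * h t"
          by eventually_elim simp
        then show ?case by (rule tendsto_eventually)
      qed
    qed
    show "AE t in I01. norm (indicator {..<real (k n) / 2^n} t * h t) \<le> \<bar>h t\<bar>" for n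
      by (intro AE_I2) (simp add: indicator_def)
  qed ((rule borel_measurable_integrable[OF integrable_indicator_mult[OF h]], simp)+, rule integrable_abs[OF h])
  then show ?thesis unfolding z by (simp add: LIMSEQ_const_iff)
next
  case False
  show ?thesis
  proof (cases "x < 0")
    case True
    have "(\<integral>t. indicator {..x} t * h t \<partial>I01) = (\<integral>t. 0 \<partial>I01)"
      by (rule Bochner_Integration.integral_cong) (use True in \<open>auto simp: space_I01 indicator_def\<close>)
    then show ?thesis by simp
  next
    case False
    then have x: "x \<ge> 1" using \<open>\<not> (0 \<le> x \<and> x < 1)\<close> by simp
    have "(\<integral>t. indicator {..x} t * h t \<partial>I01) = dyadic_int 0 0 h"
    proof (rule integral_cong_AE)
      show "AE t in I01. indicator {..x} t * h t = indicator (dyadic 0 0) t * h t"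
        using AE_I01_less_1 by eventually_elim (use x in \<open>auto simp: indicator_def dyadic_def\<close>)
    qed (rule borel_measurable_integrable[OF integrable_indicator_mult[OF h]], simp)+
    then show ?thesis using zero[of 0 0] by simp
  qed
qed

text \<open>Half-lines form an intersection-stable generator, so the integrals vanish over all Borel
  sets, then over all Lebesgue sets, and uniqueness of densities concludes.\<close>

lemma dyadic_integrals_zero:
  fixes h :: "real \<Rightarrow> real"
  assumes h: "integrable I01 h"
    and zero: "\<And>n i. i < 2^n \<Longrightarrow> dyadic_int n i h = 0"
  shows "AE t in I01. h t = 0"
proof -
  \<comment> \<open>Extension by 0 to the whole line, on which the half-lines generate the Borel
    sets.\<close>
  define g where "g t = indicator {0..1} t * h t" for t
  have g: "integrable lebesgue g"
    using h integrable_restrict_space[OF sets_I01_lebesgue, of h] by (simp add: g_def[abs_def])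
  have gA: "integrable lebesgue (\<lambda>t. indicator A t * g t)" if "A \<in> sets lebesgue" for A
    using integrable_mult_indicator[OF that g] by simp
  have seg: "(\<integral>t. indicator {..x} t * g t \<partial>lebesgue) = 0" for x
    using integral_initial_segment_zero[OF h zero, of x] unfolding integral_I01 g_def
    by (simp add: mult.left_commute)
  have borel: "(\<integral>t. indicator A t * g t \<partial>lebesgue) = 0" if "A \<in> sets borel" for A
  proof -
    have gen: "sets (borel :: real measure) = sigma_sets UNIV (range (\<lambda>a. {..a}))"
      by (subst borel_eq_atMost) simp
    have total: "(\<integral>t. g t \<partial>lebesgue) = 0"
    proof -
      have "(\<integral>t. g t \<partial>lebesgue) = (\<integral>t. indicator {..1} t * g t \<partial>lebesgue)"
        by (rule Bochner_Integration.integral_cong) (auto simp: g_def indicator_def)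
      then show ?thesis using seg by simp
    qed
    have "Int_stable (range (\<lambda>a::real. {..a}))"
      by (auto simp: Int_stable_def intro: image_eqI[of _ _ "min a b" for a b])
    moreover have "range (\<lambda>a::real. {..a}) \<subseteq> Pow UNIV" by simp
    moreover have "A \<in> sigma_sets UNIV (range (\<lambda>a. {..a}))" using that gen by simp
    ultimately show ?thesis
    proof (induction rule: sigma_sets_induct_disjoint)
      case (basic A) then show ?case using seg by auto
    next
      case empty show ?case by simp
    next
      case (compl A)
      then have A: "A \<in> sets lebesgue" using gen by (simp add: sets_completionI_sets)
      have "(\<integral>t. indicator (UNIV - A) t * g t \<partial>lebesgue) = (\<integral>t. g t - indicator A t * g t \<partial>lebesgue)"
        by (rule Bochner_Integration.integral_cong) (auto simp: indicator_def)
      also have "\<dots> = 0" using compl gA[OF A] g total by simp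
      finally show ?case .
    next
      case (union A)
      have A: "A i \<in> sets lebesgue" for i proof -
        have "A i \<in> sigma_sets UNIV (range (\<lambda>a. {..a}))" using union(2) by blast
        then have "A i \<in> sets borel" unfolding gen .
        then show ?thesis by (simp add: sets_completionI_sets)
      qed
      have "(LINT t:(\<Union>i. A i)|lebesgue. g t) = (\<Sum>i. (LINT t:(A i)|lebesgue. g t))"
      proof (rule lebesgue_integral_countable_add)
        show "i \<noteq> j \<Longrightarrow> A i \<inter> A j = {}" for i j using union(1) by (auto simp: disjoint_family_on_def)
        show "set_integrable lebesgue (\<Union>i. A i) g"
          unfolding set_integrable_def using gA A by (simp add: sets.countable_UN)
      qed (rule A)
      then show ?case using union(3) by (simp add: set_lebesgue_integral_def)
    qed
  qed
  have "AE t in lebesgue. g t = 0"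
  proof (rule density_unique_real[OF g integrable_zero])
    \<comment> \<open>A Lebesgue set differs from its Borel \<open>main_part\<close> by a subset of
      a null set.\<close>
    fix A :: "real set" assume A: "A \<in> sets lebesgue"
    have m: "main_part lborel A \<in> sets borel" using main_part_sets[OF A] by simp
    obtain N where N: "N \<in> null_sets lborel" "null_part lborel A \<subseteq> N" using null_part[OF A] by blast
    have "set_lebesgue_integral lebesgue A g = (\<integral>t. indicator (main_part lborel A) t * g t \<partial>lebesgue)"
      unfolding set_lebesgue_integral_def
    proof (rule integral_cong_AE)
      have "AE t in lebesgue. t \<notin> N" using N(1) by (intro AE_not_in null_sets_completionI)
      then show "AE t in lebesgue. indicat_real A t *\<^sub>R g t = indicator (main_part lborel A) t * g t"
      proof eventually_elim
        case (elim t)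
        then have "t \<in> A \<longleftrightarrow> t \<in> main_part lborel A" using N(2) main_part_null_part_Un[OF A] by blast
        then show ?case by (simp add: indicator_def)
      qed
      show "(\<lambda>t. indicat_real A t *\<^sub>R g t) \<in> borel_measurable lebesgue"
        using borel_measurable_integrable[OF gA[OF A]] by simp
      show "(\<lambda>t. indicator (main_part lborel A) t * g t) \<in> borel_measurable lebesgue"
        by (rule borel_measurable_integrable[OF gA]) (simp add: m sets_completionI_sets)
    qed
    also have "\<dots> = 0" by (rule borel[OF m])
    finally show "set_lebesgue_integral lebesgue A g = set_lebesgue_integral lebesgue A (\<lambda>_. 0)"
      by (simp add: set_lebesgue_integral_def)
  qed
  then show ?thesis
    unfolding AE_restrict_space_iff[OF sets_I01_lebesgue] by eventually_elim (auto simp: g_def indicator_def)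
qed

lemma dyadic_integrals_unique:
  fixes f g :: "real \<Rightarrow> real"
  assumes "integrable I01 f" "integrable I01 g"
    and "\<And>n i. i < 2^n \<Longrightarrow> dyadic_int n i f = dyadic_int n i g"
  shows "AE t in I01. f t = g t"
proof -
  have "AE t in I01. f t - g t = 0"
  proof (rule dyadic_integrals_zero)
    show "integrable I01 (\<lambda>t. f t - g t)" using assms by simp
    show "(\<integral>t. indicator (dyadic n i) t * (f t - g t) \<partial>I01) = 0" if "i < 2^n" for n i
      unfolding right_diff_distrib
      using assms(3)[OF that] integrable_indicator_mult[OF assms(1), of "dyadic n i"] integrable_indicator_mult[OF assms(2), of "dyadic n i"] by simp
  qed
  then show ?thesis by eventually_elim simp
qed

lemma Fatou_real:
  fixes g :: "nat \<Rightarrow> 'a \<Rightarrow> real"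
  assumes int: "\<And>k. integrable M (g k)" and nonneg: "\<And>k t. g k t \<ge> 0"
    and meas: "f \<in> borel_measurable M" and conv: "AE t in M. (\<lambda>k. g k t) \<longlonglongrightarrow> f t"
    and bnd: "\<And>k. k \<ge> k0 \<Longrightarrow> (\<integral>t. g k t \<partial>M) \<le> B"
  shows "integrable M f \<and> (\<integral>t. f t \<partial>M) \<le> B"
proof -
  have f0: "AE t in M. 0 \<le> f t"
    using conv by eventually_elim (rule LIMSEQ_le_const, assumption, simp add: nonneg)
  have B: "B \<ge> 0" using bnd[of k0] integral_nonneg_AE[of "g k0" M] nonneg by (meson AE_I2 order_refl order_trans)
  have "(\<integral>\<^sup>+t. ennreal (f t) \<partial>M) = (\<integral>\<^sup>+t. liminf (\<lambda>k. ennreal (g k t)) \<partial>M)"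
  proof (rule nn_integral_cong_AE)
    show "AE t in M. ennreal (f t) = liminf (\<lambda>k. ennreal (g k t))"
      using conv
    proof eventually_elim
      case (elim t)
      then have "(\<lambda>k. ennreal (g k t)) \<longlonglongrightarrow> ennreal (f t)" by (rule tendsto_ennrealI)
      then show ?case using lim_imp_Liminf[OF sequentially_bot] by metis
    qed
  qed
  also have "\<dots> \<le> liminf (\<lambda>k. \<integral>\<^sup>+t. ennreal (g k t) \<partial>M)"
    using int by (intro nn_integral_liminf) auto
  also have "\<dots> \<le> liminf (\<lambda>k. ennreal B)"
  proof (rule Liminf_mono)
    show "\<forall>\<^sub>F k in sequentially. (\<integral>\<^sup>+t. ennreal (g k t) \<partial>M) \<le> ennreal B"
      using bnd int nonneg by (intro eventually_sequentiallyI[of k0]) (simp add: nn_integral_eq_integral ennreal_leI)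
  qed
  also have "\<dots> = ennreal B" by (simp add: Liminf_const)
  finally have le: "(\<integral>\<^sup>+t. ennreal (f t) \<partial>M) \<le> ennreal B" .
  have int_f: "integrable M f"
    using meas f0 le by (intro integrableI_nonneg) (auto simp: less_top[symmetric] top_unique)
  then have "ennreal (\<integral>t. f t \<partial>M) \<le> ennreal B"
    using le f0 by (simp add: nn_integral_eq_integral)
  then show ?thesis using B int_f by simp
qed

lemma step_mult: "AE t in I01. step m a t * step m b t = step m (\<lambda>i. a i * b i) t"
  using AE_I01_less_1 by eventually_elim (unfold step_def, simp only: sum_dyadic)

lemma indicator_dyadic_eq_step:
  "i < 2^m \<Longrightarrow> indicat_real (dyadic m i) t = step m (\<lambda>j. if j = i then 1 else 0) t"
  by (simp add: step_def if_distrib[of "\<lambda>u. u * _"] sum.delta cong: if_cong)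

lemma integral_dyadic_step:
  assumes "i < 2^m"
  shows "dyadic_int m i (step m c) = c i / 2^m"
proof -
  have "AE t in I01. indicator (dyadic m i) t * step m c t = step m (\<lambda>j. (if j = i then 1 else 0) * c j) t"
    unfolding indicator_dyadic_eq_step[OF assms] by (rule step_mult)
  then have "dyadic_int m i (step m c) = (\<Sum>j<2^m. (if j = i then 1 else 0) * c j) / 2^m"
    by (rule integral_AE_eq_step(2)) (auto intro!: borel_measurable_integrable[OF integrable_indicator_mult])
  also have "(\<Sum>j<2^m. (if j = i then 1 else 0) * c j) = (\<Sum>j<2^m. if j = i then c j else 0)"
    by (rule sum.cong) auto
  also have "\<dots> = c i" using assms by simp
  finally show ?thesis .
qed

text \<open>Downward induction from level m, since the integral over a cell is the sum over its
  halves.\<close>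

lemma dyadic_integrals_coarser:
  fixes \<nu> :: "nat \<Rightarrow> nat \<Rightarrow> real"
  assumes cons: "\<And>n i. i < 2^n \<Longrightarrow> \<nu> n i = (\<nu> (Suc n) (2 * i) + \<nu> (Suc n) (2 * i + 1)) / 2"
    and F: "integrable I01 F" and m: "\<And>i. i < 2^m \<Longrightarrow> dyadic_int m i F = \<nu> m i / 2^m"
    and le: "n \<le> m" and i: "i < 2^n"
  shows "dyadic_int n i F = \<nu> n i / 2^n"
  using le i
proof (induction n arbitrary: i rule: inc_induct)
  case base
  then show ?case using m by simp
next
  case (step n)
  have lt: "2 * i < 2 ^ Suc n" "2 * i + 1 < 2 ^ Suc n" using step.prems by auto
  have "dyadic_int n i F = \<nu> (Suc n) (2 * i) / 2 ^ Suc n + \<nu> (Suc n) (2 * i + 1) / 2 ^ Suc n"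
    using integral_dyadic_split[OF F, of n i] step.IH[OF lt(1)] step.IH[OF lt(2)] by linarith
  also have "\<dots> = \<nu> n i / 2^n" by (subst cons[OF step.prems]) (simp add: field_simps)
  finally show ?case .
qed

text \<open>A dyadic martingale bounded in L_p with p >= 2 is bounded in L_2, where its increments
  are orthogonal; hence it is Cauchy in L_1 and a subsequence converges almost everywhere. Fatou's
  lemma preserves the moment bound, L_1 estimates the cell integrals.\<close>

theorem dyadic_density:
  fixes \<nu> :: "nat \<Rightarrow> nat \<Rightarrow> real"
  assumes p: "p \<ge> 2"
    and cons: "\<And>n i. i < 2^n \<Longrightarrow> \<nu> n i = (\<nu> (Suc n) (2 * i) + \<nu> (Suc n) (2 * i + 1)) / 2"
    and bnd: "\<And>n. (\<Sum>i<2^n. \<bar>\<nu> n i\<bar> powr p) / 2^n \<le> B"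
  obtains f where "f \<in> Lp_fun p" "moment p f \<le> B"
    "\<And>n i. i < 2^n \<Longrightarrow> dyadic_int n i f = \<nu> n i / 2^n"
proof -
  define M where "M n = step n (\<nu> n)" for n
  define s where "s n = (\<Sum>i<2^n. (\<nu> n i)\<^sup>2) / 2^n" for n
  have Mint: "integrable I01 (M n)" for n by (simp add: M_def)
  have dy: "dyadic_int n i (M m) = \<nu> n i / 2^n" if "n \<le> m" "i < 2^n" for n m i
    by (rule dyadic_integrals_coarser[where \<nu> = \<nu>, OF _ Mint _ that])
       (use cons in \<open>simp_all add: M_def integral_dyadic_step\<close>)
  \<comment> \<open>For \<open>n \<le> m\<close>, integrating \<open>M m\<close> against
    \<open>M n\<close> sees only the means of \<open>M m\<close> over level-n cells, and these are
    the values of \<open>M n\<close>.\<close>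
  have sq: "integrable I01 (\<lambda>t. M n t * M m t)" "(\<integral>t. M n t * M m t \<partial>I01) = s n" if "n \<le> m" for n m
  proof -
    have eq: "(\<lambda>t. M n t * M m t) = (\<lambda>t. \<Sum>i<2^n. \<nu> n i * (indicat_real (dyadic n i) t * M m t))"
      unfolding M_def[of n] step_def sum_distrib_right mult.assoc ..
    have i: "integrable I01 (\<lambda>t. indicat_real (dyadic n i) t * M m t)" for i
      by (rule integrable_indicator_mult[OF Mint]) simp
    show "integrable I01 (\<lambda>t. M n t * M m t)" unfolding eq
      by (intro Bochner_Integration.integrable_sum integrable_mult_right i)
    have "(\<integral>t. M n t * M m t \<partial>I01) = (\<Sum>j<2^n. \<nu> n j * dyadic_int n j (M m))"
      unfolding eq using i by (subst Bochner_Integration.integral_sum) auto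
    also have "\<dots> = (\<Sum>j<2^n. \<nu> n j * (\<nu> n j / 2^n))" using dy[OF that] by (intro sum.cong) auto
    also have "\<dots> = s n" by (simp add: s_def sum_divide_distrib power2_eq_square)
    finally show "(\<integral>t. M n t * M m t \<partial>I01) = s n" .
  qed
  have diff2: "integrable I01 (\<lambda>t. (M m t - M n t)\<^sup>2)" "(\<integral>t. (M m t - M n t)\<^sup>2 \<partial>I01) = s m - s n" if "n \<le> m" for n m
  proof -
    have eq: "(\<lambda>t. (M m t - M n t)\<^sup>2) = (\<lambda>t. M m t * M m t - 2 * (M n t * M m t) + M n t * M n t)"
      by (auto simp: power2_eq_square algebra_simps)
    show "integrable I01 (\<lambda>t. (M m t - M n t)\<^sup>2)" "(\<integral>t. (M m t - M n t)\<^sup>2 \<partial>I01) = s m - s n"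
      unfolding eq using sq[of m m] sq[of n n] sq[OF that] by auto
  qed
  have s_mono: "incseq s"
  proof (rule incseq_SucI)
    fix n
    have "0 \<le> (\<integral>t. (M (Suc n) t - M n t)\<^sup>2 \<partial>I01)" by (rule integral_nonneg_AE) simp
    then show "s n \<le> s (Suc n)" using diff2(2)[of n "Suc n"] by simp
  qed
  have s_bnd: "s n \<le> 1 + B" for n
  proof -
    have "(\<nu> n i)\<^sup>2 \<le> 1 + \<bar>\<nu> n i\<bar> powr p" for i
    proof (cases "\<nu> n i = 0")
      case False
      have "(\<nu> n i)\<^sup>2 = \<bar>\<nu> n i\<bar> powr 2" using False by (simp add: powr_numeral)
      then have "((\<nu> n i)\<^sup>2) powr (p / 2) = \<bar>\<nu> n i\<bar> powr p" by (simp only: powr_powr) simp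
      then show ?thesis using le_add_powr[of "(\<nu> n i)\<^sup>2" 1 "p/2"] p by simp
    qed simp
    then have "(\<Sum>i<2^n. (\<nu> n i)\<^sup>2) \<le> (\<Sum>i<2^n. 1 + \<bar>\<nu> n i\<bar> powr p)" by (intro sum_mono)
    then have "s n \<le> (\<Sum>i<2^n. 1 + \<bar>\<nu> n i\<bar> powr p) / 2^n" unfolding s_def by (intro divide_right_mono) auto
    also have "\<dots> = 1 + (\<Sum>i<2^n. \<bar>\<nu> n i\<bar> powr p) / 2^n" by (simp add: sum.distrib add_divide_distrib)
    finally show ?thesis using bnd[of n] by linarith
  qed
  have "convergent s"
    using incseq_convergent[OF s_mono] s_bnd unfolding convergent_def by metis
  then have "Cauchy s" by (rule convergent_Cauchy)
  have small: "\<exists>N. \<forall>i\<ge>N. \<forall>j\<ge>N. (\<integral>t. norm (M i t - M j t) \<partial>I01) < e" if e: "e > 0" for e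
  proof -
    obtain N where N: "\<And>i j. i \<ge> N \<Longrightarrow> j \<ge> N \<Longrightarrow> \<bar>s i - s j\<bar> < e\<^sup>2 / 2"
      using CauchyD[OF \<open>Cauchy s\<close>, of "e\<^sup>2 / 2"] e by auto
    have main: "(\<integral>t. norm (M i t - M j t) \<partial>I01) < e" if ij: "j \<ge> N" "i \<ge> j" for i j
    proof -
      \<comment> \<open>\<open>u \<le> e / 4 + u\<^sup>2 / e\<close> converts the L_2 estimate into
        one in L_1.\<close>
      have "(\<integral>t. norm (M i t - M j t) \<partial>I01) \<le> (\<integral>t. e / 4 + (M i t - M j t)\<^sup>2 / e \<partial>I01)"
      proof (rule integral_mono)
        fix t
        define u where "u = \<bar>M i t - M j t\<bar>"
        have "0 \<le> (u - e / 2)\<^sup>2 / e" using e by simp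
        also have "\<dots> = u\<^sup>2 / e - u + e / 4" using e by (simp add: power2_eq_square field_simps)
        finally show "norm (M i t - M j t) \<le> e / 4 + (M i t - M j t)\<^sup>2 / e" by (simp add: u_def)
      qed (use Mint diff2(1)[OF ij(2)] in auto)
      also have "\<dots> = e / 4 + (s i - s j) / e"
        using diff2[OF ij(2)] by (simp add: measure_I01[of "{0..1}"] space_I01 measure_restrict_space)
      also have "\<dots> < e"
      proof -
        have "s i - s j < e\<^sup>2 / 2" using N[of i j] ij abs_ge_self[of "s i - s j"] by linarith
        then have "(s i - s j) / e < e / 2" using e by (simp add: divide_less_eq power2_eq_square)
        then show ?thesis using e by linarith
      qed
      finally show ?thesis .
    qed
    have "(\<integral>t. norm (M i t - M j t) \<partial>I01) < e" if "i \<ge> N" "j \<ge> N" for i j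
    proof (cases "j \<le> i")
      case True then show ?thesis using main that by simp
    next
      case False
      then show ?thesis using main[of i j] that by (simp add: abs_minus_commute)
    qed
    then show ?thesis by blast
  qed
  obtain r where r: "strict_mono r" "AE t in I01. Cauchy (\<lambda>k. M (r k) t)"
    using cauchy_L1_AE_cauchy_subseq[OF Mint small] by blast
  define f where "f t = lim (\<lambda>k. M (r k) t)" for t
  have fm: "f \<in> borel_measurable I01" unfolding f_def
    using Mint by (intro borel_measurable_lim_metric) auto
  have conv: "AE t in I01. (\<lambda>k. M (r k) t) \<longlonglongrightarrow> f t"
    using r(2) by eventually_elim (simp add: f_def Cauchy_convergent_iff convergent_LIMSEQ_iff)
  have powr_p: "integrable I01 (\<lambda>t. \<bar>f t\<bar> powr p) \<and> moment p f \<le> B"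
  proof (rule Fatou_real)
    show "AE t in I01. (\<lambda>k. \<bar>M (r k) t\<bar> powr p) \<longlonglongrightarrow> \<bar>f t\<bar> powr p"
      using conv
    proof eventually_elim
      case (elim t)
      then show ?case using p by (intro tendsto_powr' tendsto_rabs tendsto_const) auto
    qed
    show "integrable I01 (\<lambda>t. \<bar>M (r k) t\<bar> powr p)" for k
      unfolding M_def using step_Lp_fun Lp_fun_integrable by blast
    show "moment p (M (r k)) \<le> B" if "k \<ge> 0" for k
      using bnd[of "r k"] by (simp add: M_def integral_step_powr)
  qed (use fm in auto)
  have fL: "f \<in> Lp_fun p" using powr_p fm by (simp add: Lp_fun_def)
  then have fi: "integrable I01 f" using Lp_fun_imp_integrable p by simp
  have "dyadic_int n i f = \<nu> n i / 2^n" if i: "i < 2^n" for n i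
  proof -
    have "\<bar>dyadic_int n i f - \<nu> n i / 2^n\<bar> \<le> e" if e: "e > 0" for e
    proof -
      obtain N where N: "\<And>i j. i \<ge> N \<Longrightarrow> j \<ge> N \<Longrightarrow> (\<integral>t. norm (M i t - M j t) \<partial>I01) < e" using small[OF e] by blast
      define k where "k = max N n"
      have rk: "l \<le> r l" for l using r(1) by (rule strict_mono_imp_increasing)
      \<comment> \<open>Fatou's lemma in l, with k fixed, turns the Cauchy estimate into a bound on
        the distance from the limit.\<close>
      have L: "integrable I01 (\<lambda>t. \<bar>f t - M (r k) t\<bar>) \<and> (\<integral>t. \<bar>f t - M (r k) t\<bar> \<partial>I01) \<le> e"
      proof (rule Fatou_real)
        show "AE t in I01. (\<lambda>l. \<bar>M (r l) t - M (r k) t\<bar>) \<longlonglongrightarrow> \<bar>f t - M (r k) t\<bar>"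
          using conv by eventually_elim (intro tendsto_intros)
        show "(\<integral>t. \<bar>M (r l) t - M (r k) t\<bar> \<partial>I01) \<le> e" if "l \<ge> N" for l
          using N[of "r l" "r k"] rk[of l] rk[of k] that by (simp add: k_def)
      qed (use Mint fm in auto)
      have "dyadic_int n i f - \<nu> n i / 2^n
          = dyadic_int n i f - dyadic_int n i (M (r k))"
        using dy[of n "r k" i] i rk[of k] by (simp add: k_def)
      also have "\<dots> = (\<integral>t. indicator (dyadic n i) t * f t - indicator (dyadic n i) t * M (r k) t \<partial>I01)"
        by (rule Bochner_Integration.integral_diff[symmetric]) (auto intro!: integrable_indicator_mult fi Mint)
      finally have "\<bar>dyadic_int n i f - \<nu> n i / 2^n\<bar>
          \<le> (\<integral>t. \<bar>indicator (dyadic n i) t * f t - indicator (dyadic n i) t * M (r k) t\<bar> \<partial>I01)"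
        by (simp only: integral_abs_bound)
      also have "\<dots> \<le> (\<integral>t. \<bar>f t - M (r k) t\<bar> \<partial>I01)"
        using L fi Mint
        by (intro integral_mono integrable_abs Bochner_Integration.integrable_diff integrable_indicator_mult)
           (auto simp: indicator_def)
      finally show ?thesis using L by simp
    qed
    then have "\<bar>dyadic_int n i f - \<nu> n i / 2^n\<bar> \<le> 0"
      by (rule field_le_epsilon) simp
    then show ?thesis by simp
  qed
  then show ?thesis using that fL powr_p by blast
qed

section \<open>Bounded sequences map onto \<open>L\<^sub>p\<close>\<close>

definition bounded_seq :: "(nat \<Rightarrow> real) \<Rightarrow> bool" where
  "bounded_seq y \<longleftrightarrow> (\<exists>b. \<forall>n. \<bar>y n\<bar> \<le> b)"

lemma bounded_seqI: "(\<And>n. \<bar>y n\<bar> \<le> b) \<Longrightarrow> bounded_seq y" by (auto simp: bounded_seq_def)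

lemma bounded_seq_add: "bounded_seq y \<Longrightarrow> bounded_seq z \<Longrightarrow> bounded_seq (\<lambda>n. y n + z n)"
  unfolding bounded_seq_def by (meson abs_triangle_ineq add_mono order_trans)

lemma bounded_seq_cmult: "bounded_seq y \<Longrightarrow> bounded_seq (\<lambda>n. c * y n)"
  unfolding bounded_seq_def by (metis abs_ge_zero abs_mult mult_left_mono)

lemma bounded_seq_const: "bounded_seq (\<lambda>_. c)" by (auto simp: bounded_seq_def)

lemma bounded_seq_sum: "(\<And>i. i \<in> I \<Longrightarrow> bounded_seq (y i)) \<Longrightarrow> bounded_seq (\<lambda>n. \<Sum>i\<in>I. y i n)"
  by (induction I rule: infinite_finite_induct) (auto intro: bounded_seq_add bounded_seq_const)

lemma bounded_seq_powr: "bounded_seq y \<Longrightarrow> p \<ge> 0 \<Longrightarrow> bounded_seq (\<lambda>n. \<bar>y n\<bar> powr p)"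
  unfolding bounded_seq_def by (metis abs_ge_zero abs_of_nonneg powr_ge_zero powr_mono2)

text \<open>A Banach limit on plain functions, so that sequences indexed by levels need not be
  wrapped as elements of \<open>linf\<close>.\<close>

locale limit_functional =
  fixes \<Lambda> :: "(nat \<Rightarrow> real) \<Rightarrow> real"
  assumes add: "bounded_seq y \<Longrightarrow> bounded_seq z \<Longrightarrow> \<Lambda> (\<lambda>n. y n + z n) = \<Lambda> y + \<Lambda> z"
    and cmult: "bounded_seq y \<Longrightarrow> \<Lambda> (\<lambda>n. c * y n) = c * \<Lambda> y"
    and mono: "bounded_seq y \<Longrightarrow> bounded_seq z \<Longrightarrow> (\<And>n. y n \<le> z n) \<Longrightarrow> \<Lambda> y \<le> \<Lambda> z"
    and lim: "y \<longlonglongrightarrow> l \<Longrightarrow> \<Lambda> y = l"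
begin

lemma const: "\<Lambda> (\<lambda>_. c) = c" by (rule lim) simp

lemma sum:
  assumes "finite I" "\<And>i. i \<in> I \<Longrightarrow> bounded_seq (y i)"
  shows "\<Lambda> (\<lambda>n. \<Sum>i\<in>I. y i n) = (\<Sum>i\<in>I. \<Lambda> (y i))"
  using assms by (induction I) (auto simp: const add bounded_seq_sum)

text \<open>Jensen's inequality for a positive normalised functional, up to \<open>2 powr p\<close>:
  the threshold bound holds pointwise and \<Lambda> respects it.\<close>

lemma abs_powr_le:
  assumes y: "bounded_seq y" and p: "p \<ge> 1"
  shows "\<bar>\<Lambda> y\<bar> powr p \<le> 2 powr p * \<Lambda> (\<lambda>n. \<bar>y n\<bar> powr p)"
proof (rule powr_le_of_le_add_powr)
  have bp: "bounded_seq (\<lambda>n. \<bar>y n\<bar> powr p)" using y p by (intro bounded_seq_powr) auto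
  show "0 \<le> \<Lambda> (\<lambda>n. \<bar>y n\<bar> powr p)"
    using mono[OF bounded_seq_const bp, of 0] const[of 0] by simp
  fix c :: real assume c: "c > 0"
  have b: "bounded_seq (\<lambda>n. c + c powr (1 - p) * \<bar>y n\<bar> powr p)"
    by (intro bounded_seq_add bounded_seq_const bounded_seq_cmult bp)
  have val: "\<Lambda> (\<lambda>n. c + c powr (1 - p) * \<bar>y n\<bar> powr p) = c + c powr (1 - p) * \<Lambda> (\<lambda>n. \<bar>y n\<bar> powr p)"
    using add[OF bounded_seq_const bounded_seq_cmult[OF bp]] cmult[OF bp] const by simp
  have le: "\<bar>y n\<bar> \<le> c + c powr (1 - p) * \<bar>y n\<bar> powr p" for n
    using le_add_powr[of "\<bar>y n\<bar>" c p] c p by simp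
  have "\<Lambda> y \<le> c + c powr (1 - p) * \<Lambda> (\<lambda>n. \<bar>y n\<bar> powr p)"
    using mono[OF y b] le abs_le_D1 val by metis
  moreover have "\<Lambda> (\<lambda>n. -1 * y n) \<le> c + c powr (1 - p) * \<Lambda> (\<lambda>n. \<bar>y n\<bar> powr p)"
    unfolding val[symmetric] using le by (intro mono bounded_seq_cmult y b) (simp add: abs_le_D2)
  ultimately show "\<bar>\<Lambda> y\<bar> \<le> c + c powr (1 - p) * \<Lambda> (\<lambda>n. \<bar>y n\<bar> powr p)"
    unfolding cmult[OF y] by simp
qed (use p in auto)

end

lemma limit_functional_exists: obtains \<Lambda> where "limit_functional \<Lambda>"
proof -
  obtain L :: "linf \<Rightarrow> real" where L: "linear L"
    "\<And>x l. apply_bcontfun x \<longlonglongrightarrow> l \<Longrightarrow> L x = l"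
    "\<And>x y. (\<And>n. apply_bcontfun x n \<le> apply_bcontfun y n) \<Longrightarrow> L x \<le> L y"
    by (rule Banach_limit) blast
  have ap: "apply_bcontfun (Bcontfun y) = y" if "bounded_seq y" for y :: "nat \<Rightarrow> real"
    using that linf_apply_Bcontfun unfolding bounded_seq_def by blast
  have "limit_functional (\<lambda>y. L (Bcontfun y))"
  proof
    fix y z :: "nat \<Rightarrow> real" assume y: "bounded_seq y" and z: "bounded_seq z"
    have "Bcontfun (\<lambda>n. y n + z n) = Bcontfun y + Bcontfun z"
      by (rule bcontfun_eqI) (simp add: ap y z bounded_seq_add)
    then show "L (Bcontfun (\<lambda>n. y n + z n)) = L (Bcontfun y) + L (Bcontfun z)"
      by (simp add: linear_add[OF L(1)])
    show "L (Bcontfun y) \<le> L (Bcontfun z)" if "\<And>n. y n \<le> z n"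
      using that by (intro L(3)) (simp add: ap y z)
  next
    fix y :: "nat \<Rightarrow> real" and c assume y: "bounded_seq y"
    have "Bcontfun (\<lambda>n. c * y n) = c *\<^sub>R Bcontfun y"
      by (rule bcontfun_eqI) (simp add: ap y bounded_seq_cmult)
    then show "L (Bcontfun (\<lambda>n. c * y n)) = c * L (Bcontfun y)" by (simp add: linear_scale[OF L(1)])
  next
    fix y :: "nat \<Rightarrow> real" and l assume "y \<longlonglongrightarrow> l"
    moreover from this have "bounded_seq y"
      unfolding bounded_seq_def using convergent_imp_Bseq[of y] by (auto simp: convergent_def Bseq_def)
    ultimately show "L (Bcontfun y) = l" by (intro L(2)) (simp add: ap)
  qed
  then show ?thesis by (rule that)
qed

text \<open>Hoelder's inequality on one cell, rescaled to means: averaging increases p-th moments by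
  at most \<open>2 powr p\<close>.\<close>

lemma dyadic_average_powr_le:
  assumes f: "f \<in> Lp_fun p" and p: "p \<ge> 1" and i: "i < 2^n"
  shows "\<bar>2^n * dyadic_int n i f\<bar> powr p
    \<le> 2 powr p * (2^n * (\<integral>t. indicator (dyadic n i) t * \<bar>f t\<bar> powr p \<partial>I01))"
proof -
  define J where "J = (\<integral>t. indicator (dyadic n i) t * \<bar>f t\<bar> powr p \<partial>I01)"
  define I where "I = (\<integral>t. indicator (dyadic n i) t * \<bar>f t\<bar> \<partial>I01)"
  have I: "I \<ge> 0" unfolding I_def by (rule integral_nonneg_AE) simp
  have "\<bar>\<integral>t. indicator (dyadic n i) t * f t \<partial>I01\<bar> \<le> I" unfolding I_def
    by (rule order_trans[OF integral_abs_bound]) (simp add: abs_mult)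
  then have "\<bar>2^n * dyadic_int n i f\<bar> powr p \<le> (2^n * I) powr p"
    using p by (intro powr_mono2) (auto simp: abs_mult)
  also have "\<dots> = (2^n) powr p * I powr p" using I by (simp add: powr_mult)
  also have "\<dots> \<le> (2^n) powr p * (2 powr p * ((1 / 2^n) powr (p - 1) * J))"
    using Lp_integral_indicator_le[OF f p dyadic_borel dyadic_subset[OF i]]
    by (intro mult_left_mono) (auto simp: I_def J_def measure_dyadic)
  also have "\<dots> = 2 powr p * ((2^n) powr p * (1 / 2^n) powr (p - 1) * J)" by (simp only: ac_simps)
  also have "(2^n) powr p * (1 / 2^n) powr (p - 1) = (2^n :: real)"
    by (simp add: powr_divide powr_diff)
  finally show ?thesis by (simp add: J_def)
qed

lemma sum_integral_dyadic_le:
  fixes g :: "real \<Rightarrow> real"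
  assumes g: "integrable I01 g" and nonneg: "\<And>t. g t \<ge> 0"
  shows "(\<Sum>i<2^n. \<integral>t. indicator (dyadic n i) t * g t \<partial>I01) \<le> (\<integral>t. g t \<partial>I01)"
proof -
  have "(\<Sum>i<2^n. \<integral>t. indicator (dyadic n i) t * g t \<partial>I01) = (\<integral>t. (\<Sum>i<2^n. indicator (dyadic n i) t * g t) \<partial>I01)"
    by (rule Bochner_Integration.integral_sum[symmetric]) (rule integrable_indicator_mult[OF g], simp)
  also have "\<dots> \<le> (\<integral>t. g t \<partial>I01)"
  proof (rule integral_mono_AE)
    show "integrable I01 (\<lambda>t. \<Sum>i<2^n. indicator (dyadic n i) t * g t)"
      by (intro Bochner_Integration.integrable_sum integrable_indicator_mult g) simp
    show "AE t in I01. (\<Sum>i<2^n. indicator (dyadic n i) t * g t) \<le> g t"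
      using AE_I01_less_1
    proof eventually_elim
      case (elim t)
      then have "(\<Sum>i<2^n. g t * indicat_real (dyadic n i) t) = g t" by (intro sum_dyadic) auto
      then show ?case by (simp only: mult.commute order_refl)
    qed
  qed (rule g)
  finally show ?thesis .
qed

lemma sum_dyadic_average_powr_le:
  assumes f: "f \<in> Lp_fun p" and p: "p \<ge> 1"
  shows "(\<Sum>i<2^n. \<bar>2^n * dyadic_int n i f\<bar> powr p) / 2^n
    \<le> 2 powr p * moment p f"
proof -
  have "(\<Sum>i<2^n. \<bar>2^n * dyadic_int n i f\<bar> powr p) / 2^n
      \<le> (\<Sum>i<2^n. 2 powr p * (2^n * (\<integral>t. indicator (dyadic n i) t * \<bar>f t\<bar> powr p \<partial>I01))) / 2^n"
    using dyadic_average_powr_le[OF f p] by (intro divide_right_mono sum_mono) auto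
  also have "\<dots> = 2 powr p * (\<Sum>i<2^n. (\<integral>t. indicator (dyadic n i) t * \<bar>f t\<bar> powr p \<partial>I01))"
    by (simp add: sum_distrib_left sum_divide_distrib)
  also have "\<dots> \<le> 2 powr p * moment p f"
    using sum_integral_dyadic_le[OF Lp_fun_integrable(1)[OF f]] by (intro mult_left_mono) auto
  finally show ?thesis .
qed

text \<open>One finite kernel for every dyadic level m, with one row for each of its 2^m
  cells.\<close>

locale kernel_system = limit_functional +
  fixes p C :: real and K :: "nat \<Rightarrow> nat" and X :: "nat \<Rightarrow> nat \<Rightarrow> nat \<Rightarrow> real"
  assumes p: "p \<ge> 2" and C: "C > 0" and kernel: "Lp_kernel p C (2^m) {..<K m} (X m)"
begin

text \<open>Level m reads its own block of x, at the positions \<open>prod_encode (m, w)\<close>.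
  The factor converts the p-norm of 2^m numbers into the L_p norm of a step function on cells of
  measure 2^(-m).\<close>

definition coef :: "nat \<Rightarrow> nat \<Rightarrow> linf \<Rightarrow> real" where
  "coef m i x = (2^m) powr (1 / p) * (\<Sum>w<K m. X m i w * apply_bcontfun x (prod_encode (m, w)))"

definition F :: "nat \<Rightarrow> linf \<Rightarrow> real \<Rightarrow> real" where "F m x = step m (\<lambda>i. coef m i x)"

text \<open>The mean over a fixed cell of level n of the level-m function; m comes last because the
  limit is taken in it.\<close>

definition \<alpha> :: "nat \<Rightarrow> nat \<Rightarrow> linf \<Rightarrow> nat \<Rightarrow> real" where
  "\<alpha> n i x m = 2^n * dyadic_int n i (F m x)"

definition \<nu> :: "linf \<Rightarrow> nat \<Rightarrow> nat \<Rightarrow> real" where "\<nu> x n i = \<Lambda> (\<alpha> n i x)"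

lemma F_add: "F m (x + y) t = F m x t + F m y t"
  by (simp only: F_def step_def coef_def plus_bcontfun.rep_eq distrib_left distrib_right sum.distrib)

lemma F_scale: "F m (a *\<^sub>R x) t = a * F m x t"
proof -
  have "coef m i (a *\<^sub>R x) = a * coef m i x" for i
    by (simp add: coef_def sum_distrib_left mult_ac)
  then show ?thesis by (simp only: F_def step_def sum_distrib_left mult.assoc)
qed

lemma F_Lp: "F m x \<in> Lp_fun p" unfolding F_def by (rule step_Lp_fun)

lemma F_int: "integrable I01 (F m x)" unfolding F_def by simp

lemma F_bound:
  assumes b: "\<And>w. w < K m \<Longrightarrow> \<bar>apply_bcontfun x (prod_encode (m, w))\<bar> \<le> b" "b > 0"
  shows "moment p (F m x) \<le> C * b powr p"
proof -
  define y where "y w = apply_bcontfun x (prod_encode (m, w)) / b" for w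
  have "\<forall>w\<in>{..<K m}. \<bar>y w\<bar> \<le> 1" using b by (auto simp: y_def field_simps)
  then have le: "(\<Sum>i<2^m. \<bar>\<Sum>w<K m. X m i w * y w\<bar> powr p) \<le> C"
    using kernel[of m] unfolding Lp_kernel_def by blast
  have "\<bar>coef m i x\<bar> powr p = 2^m * (b powr p * \<bar>\<Sum>w<K m. X m i w * y w\<bar> powr p)" for i
  proof -
    have "coef m i x = (2^m) powr (1 / p) * (b * (\<Sum>w<K m. X m i w * y w))"
      unfolding coef_def sum_distrib_left[of b] using b(2) by (simp add: y_def)
    then show ?thesis using b(2) p by (simp add: abs_mult powr_mult powr_powr)
  qed
  then have "moment p (F m x) = b powr p * (\<Sum>i<2^m. \<bar>\<Sum>w<K m. X m i w * y w\<bar> powr p)"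
    unfolding F_def integral_step_powr by (simp flip: sum_distrib_left)
  also have "\<dots> \<le> b powr p * C" using le by (intro mult_left_mono) auto
  finally show ?thesis by (simp add: mult.commute)
qed

definition D :: "nat \<Rightarrow> real" where "D n = (2 powr p * (2^n * C)) powr (1 / p)"

lemma \<alpha>_bound:
  assumes i: "i < 2^n" and b: "\<And>w. w < K m \<Longrightarrow> \<bar>apply_bcontfun x (prod_encode (m, w))\<bar> \<le> b" "b > 0"
  shows "\<bar>\<alpha> n i x m\<bar> \<le> D n * b"
proof -
  have "(\<integral>t. indicator (dyadic n i) t * \<bar>F m x t\<bar> powr p \<partial>I01) \<le> moment p (F m x)"
    using Lp_fun_integrable(1)[OF F_Lp]
    by (intro integral_mono integrable_indicator_mult) (auto simp: indicator_def)
  also have "\<dots> \<le> C * b powr p" by (rule F_bound[OF b])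
  finally have "\<bar>\<alpha> n i x m\<bar> powr p \<le> 2 powr p * (2^n * (C * b powr p))"
    unfolding \<alpha>_def using p
    by (intro order_trans[OF dyadic_average_powr_le[OF F_Lp _ i]] mult_left_mono) auto
  then have "(\<bar>\<alpha> n i x m\<bar> powr p) powr (1 / p) \<le> (2 powr p * (2^n * C) * b powr p) powr (1 / p)"
    using p by (intro powr_mono2) (auto simp: mult.assoc)
  also have "\<dots> = D n * b" unfolding D_def using b(2) C p by (subst powr_mult) (auto simp: powr_powr)
  finally show ?thesis using p by (simp add: powr_powr)
qed

lemma \<alpha>_bounded: "i < 2^n \<Longrightarrow> bounded_seq (\<alpha> n i x)"
proof (rule bounded_seqI)
  fix m assume "i < 2^n"
  then show "\<bar>\<alpha> n i x m\<bar> \<le> D n * (norm x + 1)"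
  proof (rule \<alpha>_bound)
    show "\<bar>apply_bcontfun x (prod_encode (m, w))\<bar> \<le> norm x + 1" for w
      using linf_abs_le_norm[of x "prod_encode (m, w)"] by linarith
  qed (simp add: add_nonneg_pos)
qed

lemma \<nu>_add: assumes "i < 2^n" shows "\<nu> (x + y) n i = \<nu> x n i + \<nu> y n i"
proof -
  have "\<alpha> n i (x + y) = (\<lambda>m. \<alpha> n i x m + \<alpha> n i y m)"
    using integrable_indicator_mult[OF F_int, of "dyadic n i"]
    by (simp add: \<alpha>_def[abs_def] F_add distrib_left)
  then show ?thesis unfolding \<nu>_def using add[OF \<alpha>_bounded \<alpha>_bounded] assms by simp
qed

lemma \<nu>_scale: assumes "i < 2^n" shows "\<nu> (a *\<^sub>R x) n i = a * \<nu> x n i"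
proof -
  have "\<alpha> n i (a *\<^sub>R x) = (\<lambda>m. a * \<alpha> n i x m)"
    by (simp add: \<alpha>_def[abs_def] F_scale mult.left_commute)
  then show ?thesis unfolding \<nu>_def using cmult[OF \<alpha>_bounded] assms by simp
qed

lemma \<nu>_consistent: assumes "i < 2^n" shows "\<nu> x n i = (\<nu> x (Suc n) (2 * i) + \<nu> x (Suc n) (2 * i + 1)) / 2"
proof -
  have lt: "2 * i < 2 ^ Suc n" "2 * i + 1 < 2 ^ Suc n" using assms by auto
  have "\<alpha> n i x = (\<lambda>m. (1/2) * (\<alpha> (Suc n) (2 * i) x m + \<alpha> (Suc n) (2 * i + 1) x m))"
    unfolding \<alpha>_def using integral_dyadic_split[OF F_int, of n i] by (simp add: fun_eq_iff algebra_simps)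
  then show ?thesis unfolding \<nu>_def
    using cmult[OF bounded_seq_add[OF \<alpha>_bounded[OF lt(1)] \<alpha>_bounded[OF lt(2)]], of "1/2"]
      add[OF \<alpha>_bounded[OF lt(1)] \<alpha>_bounded[OF lt(2)]] by simp
qed

text \<open>One factor \<open>2 powr p\<close> stems from the limit functional, another from
  averaging over cells, which gives the 4.\<close>

lemma \<nu>_bound:
  "(\<Sum>i<2^n. \<bar>\<nu> x n i\<bar> powr p) / 2^n \<le> 4 powr p * (C * norm x powr p)"
proof (cases "x = 0")
  case True
  have "\<nu> 0 n i = 0" if "i < 2^n" for i using \<nu>_scale[OF that, of 0 0] by simp
  then show ?thesis using True by simp
next
  case False
  have b: "bounded_seq (\<lambda>m. \<bar>\<alpha> n i x m\<bar> powr p)" if "i < 2^n" for i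
    using \<alpha>_bounded[OF that] p by (intro bounded_seq_powr) auto
  have "(\<Sum>i<2^n. \<bar>\<nu> x n i\<bar> powr p) / 2^n \<le> (\<Sum>i<2^n. 2 powr p * \<Lambda> (\<lambda>m. \<bar>\<alpha> n i x m\<bar> powr p)) / 2^n"
    unfolding \<nu>_def using abs_powr_le[OF \<alpha>_bounded] p by (intro divide_right_mono sum_mono) auto
  also have "\<dots> = 2 powr p * ((1 / 2^n) * \<Lambda> (\<lambda>m. \<Sum>i<2^n. \<bar>\<alpha> n i x m\<bar> powr p))"
    using b by (subst sum) (auto simp flip: sum_distrib_left)
  also have "(1 / 2^n) * \<Lambda> (\<lambda>m. \<Sum>i<2^n. \<bar>\<alpha> n i x m\<bar> powr p) = \<Lambda> (\<lambda>m. (1 / 2^n) * (\<Sum>i<2^n. \<bar>\<alpha> n i x m\<bar> powr p))"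
    using b by (intro cmult[symmetric] bounded_seq_sum) auto
  also have "\<dots> \<le> \<Lambda> (\<lambda>_. 2 powr p * (C * norm x powr p))"
  proof (rule mono)
    show "bounded_seq (\<lambda>m. (1 / 2^n) * (\<Sum>i<2^n. \<bar>\<alpha> n i x m\<bar> powr p))"
      using b by (intro bounded_seq_cmult bounded_seq_sum) auto
    fix m
    have "(1 / 2^n) * (\<Sum>i<2^n. \<bar>\<alpha> n i x m\<bar> powr p) \<le> 2 powr p * moment p (F m x)"
      using sum_dyadic_average_powr_le[OF F_Lp, of n m x] p by (simp add: \<alpha>_def)
    also have "\<dots> \<le> 2 powr p * (C * norm x powr p)"
      using F_bound[of m x "norm x"] linf_abs_le_norm[of x] False by (intro mult_left_mono) auto
    finally show "(1 / 2^n) * (\<Sum>i<2^n. \<bar>\<alpha> n i x m\<bar> powr p) \<le> 2 powr p * (C * norm x powr p)" .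
  qed (rule bounded_seq_const)
  also have "\<dots> = 2 powr p * (C * norm x powr p)" by (rule const)
  also have "2 powr p * (2 powr p * (C * norm x powr p)) = 4 powr p * (C * norm x powr p)"
    by (simp flip: mult.assoc powr_mult)
  finally show ?thesis by (simp add: mult_left_mono)
qed

text \<open>Any density with the limiting means; these determine it almost everywhere, by
  \<open>dyadic_integrals_unique\<close>.\<close>

definition T :: "linf \<Rightarrow> real \<Rightarrow> real" where
  "T x = (SOME f. f \<in> Lp_fun p \<and> moment p f \<le> 4 powr p * (C * norm x powr p) \<and>
     (\<forall>n. \<forall>i<2^n. dyadic_int n i f = \<nu> x n i / 2^n))"

lemma T: "T x \<in> Lp_fun p" "moment p (T x) \<le> 4 powr p * (C * norm x powr p)"
    "i < 2^n \<Longrightarrow> dyadic_int n i (T x) = \<nu> x n i / 2^n"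
proof -
  obtain f where "f \<in> Lp_fun p" "moment p f \<le> 4 powr p * (C * norm x powr p)"
     "\<And>n i. i < 2^n \<Longrightarrow> dyadic_int n i f = \<nu> x n i / 2^n"
  proof (rule dyadic_density[OF p, of "\<nu> x" "4 powr p * (C * norm x powr p)"])
    show "\<nu> x n i = (\<nu> x (Suc n) (2 * i) + \<nu> x (Suc n) (2 * i + 1)) / 2" if "i < 2^n" for n i
      by (rule \<nu>_consistent[OF that])
    show "(\<Sum>i<2^n. \<bar>\<nu> x n i\<bar> powr p) / 2^n \<le> 4 powr p * (C * norm x powr p)" for n by (rule \<nu>_bound)
  qed blast
  then have "f \<in> Lp_fun p \<and> moment p f \<le> 4 powr p * (C * norm x powr p) \<and>
     (\<forall>n. \<forall>i<2^n. dyadic_int n i f = \<nu> x n i / 2^n)"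
    by blast
  from someI[of "\<lambda>f. f \<in> Lp_fun p \<and> moment p f \<le> 4 powr p * (C * norm x powr p) \<and>
     (\<forall>n. \<forall>i<2^n. dyadic_int n i f = \<nu> x n i / 2^n)", OF this]
  show "T x \<in> Lp_fun p" "moment p (T x) \<le> 4 powr p * (C * norm x powr p)"
    "i < 2^n \<Longrightarrow> dyadic_int n i (T x) = \<nu> x n i / 2^n"
    unfolding T_def[symmetric] by auto
qed

lemma T_int: "integrable I01 (T x)" using Lp_fun_imp_integrable[OF T(1)] p by simp

text \<open>Reduces almost-everywhere identities for \<open>T\<close> to identities between the
  means \<nu>.\<close>

lemma T_eqI:
  assumes f: "integrable I01 f" and eq: "\<And>n i. i < 2^n \<Longrightarrow> 2^n * dyadic_int n i f = \<nu> x n i"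
  shows "AE t in I01. T x t = f t"
proof (rule dyadic_integrals_unique[OF T_int f])
  fix n i :: nat assume i: "i < 2^n"
  show "dyadic_int n i (T x) = dyadic_int n i f"
    unfolding T(3)[OF i] eq[OF i, symmetric] by simp
qed

lemma T_add: "AE t in I01. T (x + y) t = T x t + T y t"
proof (rule T_eqI)
  show "integrable I01 (\<lambda>t. T x t + T y t)" using T_int by simp
  fix n i :: nat assume i: "i < 2^n"
  show "2^n * (\<integral>t. indicator (dyadic n i) t * (T x t + T y t) \<partial>I01) = \<nu> (x + y) n i"
    using integrable_indicator_mult[OF T_int, of "dyadic n i"] T(3)[OF i]
    by (simp add: distrib_left \<nu>_add[OF i])
qed

lemma T_scale: "AE t in I01. T (a *\<^sub>R x) t = a * T x t"
proof (rule T_eqI)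
  show "integrable I01 (\<lambda>t. a * T x t)" using T_int by simp
  fix n i :: nat assume i: "i < 2^n"
  show "2^n * (\<integral>t. indicator (dyadic n i) t * (a * T x t) \<partial>I01) = \<nu> (a *\<^sub>R x) n i"
    using T(3)[OF i, of x] by (simp add: mult.left_commute \<nu>_scale[OF i])
qed

lemma T_diff: "AE t in I01. T (x - y) t = T x t - T y t"
  using T_add[of x "(-1) *\<^sub>R y"] T_scale[of "-1" y] by eventually_elim simp

text \<open>The block of level m sits at positions not below m (\<open>le_prod_encode_1\<close>), so
  for x in \<open>c0\<close> its entries tend to 0, and with them the means.\<close>

lemma T_c0: assumes x: "x \<in> c0" shows "AE t in I01. T x t = 0"
proof (rule T_eqI)
  fix n i :: nat assume i: "i < 2^n"
  have "\<alpha> n i x \<longlonglongrightarrow> 0"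
  proof (rule LIMSEQ_I)
    fix e :: real assume e: "e > 0"
    have D0: "D n \<ge> 0" by (simp add: D_def)
    define b where "b = e / (2 * (D n + 1))"
    have b: "b > 0" "D n * b < e" using e D0 by (auto simp: b_def field_simps intro: add_pos_nonneg)
    obtain m0 where m0: "\<And>k. k \<ge> m0 \<Longrightarrow> \<bar>apply_bcontfun x k\<bar> < b"
      using x b(1) unfolding c0_def by (force dest: LIMSEQ_D)
    have "norm (\<alpha> n i x m - 0) < e" if m: "m \<ge> m0" for m
    proof -
      have "\<bar>\<alpha> n i x m\<bar> \<le> D n * b"
        by (rule \<alpha>_bound[OF i _ b(1)]) (use m0 m le_prod_encode_1 in \<open>meson less_imp_le order_trans\<close>)
      then show ?thesis using b(2) by simp
    qed
    then show "\<exists>m0. \<forall>m\<ge>m0. norm (\<alpha> n i x m - 0) < e" by blast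
  qed
  then show "2^n * (\<integral>t. indicator (dyadic n i) t * 0 \<partial>I01) = \<nu> x n i" by (simp add: \<nu>_def lim)
qed simp

lemma Lp_norm_eq_0: "f \<in> Lp_fun p \<Longrightarrow> Lp_norm p f = 0 \<Longrightarrow> AE t in I01. f t = 0"
proof -
  assume f: "f \<in> Lp_fun p" and "Lp_norm p f = 0"
  then have "moment p f = 0" by (simp add: Lp_norm_def)
  then have "AE t in I01. \<bar>f t\<bar> powr p = 0"
    using integral_nonneg_eq_0_iff_AE[OF Lp_fun_integrable(1)[OF f]] by simp
  then show ?thesis by eventually_elim simp
qed

lemma Lp_norm_cong: "f \<in> Lp_fun p \<Longrightarrow> g \<in> Lp_fun p \<Longrightarrow> AE t in I01. f t = g t \<Longrightarrow> Lp_norm p f = Lp_norm p g"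
  unfolding Lp_norm_def
  by (intro arg_cong[where f = "\<lambda>u. u powr (1/p)"] integral_cong_AE) (auto simp: Lp_fun_def)

lemma T_upper: "Lp_norm p (T x) \<le> 4 * C powr (1 / p) * norm x"
proof -
  have "Lp_norm p (T x) \<le> (4 powr p * (C * norm x powr p)) powr (1 / p)"
    unfolding Lp_norm_def using T(2)[of x] p by (intro powr_mono2) (auto intro: integral_nonneg_AE)
  also have "\<dots> = 4 * C powr (1 / p) * norm x" using p C by (simp add: powr_mult powr_powr)
  finally show ?thesis .
qed

text \<open>Each level lifts the means of f over its own cells, and these lifts are stored together
  in one sequence. A mean over a level-n cell agrees with that of f once \<open>m \<ge> n\<close>,
  so the limit is that of an eventually constant sequence.\<close>

lemma T_lift:
  assumes f: "f \<in> Lp_fun p"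
  shows "\<exists>x. (AE t in I01. T x t = f t) \<and> norm x \<le> 2 * C * Lp_norm p f"
proof (cases "Lp_norm p f = 0")
  case True
  have "AE t in I01. T 0 t = f t"
  proof -
    have "AE t in I01. T 0 t = 0" using T_scale[of 0 0] by simp
    with Lp_norm_eq_0[OF f True] show ?thesis by eventually_elim simp
  qed
  then have "(AE t in I01. T 0 t = f t) \<and> norm (0::linf) \<le> 2 * C * Lp_norm p f" using True by simp
  then show ?thesis by blast
next
  case False
  have "Lp_norm p f \<ge> 0" by (simp add: Lp_norm_def)
  \<comment> \<open>The factor 2 absorbs the \<open>2 powr p\<close> in the moment bound for the
    means of f.\<close>
  define R where "R = 2 * Lp_norm p f"
  have R: "R > 0" using False \<open>Lp_norm p f \<ge> 0\<close> by (simp add: R_def)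
  have fi: "integrable I01 f" using Lp_fun_imp_integrable[OF f] p by simp
  have Rp: "R powr p = 2 powr p * moment p f"
    unfolding R_def Lp_norm_def using p by (simp add: powr_mult powr_powr integral_nonneg_AE)
  define c where "c n i = 2^n * dyadic_int n i f" for n i
  have c_bound: "(\<Sum>i<2^n. \<bar>c n i\<bar> powr p) / 2^n \<le> R powr p" for n
    unfolding c_def Rp using p by (intro sum_dyadic_average_powr_le f) simp
  have "\<exists>y. (\<forall>w\<in>{..<K m}. \<bar>y w\<bar> \<le> C) \<and> (\<forall>i<2^m. (\<Sum>w<K m. X m i w * y w) = c m i / ((2^m) powr (1/p) * R))" for m
  proof -
    have "(\<Sum>i<2^m. \<bar>c m i / ((2^m) powr (1/p) * R)\<bar> powr p) = (\<Sum>i<2^m. \<bar>c m i\<bar> powr p / (2^m * R powr p))"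
      using R p by (intro sum.cong) (auto simp: powr_divide powr_mult powr_powr abs_mult)
    also have "\<dots> = ((\<Sum>i<2^m. \<bar>c m i\<bar> powr p) / 2^m) / R powr p" by (simp add: sum_divide_distrib)
    also have "\<dots> \<le> 1"
    proof (rule divide_le_eq_1_pos[THEN iffD2])
      show "0 < R powr p" using R by simp
    qed (rule c_bound)
    finally have "(\<Sum>i<2^m. \<bar>c m i / ((2^m) powr (1/p) * R)\<bar> powr p) \<le> 1" .
    moreover have "\<forall>f. (\<Sum>i<2^m. \<bar>f i\<bar> powr p) \<le> 1 \<longrightarrow>
        (\<exists>y. (\<forall>w\<in>{..<K m}. \<bar>y w\<bar> \<le> C) \<and> (\<forall>i<2^m. (\<Sum>w<K m. X m i w * y w) = f i))"
      using kernel[of m] unfolding Lp_kernel_def by (elim conjE)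
    ultimately show ?thesis by (elim allE[of _ "\<lambda>i. c m i / ((2^m) powr (1/p) * R)"] impE)
  qed
  then obtain y where y: "\<And>m w. w < K m \<Longrightarrow> \<bar>y m w\<bar> \<le> C"
    "\<And>m i. i < 2^m \<Longrightarrow> (\<Sum>w<K m. X m i w * y m w) = c m i / ((2^m) powr (1/p) * R)" by (metis lessThan_iff)
  \<comment> \<open>Positions outside the blocks hold 0; the factor \<open>R\<close> undoes the
    normalisation to the unit ball.\<close>
  define z where "z k = (case prod_decode k of (m, w) \<Rightarrow> if w < K m then R * y m w else 0)" for k
  have zb: "\<bar>z k\<bar> \<le> R * C" for k
    using y(1) R C by (auto simp: z_def abs_mult split: prod.splits)
  define x where "x = (Bcontfun z :: linf)"
  have xk: "apply_bcontfun x k = z k" for k unfolding x_def using linf_apply_Bcontfun[of z, OF zb] by simp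
  have xn: "norm x \<le> 2 * C * Lp_norm p f"
    by (rule linf_norm_le) (use zb in \<open>simp add: xk R_def mult_ac\<close>)
  have coef: "coef m i x = c m i" if "i < 2^m" for m i
  proof -
    have "(\<Sum>w<K m. X m i w * apply_bcontfun x (prod_encode (m, w))) = (\<Sum>w<K m. R * (X m i w * y m w))"
      by (rule sum.cong) (auto simp: xk z_def)
    then have "coef m i x = (2^m) powr (1/p) * (R * (\<Sum>w<K m. X m i w * y m w))"
      unfolding coef_def by (simp only: sum_distrib_left)
    then show ?thesis using y(2)[OF that] R by simp
  qed
  have \<alpha>: "\<alpha> n i x m = c n i" if "n \<le> m" "i < 2^n" for n m i
  proof -
    have "dyadic_int n i (F m x) = c n i / 2^n"
    proof (rule dyadic_integrals_coarser[OF _ F_int _ that])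
      show "c n i = (c (Suc n) (2 * i) + c (Suc n) (2 * i + 1)) / 2" for n i
        unfolding c_def using integral_dyadic_split[OF fi, of n i] by (simp add: algebra_simps)
      show "dyadic_int m i (F m x) = c m i / 2^m" if "i < 2^m" for i
        unfolding F_def integral_dyadic_step[OF that] coef[OF that] ..
    qed
    then show ?thesis by (simp add: \<alpha>_def)
  qed
  have "AE t in I01. T x t = f t"
  proof (rule T_eqI[OF fi])
    fix n i :: nat assume i: "i < 2^n"
    have "\<alpha> n i x \<longlonglongrightarrow> c n i"
      using \<alpha> i by (intro tendsto_eventually eventually_sequentiallyI[of n]) auto
    then show "2^n * dyadic_int n i f = \<nu> x n i"
      by (simp add: \<nu>_def lim c_def)
  qed
  then show ?thesis using xn by blast
qed

definition N :: "linf set" where "N = {x. AE t in I01. T x t = 0}"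

lemma subspace_N: "subspace N"
  unfolding subspace_def N_def
proof (intro conjI ballI allI; (unfold mem_Collect_eq)?)
  show "AE t in I01. T 0 t = 0" using T_scale[of 0 0] by eventually_elim simp
  show "AE t in I01. T (x + y) t = 0" if "AE t in I01. T x t = 0" "AE t in I01. T y t = 0" for x y
    using T_add[of x y] that by eventually_elim simp
  show "AE t in I01. T (a *\<^sub>R x) t = 0" if "AE t in I01. T x t = 0" for a x
    using T_scale[of a x] that by eventually_elim simp
qed

lemma T_upper_infdist: "Lp_norm p (T x) \<le> 4 * C powr (1 / p) * infdist x N"
proof (rule le_mult_infdist)
  show "N \<noteq> {}" using subspace_0[OF subspace_N] by auto
  fix u assume "u \<in> N"
  then have "AE t in I01. T u t = 0" by (simp add: N_def)
  with T_diff[of x u] have "AE t in I01. T x t = T (x - u) t" by eventually_elim simp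
  then have "Lp_norm p (T x) = Lp_norm p (T (x - u))" using T(1) by (intro Lp_norm_cong)
  then show "Lp_norm p (T x) \<le> 4 * C powr (1 / p) * dist x u" using T_upper[of "x - u"] by (simp add: dist_norm)
qed simp

text \<open>T x has a lift x' of controlled norm, and x - x' lies in \<open>N\<close>; hence x is
  within \<open>norm x'\<close> of \<open>N\<close>.\<close>

lemma T_lower_infdist: "(1 / (2 * C)) * infdist x N \<le> Lp_norm p (T x)"
proof -
  obtain x' where x': "AE t in I01. T x' t = T x t" "norm x' \<le> 2 * C * Lp_norm p (T x)"
    using T_lift[OF T(1)] by blast
  have "AE t in I01. T (x - x') t = 0" using T_diff[of x x'] x'(1) by eventually_elim simp
  then have "x - x' \<in> N" by (simp add: N_def)
  then have "infdist x N \<le> norm x'" using infdist_le[of "x - x'" N x] by (simp add: dist_norm)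
  then show ?thesis using x'(2) C by (simp add: field_simps)
qed

text \<open>On the closure the distance to \<open>N\<close> is 0, and the upper bound of
  \<open>T\<close> by this distance puts such points into \<open>N\<close>.\<close>

lemma closed_subspace_N: "closed_subspace N"
  unfolding closed_subspace_def
proof (intro conjI subspace_N)
  have ne: "N \<noteq> {}" using subspace_0[OF subspace_N] by auto
  have "x \<in> N" if "x \<in> closure N" for x
  proof -
    have "infdist x N = 0" using that ne in_closure_iff_infdist_zero by blast
    then have "Lp_norm p (T x) = 0" using T_upper_infdist[of x] by (simp add: Lp_norm_def)
    then show ?thesis using Lp_norm_eq_0[OF T(1)] by (simp add: N_def)
  qed
  then show "closed N" using closure_subset_eq by blast
qed

lemma quot_iso_N: "quot_iso_Lp N p"
  unfolding quot_iso_Lp_def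
proof (intro exI[of _ T] conjI allI ballI)
  show "\<exists>C>0. \<forall>x. Lp_norm p (T x) \<le> C * infdist x N"
    using T_upper_infdist C by (intro exI[of _ "4 * C powr (1 / p)"]) simp
  show "\<exists>c>0. \<forall>x. c * infdist x N \<le> Lp_norm p (T x)"
    using T_lower_infdist C by (intro exI[of _ "1 / (2 * C)"]) simp
  show "\<exists>x. AE t in I01. T x t = f t" if "f \<in> Lp_fun p" for f using T_lift[OF that] by blast
  show "(AE t in I01. T x t = 0) = (x \<in> N)" for x by (simp add: N_def)
qed (fact T(1) T_add T_scale)+

end

theorem quot_iso_Lp_exists:
  assumes "p \<ge> 2"
  shows "\<exists>N. closed_subspace N \<and> c0 \<subseteq> N \<and> quot_iso_Lp N p"
proof -
  obtain C where C: "C > 0" "\<And>n. \<exists>K X. Lp_kernel p C n {..<K::nat} X"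
    using finite_Lp_kernel[OF assms] by blast
  have "\<forall>m. \<exists>g. Lp_kernel p C (2^m) {..<fst g :: nat} (snd g)" using C(2) by (metis fst_conv snd_conv)
  then obtain g where "\<forall>m. Lp_kernel p C (2^m) {..<fst (g m) :: nat} (snd (g m))" by (rule choice[THEN exE])
  moreover obtain \<Lambda> where "limit_functional \<Lambda>" by (rule limit_functional_exists)
  ultimately interpret kernel_system \<Lambda> p C "\<lambda>m. fst (g m)" "\<lambda>m. snd (g m)"
    using assms C(1) by (simp add: kernel_system_def kernel_system_axioms_def)
  show ?thesis using closed_subspace_N quot_iso_N T_c0 by (intro exI[of _ N]) (auto simp: N_def)
qed

theorem theorem3p3:
  shows "(\<forall>p::real. 2 \<le> p \<longrightarrow>
            (\<exists>N. closed_subspace N \<and> c0 \<subseteq> N \<and> quot_iso_Lp N p) \<and>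
            (\<forall>N. closed_subspace N \<and> c0 \<subseteq> N \<and> quot_iso_Lp N p
                   \<longrightarrow> linf_grothendieck N)) \<and>
         (\<forall>(p::real) (r::real) Np Nr. 2 \<le> p \<and> 2 \<le> r \<and> p \<noteq> r \<and>
            closed_subspace Np \<and> c0 \<subseteq> Np \<and> quot_iso_Lp Np p \<and>
            closed_subspace Nr \<and> c0 \<subseteq> Nr \<and> quot_iso_Lp Nr r
            \<longrightarrow> \<not> subspace_iso Np Nr)"
proof (intro conjI allI impI, goal_cases)
  case (1 p)
  then show ?case by (rule quot_iso_Lp_exists)
next
  case (2 p N)
  then show ?case using quot_iso_Lp_imp_grothendieck by blast
next
  case (3 p r Np Nr)
  then have S: "subspace Np" "subspace Nr" by (auto simp: closed_subspace_def)
  obtain Tp Cp cp where P: "Lp_quotient Np p Tp Cp cp" using quot_iso_Lp_obtain[of Np p] S 3 by blast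
  obtain Tr Cr cr where R: "Lp_quotient Nr r Tr Cr cr" using quot_iso_Lp_obtain[of Nr r] S 3 by blast
  show ?case
  proof
    assume iso: "subspace_iso Np Nr"
    obtain V W KV KW where V: "linear V" "\<And>x. norm (V x) \<le> KV * norm x" "KV \<ge> 0" "\<And>u. u \<in> Np \<Longrightarrow> V u \<in> Nr"
      and W: "linear W" "\<And>x. norm (W x) \<le> KW * norm x" "KW \<ge> 0" "\<And>u. u \<in> Nr \<Longrightarrow> W u \<in> Np"
      and VW: "\<And>u. u \<in> Np \<Longrightarrow> W (V u) = u" "\<And>u. u \<in> Nr \<Longrightarrow> V (W u) = u"
      by (rule subspace_iso_extend[OF iso S]) (rule that; assumption)
    \<comment> \<open>The data are symmetric: for r < p the two subspaces and the operators V and W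
      exchange roles.\<close>
    have "p < r \<or> r < p" using 3 by auto
    then show False
    proof
      assume "p < r"
      then show False by (rule no_factorization[OF P R _ V W VW(2)])
    next
      assume "r < p"
      then show False by (rule no_factorization[OF R P _ W V VW(1)])
    qed
  qed
qed

end
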